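(* For every $1\le n\le\infty$, the universal dendrite $U_n$ of order $n$ admits a homeomorphism $U_n\to U_n$ with the shadowing property.
   Context: A dendrite is a locally connected continuum (non-empty compact connected metric space) which does not contain a simple closed curve. The order of a point $p$ in a dendrite $X$ is the number of connected components of $X\setminus\{p\}$ (always countable; order $\infty$ means countably infinite). A branch point is a point of order at least $3$. For $n\ge 3$ (including $n=\infty$), the universal dendrite of order $n$, denoted $U_n$, is a dendrite whose set of branch points is dense in it and each of whose branch points has order $n$; it is known to be unique up to homeomorphism. By convention $U_2$ is the arc $[0,1]$ and $U_1$ is a single point. A homeomorphism $g\colon Y\to Y$ of a compact metric space $(Y,\rho)$ has the shadowing property if for every $\varepsilon>0$ there is $\delta>0$ such that for each sequence $(x_n)_{n\in\mathbb{Z}}$ in $Y$ with $\rho(g(x_n),x_{n+1})<\delta$ for all $n\in\mathbb{Z}$ there is $y\in Y$ with $\rho(g^n(y),x_n)<\varepsilon$ for all $n\in\mathbb{Z}$. *)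

theory Defs
  imports "HOL-Analysis.Analysis" "HOL-Library.Extended_Nat"
begin

definition dendrite :: "'a::metric_space set \<Rightarrow> bool" where
  "dendrite X \<longleftrightarrow>
     X \<noteq> {} \<and> compact X \<and> connected X \<and> locally connected X \<and>
     \<not> (\<exists>C\<subseteq>X. C homeomorphic sphere (0::complex) 1)"

text \<open>In a dendrite there are only countably many components of the complement of a point,
  so the value \<open>\<infinity>\<close> stands for countably infinitely many.\<close>

definition point_order :: "'a::metric_space set \<Rightarrow> 'a \<Rightarrow> enat" where
  "point_order X p =
     (if finite (components (X - {p})) then enat (card (components (X - {p}))) else \<infinity>)"

definition branch_points :: "'a::metric_space set \<Rightarrow> 'a set" where
  "branch_points X = {p \<in> X. 3 \<le> point_order X p}"

text \<open>\<open>universal_dendrite n X\<close>: the space \<open>X\<close> is (a homeomorphic copy of) \<open>U\<^sub>n\<close>.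
  The cases \<open>n = 1\<close> and \<open>n = 2\<close> are conventions; \<open>n = 0\<close> is excluded.\<close>

definition universal_dendrite :: "enat \<Rightarrow> 'a::metric_space set \<Rightarrow> bool" where
  "universal_dendrite n X \<longleftrightarrow>
     (n = 1 \<and> (\<exists>a. X = {a})) \<or>
     (n = 2 \<and> X homeomorphic {0..1::real}) \<or>
     (3 \<le> n \<and> dendrite X \<and> X \<subseteq> closure (branch_points X) \<and>
        (\<forall>p\<in>branch_points X. point_order X p = n))"

text \<open>Integer iterates of a bijection \<open>g\<close> of \<open>X\<close>; on \<open>X\<close>, \<open>inv_into X g\<close> is its inverse.\<close>

definition int_iterate :: "'a set \<Rightarrow> ('a \<Rightarrow> 'a) \<Rightarrow> int \<Rightarrow> 'a \<Rightarrow> 'a" where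
  "int_iterate X g k =
     (if 0 \<le> k then g ^^ nat k else inv_into X g ^^ nat (- k))"

definition shadowing_property :: "'a::metric_space set \<Rightarrow> ('a \<Rightarrow> 'a) \<Rightarrow> bool" where
  "shadowing_property X g \<longleftrightarrow>
     (\<forall>\<epsilon>>0. \<exists>\<delta>>0. \<forall>x :: int \<Rightarrow> 'a.
        (\<forall>k. x k \<in> X) \<and> (\<forall>k. dist (g (x k)) (x (k + 1)) < \<delta>) \<longrightarrow>
        (\<exists>y\<in>X. \<forall>k. dist (int_iterate X g k y) (x k) < \<epsilon>))"

end

theory Submission
  imports Defs "HOL-Real_Asymp.Real_Asymp"
begin

text \<open>
  A homeomorphism with exactly two fixed points, a repelling \<open>a\<close> and an attracting \<open>b\<close>, such that all
  other points travel from \<open>a\<close> to \<open>b\<close>, has the shadowing property: a pseudo-orbit that is neither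
  trapped near \<open>a\<close> nor trapped near \<open>b\<close> needs a bounded time for the passage between them. On the arc,
  \<open>x \<mapsto> x\<^sup>2\<close> is of this kind.

  For \<open>n \<ge> 3\<close> root the dendrite at an end point \<open>a\<close>, order it by \<open>x \<sqsubseteq> y\<close> iff \<open>x\<close> lies on the arc from
  \<open>a\<close> to \<open>y\<close>, and let \<open>b \<noteq> a\<close> be maximal. The branch points form a countable dense meet-tree in
  which all points have the same number of upper cones. By a back-and-forth argument any pair \<open>u \<sqsubset> v\<close>
  of branch points can be moved to any other such pair by an automorphism. Choose branch points
  \<open>p\<^sub>i\<close> (\<open>i \<in> \<int>\<close>) on the arc from \<open>a\<close> to \<open>b\<close>, increasing, with limits \<open>a\<close> and \<open>b\<close>. Automorphisms
  moving \<open>(p\<^sub>i, p\<^bsub>i+1\<^esub>)\<close> to \<open>(p\<^bsub>i+1\<^esub>, p\<^bsub>i+2\<^esub>)\<close>, each restricted to the points above \<open>p\<^sub>i\<close> but not above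
  \<open>p\<^bsub>i+1\<^esub>\<close>, glue to an automorphism that shifts the sequence. It extends to the whole
  dendrite, and the extension has the required dynamics.
\<close>

section \<open>Automorphisms of dense meet-trees\<close>

text \<open>The topology is accessed mainly through \<open>joined p x y\<close> (same component of
  the complement of \<open>p\<close>), and \<open>joined_above_iff\<close> turns this relation into
  order. So an order automorphism of the branch points preserves separation, and every other point
  is carried along, being determined by the side of each branch point on which it lies. The value of
  \<open>n\<close> enters through one count: all branch points have equally many upper cones, which
  supplies the free cone that a one-point extension needs. Two choices shape the construction. The
  root is an end point, so it is no branch point, and any two other points have a common lower bound
  other than the root; hence the \<open>p i\<close>, although they lie on one arc, get below every
  point except the root. And \<open>b\<close> is maximal, so any other point leaves the arc to
  \<open>b\<close> strictly before \<open>b\<close> and fails to lie above some \<open>p i\<close>.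
  For shadowing, consecutive levels have positive distance, which lets a pseudo-orbit cross the
  relevant ones in one direction only. The absence of circles is used once, to provide cut points.
  This needs arcs, hence the path-connectedness of Peano continua.\<close>

definition upper_cone :: "'b set \<Rightarrow> ('b \<Rightarrow> 'b \<Rightarrow> bool) \<Rightarrow> 'b \<Rightarrow> 'b \<Rightarrow> 'b set" where
  "upper_cone B le x b = {c \<in> B. \<exists>z\<in>B. le x z \<and> x \<noteq> z \<and> le z b \<and> le z c}"

text \<open>At a branch point \<open>x\<close> of the rooted dendrite, these are the traces on the
  branch points of the components of the complement of \<open>x\<close> other than that of the
  root.\<close>

definition upper_cones :: "'b set \<Rightarrow> ('b \<Rightarrow> 'b \<Rightarrow> bool) \<Rightarrow> 'b \<Rightarrow> 'b set set" where
  "upper_cones B le x = upper_cone B le x ` {b \<in> B. le x b \<and> x \<noteq> b}"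

text \<open>In \<open>cones_card\<close>, an infinite family has \<open>card\<close> 0. By
  \<open>no_max\<close> there is at least one cone, so equal cardinals mean: equally many, or
  infinitely many on both sides. The case of infinite order is thus included.\<close>

locale meet_tree =
  fixes B :: "'b set" and le :: "'b \<Rightarrow> 'b \<Rightarrow> bool" (infix \<open>\<sqsubseteq>\<close> 50)
  assumes refl [simp]: "x \<in> B \<Longrightarrow> x \<sqsubseteq> x"
    and antisym: "\<lbrakk>x \<in> B; y \<in> B; x \<sqsubseteq> y; y \<sqsubseteq> x\<rbrakk> \<Longrightarrow> x = y"
    and trans: "\<lbrakk>x \<in> B; y \<in> B; z \<in> B; x \<sqsubseteq> y; y \<sqsubseteq> z\<rbrakk> \<Longrightarrow> x \<sqsubseteq> z"
    and chain: "\<lbrakk>x \<in> B; y \<in> B; z \<in> B; x \<sqsubseteq> z; y \<sqsubseteq> z\<rbrakk> \<Longrightarrow> x \<sqsubseteq> y \<or> y \<sqsubseteq> x"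
    and meet_ex: "\<lbrakk>x \<in> B; y \<in> B\<rbrakk> \<Longrightarrow>
      \<exists>m\<in>B. m \<sqsubseteq> x \<and> m \<sqsubseteq> y \<and> (\<forall>z\<in>B. z \<sqsubseteq> x \<longrightarrow> z \<sqsubseteq> y \<longrightarrow> z \<sqsubseteq> m)"
    and dense: "\<lbrakk>x \<in> B; y \<in> B; x \<sqsubseteq> y; x \<noteq> y\<rbrakk> \<Longrightarrow> \<exists>z\<in>B. x \<sqsubseteq> z \<and> x \<noteq> z \<and> z \<sqsubseteq> y \<and> z \<noteq> y"
    and no_min: "x \<in> B \<Longrightarrow> \<exists>y\<in>B. y \<sqsubseteq> x \<and> y \<noteq> x"
    and no_max: "x \<in> B \<Longrightarrow> \<exists>y\<in>B. x \<sqsubseteq> y \<and> y \<noteq> x"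
    and cones_card: "\<lbrakk>x \<in> B; y \<in> B\<rbrakk> \<Longrightarrow> card (upper_cones B le x) = card (upper_cones B le y)"
begin

definition meet :: "'b \<Rightarrow> 'b \<Rightarrow> 'b" where
  "meet x y = (SOME m. m \<in> B \<and> m \<sqsubseteq> x \<and> m \<sqsubseteq> y \<and> (\<forall>z\<in>B. z \<sqsubseteq> x \<longrightarrow> z \<sqsubseteq> y \<longrightarrow> z \<sqsubseteq> m))"

lemma meet:
  assumes "x \<in> B" "y \<in> B"
  shows meet_in [simp]: "meet x y \<in> B" and meet_le1: "meet x y \<sqsubseteq> x" and meet_le2: "meet x y \<sqsubseteq> y"
    and meet_greatest: "\<lbrakk>z \<in> B; z \<sqsubseteq> x; z \<sqsubseteq> y\<rbrakk> \<Longrightarrow> z \<sqsubseteq> meet x y"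
proof -
  have "\<exists>m. m \<in> B \<and> m \<sqsubseteq> x \<and> m \<sqsubseteq> y \<and> (\<forall>z\<in>B. z \<sqsubseteq> x \<longrightarrow> z \<sqsubseteq> y \<longrightarrow> z \<sqsubseteq> m)"
    using meet_ex[OF assms] by blast
  from someI_ex[OF this]
  have *: "meet x y \<in> B \<and> meet x y \<sqsubseteq> x \<and> meet x y \<sqsubseteq> y \<and>
    (\<forall>z\<in>B. z \<sqsubseteq> x \<longrightarrow> z \<sqsubseteq> y \<longrightarrow> z \<sqsubseteq> meet x y)"
    unfolding meet_def .
  then show "meet x y \<in> B" "meet x y \<sqsubseteq> x" "meet x y \<sqsubseteq> y" by auto
  show "\<lbrakk>z \<in> B; z \<sqsubseteq> x; z \<sqsubseteq> y\<rbrakk> \<Longrightarrow> z \<sqsubseteq> meet x y" using * by blast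
qed

lemma meet_eqI:
  assumes "x \<in> B" "y \<in> B" "m \<in> B" "m \<sqsubseteq> x" "m \<sqsubseteq> y" "\<And>z. \<lbrakk>z \<in> B; z \<sqsubseteq> x; z \<sqsubseteq> y\<rbrakk> \<Longrightarrow> z \<sqsubseteq> m"
  shows "meet x y = m"
  by (intro antisym meet_in meet_greatest assms meet_le1 meet_le2)

lemma meet_commute: "\<lbrakk>x \<in> B; y \<in> B\<rbrakk> \<Longrightarrow> meet x y = meet y x"
  by (intro meet_eqI meet_in meet_greatest meet_le1 meet_le2)

lemma meet_absorb1: "\<lbrakk>x \<in> B; y \<in> B; x \<sqsubseteq> y\<rbrakk> \<Longrightarrow> meet x y = x"
  by (intro meet_eqI) auto

lemma meet_absorb2: "\<lbrakk>x \<in> B; y \<in> B; y \<sqsubseteq> x\<rbrakk> \<Longrightarrow> meet x y = y"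
  by (intro meet_eqI) auto

text \<open>Replaces equality of cones by a condition on meets, which partial isomorphisms preserve.
  If the meet \<open>m\<close> is strictly above \<open>x\<close>, any witness \<open>z\<close> for
  a point of one cone is comparable with \<open>m\<close> by \<open>chain\<close>, and the smaller
  of the two is a witness for the other cone.\<close>

lemma cone_eq_iff:
  assumes "x \<in> B" "b \<in> B" "c \<in> B" "x \<sqsubseteq> b" "x \<noteq> b" "x \<sqsubseteq> c" "x \<noteq> c"
  shows "upper_cone B le x b = upper_cone B le x c \<longleftrightarrow> meet b c \<noteq> x"
proof
  assume "upper_cone B le x b = upper_cone B le x c"
  moreover have "c \<in> upper_cone B le x c" using assms by (auto simp: upper_cone_def)
  ultimately obtain z where z: "z \<in> B" "x \<sqsubseteq> z" "x \<noteq> z" "z \<sqsubseteq> b" "z \<sqsubseteq> c"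
    by (auto simp: upper_cone_def)
  then have "z \<sqsubseteq> meet b c" using assms by (intro meet_greatest) auto
  then show "meet b c \<noteq> x" using z antisym[of x z] assms by auto
next
  assume ne: "meet b c \<noteq> x"
  define m where "m = meet b c"
  have m: "m \<in> B" "m \<sqsubseteq> b" "m \<sqsubseteq> c" "x \<sqsubseteq> m" "x \<noteq> m"
    using assms ne unfolding m_def by (auto intro: meet_le1 meet_le2 meet_greatest)
  have "upper_cone B le x b' \<subseteq> upper_cone B le x c'" if "b' \<in> B" "c' \<in> B" "m \<sqsubseteq> b'" "m \<sqsubseteq> c'" for b' c'
  proof
    fix d assume "d \<in> upper_cone B le x b'"
    then obtain z where z: "d \<in> B" "z \<in> B" "x \<sqsubseteq> z" "x \<noteq> z" "z \<sqsubseteq> b'" "z \<sqsubseteq> d"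
      by (auto simp: upper_cone_def)
    from chain[of z m b'] z m that have "z \<sqsubseteq> m \<or> m \<sqsubseteq> z" by auto
    then show "d \<in> upper_cone B le x c'"
    proof
      assume "z \<sqsubseteq> m"
      then have "z \<sqsubseteq> c'" using trans[of z m c'] z m that by auto
      then show ?thesis using z by (auto simp: upper_cone_def)
    next
      assume "m \<sqsubseteq> z"
      then have "m \<sqsubseteq> d" using trans[of m z d] z m by auto
      then show ?thesis using z m that by (auto simp: upper_cone_def)
    qed
  qed
  then show "upper_cone B le x b = upper_cone B le x c" using assms m by (simp add: subset_antisym)
qed

text \<open>Closure under meets makes a one-point extension possible; a finite relation rather than a function
  is used so that the converse step of the back-and-forth is the same statement for \<open>P\<inverse>\<close>.\<close>
definition partial_iso :: "('b \<times> 'b) set \<Rightarrow> bool" where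
  "partial_iso P \<longleftrightarrow> finite P \<and> P \<subseteq> B \<times> B \<and>
     (\<forall>x x' y y'. (x, x') \<in> P \<longrightarrow> (y, y') \<in> P \<longrightarrow>
        (x \<sqsubseteq> y \<longleftrightarrow> x' \<sqsubseteq> y') \<and> (meet x y, meet x' y') \<in> P)"

lemma partial_isoD:
  assumes "partial_iso P"
  shows "finite P" "(x, x') \<in> P \<Longrightarrow> x \<in> B" "(x, x') \<in> P \<Longrightarrow> x' \<in> B"
    "\<lbrakk>(x, x') \<in> P; (y, y') \<in> P\<rbrakk> \<Longrightarrow> x \<sqsubseteq> y \<longleftrightarrow> x' \<sqsubseteq> y'"
    "\<lbrakk>(x, x') \<in> P; (y, y') \<in> P\<rbrakk> \<Longrightarrow> (meet x y, meet x' y') \<in> P"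
  using assms unfolding partial_iso_def by blast+

lemma partial_iso_eq_iff:
  assumes "partial_iso P" "(x, x') \<in> P" "(y, y') \<in> P"
  shows "x = y \<longleftrightarrow> x' = y'"
proof -
  have B: "x \<in> B" "y \<in> B" "x' \<in> B" "y' \<in> B" using partial_isoD(2,3)[OF assms(1)] assms by blast+
  have "x \<sqsubseteq> y \<longleftrightarrow> x' \<sqsubseteq> y'" "y \<sqsubseteq> x \<longleftrightarrow> y' \<sqsubseteq> x'"
    using partial_isoD(4)[OF assms(1)] assms by blast+
  then show ?thesis using antisym[of x y] antisym[of x' y'] B by auto
qed

lemma partial_iso_converse: "partial_iso P \<Longrightarrow> partial_iso (P\<inverse>)"
  unfolding partial_iso_def by (auto 0 3)

lemma partial_iso_insert:
  assumes P: "partial_iso P" and c: "c \<in> B" "c' \<in> B"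
    and "\<And>a a'. (a, a') \<in> P \<Longrightarrow> (a \<sqsubseteq> c \<longleftrightarrow> a' \<sqsubseteq> c') \<and> (c \<sqsubseteq> a \<longleftrightarrow> c' \<sqsubseteq> a')"
    and "\<And>a a'. (a, a') \<in> P \<Longrightarrow> (meet a c, meet a' c') \<in> insert (c, c') P"
  shows "partial_iso (insert (c, c') P)"
proof -
  have comm: "meet c a = meet a c" "meet c' a' = meet a' c'" if "(a, a') \<in> P" for a a'
    using meet_commute c partial_isoD(2,3)[OF P that] by auto
  have self: "meet c c = c" "meet c' c' = c'"
    using c by (auto intro: meet_absorb1)
  show ?thesis
    unfolding partial_iso_def
  proof (intro conjI allI impI)
    show "finite (insert (c, c') P)" "insert (c, c') P \<subseteq> B \<times> B"
      using P c unfolding partial_iso_def by auto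
    fix x x' y y' assume "(x, x') \<in> insert (c, c') P" "(y, y') \<in> insert (c, c') P"
    then consider "x = c" "x' = c'" "y = c" "y' = c'" | "x = c" "x' = c'" "(y, y') \<in> P"
      | "(x, x') \<in> P" "y = c" "y' = c'" | "(x, x') \<in> P" "(y, y') \<in> P" by auto
    then show "x \<sqsubseteq> y \<longleftrightarrow> x' \<sqsubseteq> y'" "(meet x y, meet x' y') \<in> insert (c, c') P"
      by (cases; use assms self comm partial_isoD[OF P] in simp)+
  qed
qed

lemma finite_chain_max:
  assumes "finite S" "S \<noteq> {}" "S \<subseteq> B" "b \<in> B" "\<And>x. x \<in> S \<Longrightarrow> x \<sqsubseteq> b"
  obtains m where "m \<in> S" "\<And>x. x \<in> S \<Longrightarrow> x \<sqsubseteq> m"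
proof -
  have "\<exists>m\<in>S. \<forall>x\<in>S. x \<sqsubseteq> m"
    using assms
  proof (induction S rule: finite_ne_induct)
    case (insert y S)
    then obtain m where m: "m \<in> S" "\<forall>x\<in>S. x \<sqsubseteq> m" by auto
    have "y \<sqsubseteq> m \<or> m \<sqsubseteq> y" using chain[of y m b] insert.prems m by auto
    then show ?case
    proof
      assume "m \<sqsubseteq> y"
      then have "\<forall>x\<in>insert y S. x \<sqsubseteq> y" using trans[of _ m y] m insert.prems by auto
      then show ?thesis by blast
    qed (use m in blast)
  qed auto
  then show ?thesis using that by blast
qed

lemma finite_meet_closed_min:
  assumes "finite T" "T \<noteq> {}" "T \<subseteq> B" "\<And>x y. \<lbrakk>x \<in> T; y \<in> T\<rbrakk> \<Longrightarrow> meet x y \<in> T"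
  obtains m where "m \<in> T" "\<And>x. x \<in> T \<Longrightarrow> m \<sqsubseteq> x"
proof -
  \<comment> \<open>The lower bound is sought in \<open>T\<close> and not in \<open>S\<close>: the
    induction passes to meets, which may leave \<open>S\<close>.\<close>
  have "\<exists>m\<in>T. \<forall>x\<in>S. m \<sqsubseteq> x" if "finite S" "S \<noteq> {}" "S \<subseteq> T" for S
    using that
  proof (induction S rule: finite_ne_induct)
    case (singleton x)
    then have "x \<in> T" "x \<sqsubseteq> x" using assms(3) by auto
    then show ?case by blast
  next
    case (insert y S)
    then obtain m where m: "m \<in> T" "\<forall>x\<in>S. m \<sqsubseteq> x" by auto
    then have "meet y m \<sqsubseteq> x" if "x \<in> insert y S" for x
      using that insert.prems assms meet_le1[of y m] meet_le2[of y m] trans[of "meet y m" m x]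
      by (auto simp: subset_iff)
    then show ?case using assms(4)[of y m] m insert.prems by auto
  qed
  then have "\<exists>m\<in>T. \<forall>x\<in>T. m \<sqsubseteq> x" using assms by blast
  then show ?thesis using that by blast
qed

text \<open>The domain elements above \<open>c\<close> are closed under meets and so have a least
  one, \<open>a1\<close>; those below \<open>c\<close> form a chain and, if there are any, have a
  greatest one, \<open>a2\<close>. Any point strictly between the images of \<open>a2\<close> and
  \<open>a1\<close> can serve as the image of \<open>c\<close>; no cone has to be chosen.\<close>

lemma extend_below:
  assumes P: "partial_iso P" and a0: "(a0, a0') \<in> P" and c: "c \<in> B" "c \<sqsubseteq> a0"
  obtains c' where "c' \<in> B" "partial_iso (insert (c, c') P)"
proof (cases "c \<in> Domain P")
  case True
  then obtain c' where "(c, c') \<in> P" by auto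
  then show ?thesis using that[of c'] P partial_isoD[OF P] by (auto simp: insert_absorb)
next
  case False
  note PD = partial_isoD[OF P]
  have mem: "a \<in> B" "a' \<in> B" "a \<noteq> c" if "(a, a') \<in> P" for a a'
    using that PD False by auto
  define T where "T = {a \<in> Domain P. c \<sqsubseteq> a}"
  have "finite T" "T \<noteq> {}" "T \<subseteq> B"
    using PD(1) a0 c mem by (auto simp: T_def finite_Domain)
  moreover have "meet x y \<in> T" if xy: "x \<in> T" "y \<in> T" for x y
  proof -
    obtain x' y' where "(x, x') \<in> P" "(y, y') \<in> P" "c \<sqsubseteq> x" "c \<sqsubseteq> y" using xy unfolding T_def by blast
    then have "(meet x y, meet x' y') \<in> P" "c \<sqsubseteq> meet x y"
      using PD(5) mem c by (auto intro: meet_greatest)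
    then show ?thesis unfolding T_def by blast
  qed
  ultimately obtain a1 where "a1 \<in> T" "\<And>x. x \<in> T \<Longrightarrow> a1 \<sqsubseteq> x"
    using finite_meet_closed_min by blast
  then obtain a1' where a1: "(a1, a1') \<in> P" "c \<sqsubseteq> a1" "\<And>x x'. \<lbrakk>(x, x') \<in> P; c \<sqsubseteq> x\<rbrakk> \<Longrightarrow> a1 \<sqsubseteq> x"
    unfolding T_def by blast
  define S where "S = {a \<in> Domain P. a \<sqsubseteq> c}"
  have S: "finite S" "S \<subseteq> B" using PD(1) mem by (auto simp: S_def finite_Domain)
  have "\<exists>c'\<in>B. c' \<sqsubseteq> a1' \<and> c' \<noteq> a1' \<and> (\<forall>a a'. (a, a') \<in> P \<longrightarrow> a \<sqsubseteq> c \<longrightarrow> a' \<sqsubseteq> c' \<and> a' \<noteq> c')"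
  proof (cases "S = {}")
    case True
    then show ?thesis using no_min[of a1'] mem[OF a1(1)] by (auto simp: S_def)
  next
    case False
    then obtain a2 where "a2 \<in> S" "\<And>x. x \<in> S \<Longrightarrow> x \<sqsubseteq> a2"
      using finite_chain_max[OF S(1) False S(2) c(1)] by (auto simp: S_def)
    then obtain a2' where a2: "(a2, a2') \<in> P" "a2 \<sqsubseteq> c" "\<And>x x'. \<lbrakk>(x, x') \<in> P; x \<sqsubseteq> c\<rbrakk> \<Longrightarrow> x \<sqsubseteq> a2"
      unfolding S_def by blast
    have "a2 \<sqsubseteq> a1" using trans[of a2 c a1] a1 a2 mem c by blast
    moreover have "a2 \<noteq> a1" using antisym[of a2 c] mem c a1 a2 by metis
    ultimately have "a2' \<sqsubseteq> a1'" "a2' \<noteq> a1'"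
      using PD(4) partial_iso_eq_iff[OF P] a1 a2 by metis+
    then obtain c' where c': "c' \<in> B" "a2' \<sqsubseteq> c'" "a2' \<noteq> c'" "c' \<sqsubseteq> a1'" "c' \<noteq> a1'"
      using dense mem a1 a2 by metis
    have "a' \<sqsubseteq> c' \<and> a' \<noteq> c'" if "(a, a') \<in> P" "a \<sqsubseteq> c" for a a'
    proof -
      have "a' \<sqsubseteq> a2'" using a2 that PD(4) by metis
      then show ?thesis
        using trans[of a' a2' c'] antisym[of a2' c'] c' mem that a2(1) by metis
    qed
    then show ?thesis using c' by blast
  qed
  then obtain c' where c': "c' \<in> B" "c' \<sqsubseteq> a1'" "c' \<noteq> a1'"
    and below: "\<And>a a'. \<lbrakk>(a, a') \<in> P; a \<sqsubseteq> c\<rbrakk> \<Longrightarrow> a' \<sqsubseteq> c' \<and> a' \<noteq> c'" by blast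
  have above: "c' \<sqsubseteq> a'" if "(a, a') \<in> P" "c \<sqsubseteq> a" for a a'
  proof -
    have "a1' \<sqsubseteq> a'" using a1 that PD(4) by metis
    then show ?thesis using trans[of c' a1' a'] c' mem that a1 by metis
  qed
  \<comment> \<open>The position of \<open>a\<close> relative to \<open>c\<close> is decided by
    \<open>meet a a1\<close>, an element of the domain which lies below \<open>a1\<close> and is
    therefore comparable with \<open>c\<close>.\<close>
  have dich: "(meet a a1, meet a' a1') \<in> P \<and> (meet a a1 \<sqsubseteq> c \<or> c \<sqsubseteq> meet a a1)" if "(a, a') \<in> P" for a a'
    using that PD(5) a1 mem c chain[of "meet a a1" c a1] meet_le2[of a a1] by auto
  have le_iff: "a \<sqsubseteq> c \<longleftrightarrow> a' \<sqsubseteq> c'" if a: "(a, a') \<in> P" for a a'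
  proof
    assume "a' \<sqsubseteq> c'"
    then have "a' \<sqsubseteq> a1'" using trans[of a' c' a1'] c' mem a a1 by metis
    then have "a \<sqsubseteq> a1" using PD(4) a a1 by metis
    have "\<not> c \<sqsubseteq> a"
    proof
      assume "c \<sqsubseteq> a"
      then have "c' = a'" using above[OF a] antisym[of c' a'] \<open>a' \<sqsubseteq> c'\<close> c' mem a by metis
      moreover have "a1' \<sqsubseteq> a'" using a1 a PD(4) \<open>c \<sqsubseteq> a\<close> by metis
      ultimately show False using c' antisym[of c' a1'] mem a1 by metis
    qed
    then show "a \<sqsubseteq> c" using chain[of a c a1] \<open>a \<sqsubseteq> a1\<close> a1 mem a c by metis
  qed (use below a in blast)
  have ge_iff: "c \<sqsubseteq> a \<longleftrightarrow> c' \<sqsubseteq> a'" if a: "(a, a') \<in> P" for a a'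
  proof
    assume "c' \<sqsubseteq> a'"
    then have *: "c' \<sqsubseteq> meet a' a1'" using c' mem a a1 by (auto intro: meet_greatest)
    have "\<not> meet a a1 \<sqsubseteq> c"
      using dich[OF a] below[of "meet a a1" "meet a' a1'"] * antisym[of c' "meet a' a1'"] c' mem by metis
    then have "c \<sqsubseteq> meet a a1" using dich[OF a] by blast
    then show "c \<sqsubseteq> a" using trans[of c "meet a a1" a] meet_le1[of a a1] c mem a a1 meet_in by metis
  qed (use above a in blast)
  have "(meet a c, meet a' c') \<in> insert (c, c') P" if a: "(a, a') \<in> P" for a a'
  proof (cases "c \<sqsubseteq> a")
    case True
    then have "meet a c = c" "meet a' c' = c'"
      using ge_iff[OF a] c c' mem[OF a] by (auto intro: meet_absorb2)
    then show ?thesis by simp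
  next
    case False
    \<comment> \<open>If \<open>c\<close> is not below \<open>a\<close>, then \<open>a\<close>
      leaves the chain under \<open>a1\<close> already below \<open>c\<close>, so the new meet is an
      old one.\<close>
    define e e' where "e = meet a a1" and "e' = meet a' a1'"
    have e: "(e, e') \<in> P" "e \<sqsubseteq> a" "e' \<sqsubseteq> a'"
      using dich[OF a] mem a a1 by (auto simp: e_def e'_def intro: meet_le1)
    have "\<not> c \<sqsubseteq> e" using trans[of c e a] False e mem a c by metis
    then have ec: "e \<sqsubseteq> c" using dich[OF a] e_def by blast
    have "meet a c = e"
    proof (rule meet_eqI)
      fix z assume z: "z \<in> B" "z \<sqsubseteq> a" "z \<sqsubseteq> c"
      then have "z \<sqsubseteq> a1" using trans[of z c a1] a1 c mem by metis
      then show "z \<sqsubseteq> e" using z mem a a1 by (auto simp: e_def intro: meet_greatest)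
    qed (use e ec mem a c in auto)
    moreover have "meet a' c' = e'"
    proof (rule meet_eqI)
      fix z assume z: "z \<in> B" "z \<sqsubseteq> a'" "z \<sqsubseteq> c'"
      then have "z \<sqsubseteq> a1'" using trans[of z c' a1'] a1 c' mem by metis
      then show "z \<sqsubseteq> e'" using z mem a a1 by (auto simp: e'_def intro: meet_greatest)
    qed (use e ec mem a c' le_iff[OF e(1)] in auto)
    ultimately show ?thesis using e by auto
  qed
  then have "partial_iso (insert (c, c') P)"
    using le_iff ge_iff by (intro partial_iso_insert P c(1) c'(1)) auto
  then show ?thesis using that c' by blast
qed

text \<open>By \<open>gate\<close>, the cone of \<open>b\<close> at \<open>c\<close> contains no
  domain element. Corresponding pairs of \<open>P\<close> occupy equally many cones at
  \<open>c\<close> and at \<open>c'\<close>; as the total numbers agree, some cone at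
  \<open>c'\<close> is free, and any point of it can be the image of \<open>b\<close>.\<close>

lemma extend_above:
  assumes P: "partial_iso P" and c: "(c, c') \<in> P" and b: "b \<in> B" "c \<sqsubseteq> b" "c \<noteq> b"
    and gate: "\<And>a. a \<in> Domain P \<Longrightarrow> meet a b \<sqsubseteq> c"
  obtains b' where "b' \<in> B" "partial_iso (insert (b, b') P)"
proof -
  note PD = partial_isoD[OF P]
  have mem: "a \<in> B" "a' \<in> B" if "(a, a') \<in> P" for a a' using that PD by auto
  define Q where "Q = {(a, a'). (a, a') \<in> P \<and> c \<sqsubseteq> a \<and> c \<noteq> a}"
  have Q': "(a, a') \<in> Q \<longleftrightarrow> (a, a') \<in> P \<and> c' \<sqsubseteq> a' \<and> c' \<noteq> a'" for a a'
    using PD(4)[OF c, of a a'] partial_iso_eq_iff[OF P c, of a a'] unfolding Q_def by auto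
  have finQ: "finite Q" using PD(1) by (rule finite_subset[rotated]) (auto simp: Q_def)
  define U where "U = (\<lambda>(a, a'). upper_cone B le c a) ` Q"
  define U' where "U' = (\<lambda>(a, a'). upper_cone B le c' a') ` Q"
  have eq: "upper_cone B le c a = upper_cone B le c d \<longleftrightarrow> upper_cone B le c' a' = upper_cone B le c' d'"
    if "(a, a') \<in> Q" "(d, d') \<in> Q" for a a' d d'
  proof -
    have "upper_cone B le c a = upper_cone B le c d \<longleftrightarrow> meet a d \<noteq> c"
      using that mem c by (intro cone_eq_iff) (auto simp: Q_def)
    moreover have "upper_cone B le c' a' = upper_cone B le c' d' \<longleftrightarrow> meet a' d' \<noteq> c'"
      using that mem c by (intro cone_eq_iff) (auto simp: Q')
    moreover have "(meet a d, meet a' d') \<in> P" using that PD(5) by (auto simp: Q_def)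
    ultimately show ?thesis using partial_iso_eq_iff[OF P _ c] by auto
  qed
  have cardU: "card U = card U'"
  proof -
    \<comment> \<open>\<open>h\<close> sends an occupied cone at \<open>c\<close> to the
      corresponding one at \<open>c'\<close>; \<open>eq\<close> makes it well defined and
      injective.\<close>
    define h where "h = (\<lambda>K. SOME K'. \<exists>(a, a')\<in>Q. K = upper_cone B le c a \<and> K' = upper_cone B le c' a')"
    have h: "h (upper_cone B le c a) = upper_cone B le c' a'" if "(a, a') \<in> Q" for a a'
      unfolding h_def by (rule some_equality) (use that eq in fastforce)+
    have "bij_betw h U U'"
      unfolding bij_betw_def inj_on_def
    proof (intro conjI ballI impI)
      fix K L assume "K \<in> U" "L \<in> U" "h K = h L"
      moreover from this obtain a a' d d' where "(a, a') \<in> Q" "K = upper_cone B le c a"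
        "(d, d') \<in> Q" "L = upper_cone B le c d" unfolding U_def by auto
      ultimately show "K = L" using h[of a a'] h[of d d'] eq[of a a' d d'] by simp
    next
      show "h ` U = U'" using h by (auto simp: U_def U'_def image_image case_prod_beta intro!: image_cong)
    qed
    then show ?thesis by (rule bij_betw_same_card)
  qed
  have Usub: "U \<subseteq> upper_cones B le c" "U' \<subseteq> upper_cones B le c'"
    using mem by (auto simp: U_def U'_def upper_cones_def Q_def) (use Q' Q_def mem in blast)
  have "upper_cone B le c b \<notin> U"
  proof
    assume "upper_cone B le c b \<in> U"
    then obtain a a' where a: "(a, a') \<in> Q" "upper_cone B le c b = upper_cone B le c a" by (auto simp: U_def)
    then have "meet b a \<noteq> c"
      using cone_eq_iff[of c b a] b c mem by (auto simp: Q_def)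
    moreover have "c \<sqsubseteq> meet b a" using a b c mem by (auto simp: Q_def intro!: meet_greatest)
    moreover have "meet b a \<sqsubseteq> c" using gate[of a] a b mem meet_commute[of a b] unfolding Q_def by force
    ultimately show False using antisym[of c "meet b a"] b c a mem[OF c] mem[of a a'] by (auto simp: Q_def)
  qed
  moreover have "upper_cone B le c b \<in> upper_cones B le c" using b by (auto simp: upper_cones_def)
  ultimately have "U \<noteq> upper_cones B le c" by blast
  \<comment> \<open>If all cones at \<open>c'\<close> were occupied, their number would be finite
    and nonzero, hence also the true number of cones at \<open>c\<close>. Then \<open>U\<close>
    would contain all cones at \<open>c\<close>, including that of \<open>b\<close>.\<close>
  have "U' \<noteq> upper_cones B le c'"
  proof
    assume all: "U' = upper_cones B le c'"
    then have "card (upper_cones B le c) = card U" using cardU all cones_card[of c c'] mem[OF c] by simp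
    moreover have "finite (upper_cones B le c')" using finQ unfolding all[symmetric] U'_def by blast
    moreover have "upper_cones B le c' \<noteq> {}" using no_max[of c'] mem[OF c] by (auto simp: upper_cones_def)
    ultimately have "finite (upper_cones B le c)"
      using cones_card[of c c'] mem[OF c] by (metis card.infinite card_0_eq)
    then show False using \<open>U \<noteq> upper_cones B le c\<close> Usub(1) \<open>card (upper_cones B le c) = card U\<close> card_subset_eq by metis
  qed
  then obtain b' where b': "b' \<in> B" "c' \<sqsubseteq> b'" "c' \<noteq> b'" "upper_cone B le c' b' \<notin> U'"
    using Usub(2) by (auto simp: upper_cones_def)
  have gate': "meet a' b' \<sqsubseteq> c'" if a: "(a, a') \<in> P" for a a'
  proof (rule ccontr)
    assume n: "\<not> meet a' b' \<sqsubseteq> c'"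
    define m where "m = meet a' b'"
    have m: "m \<in> B" "m \<sqsubseteq> a'" "m \<sqsubseteq> b'" "\<not> m \<sqsubseteq> c'"
      using n mem[OF a] b' by (auto simp: m_def intro: meet_le1 meet_le2)
    then have cm: "c' \<sqsubseteq> m" "c' \<noteq> m" using chain[of c' m b'] b' mem[OF c] by auto
    then have ca: "c' \<sqsubseteq> a'" "c' \<noteq> a'"
      using trans[of c' m a'] antisym[of c' m] m mem[OF a] mem[OF c] by auto
    then have "upper_cone B le c' a' = upper_cone B le c' b'"
      using cone_eq_iff[of c' a' b'] b' mem[OF a] mem[OF c] cm m_def by auto
    moreover have "upper_cone B le c' a' \<in> U'"
      unfolding U'_def using Q' a ca by (intro image_eqI[of _ _ "(a, a')"]) auto
    ultimately have "upper_cone B le c' b' \<in> U'" by simp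
    then show False using b'(4) by blast
  qed
  \<comment> \<open>Both new points are attached to the old ones only through \<open>c\<close> and
    \<open>c'\<close>, so they create no new meets.\<close>
  have meets: "meet a b = meet a c" "meet a' b' = meet a' c'" if a: "(a, a') \<in> P" for a a'
  proof -
    have gen: "meet x y = meet x z"
      if "x \<in> B" "y \<in> B" "z \<in> B" "z \<sqsubseteq> y" "meet x y \<sqsubseteq> z" for x y z
    proof (rule meet_eqI)
      show "meet x z \<sqsubseteq> y" using trans[of "meet x z" z y] meet_le2[of x z] that by simp
      fix w assume w: "w \<in> B" "w \<sqsubseteq> x" "w \<sqsubseteq> y"
      then have "w \<sqsubseteq> meet x y" using that by (intro meet_greatest)
      then have "w \<sqsubseteq> z" using trans[of w "meet x y" z] w that by simp
      then show "w \<sqsubseteq> meet x z" using w that by (intro meet_greatest)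
    qed (use that in \<open>auto intro: meet_le1\<close>)
    show "meet a b = meet a c" "meet a' b' = meet a' c'"
      using gen[of a b c] gen[of a' b' c'] gate gate' a b b' mem[OF a] mem[OF c] by auto
  qed
  have "partial_iso (insert (b, b') P)"
  proof (rule partial_iso_insert[OF P b(1) b'(1)])
    fix a a' assume a: "(a, a') \<in> P"
    have ga: "meet a b \<sqsubseteq> c" using gate a by blast
    show "(meet a b, meet a' b') \<in> insert (b, b') P"
      using PD(5)[OF a c] meets[OF a] by simp
    have "a \<sqsubseteq> b \<longleftrightarrow> a \<sqsubseteq> c"
      using ga meet_absorb1[of a b] trans[of a c b] b mem[OF a] mem[OF c] by auto
    moreover have "a' \<sqsubseteq> b' \<longleftrightarrow> a' \<sqsubseteq> c'"
      using gate'[OF a] a meet_absorb1[of a' b'] trans[of a' c' b'] b' mem[OF a] mem[OF c] by auto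
    moreover have "\<not> b \<sqsubseteq> a"
      using ga meet_absorb2[of a b] antisym[of b c] b mem[OF a] mem[OF c] by auto
    moreover have "\<not> b' \<sqsubseteq> a'"
      using gate'[OF a] a meet_absorb2[of a' b'] antisym[of b' c'] b' mem[OF a] mem[OF c] by auto
    ultimately show "(a \<sqsubseteq> b \<longleftrightarrow> a' \<sqsubseteq> b') \<and> (b \<sqsubseteq> a \<longleftrightarrow> b' \<sqsubseteq> a')"
      using PD(4)[OF a c] by simp
  qed
  then show ?thesis using that b' by blast
qed

text \<open>Two insertions: first the point \<open>c\<close> where \<open>b\<close> branches off
  from the domain, which is the largest meet of \<open>b\<close> with a domain element, and then
  \<open>b\<close> above it.\<close>

lemma extend_domain:
  assumes P: "partial_iso P" "P \<noteq> {}" and b: "b \<in> B"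
  obtains P' where "partial_iso P'" "P \<subseteq> P'" "b \<in> Domain P'"
proof -
  have D: "finite (Domain P)" "Domain P \<subseteq> B" "Domain P \<noteq> {}"
    using partial_isoD(1,2)[OF P(1)] P(2) by (auto simp: finite_Domain)
  obtain c where "c \<in> (\<lambda>a. meet a b) ` Domain P" and cmax: "\<And>x. x \<in> (\<lambda>a. meet a b) ` Domain P \<Longrightarrow> x \<sqsubseteq> c"
    by (rule finite_chain_max[of "(\<lambda>a. meet a b) ` Domain P" b])
      (use D b in \<open>auto simp: subset_iff intro: meet_le2\<close>)
  then obtain a0 a0' where a0: "(a0, a0') \<in> P" "c = meet a0 b" by auto
  then have c: "c \<in> B" "c \<sqsubseteq> a0" "c \<sqsubseteq> b" using D b by (auto intro: meet_le1 meet_le2)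
  obtain c' where c': "c' \<in> B" "partial_iso (insert (c, c') P)"
    using extend_below[OF P(1) a0(1) c(1,2)] .
  show ?thesis
  proof (cases "c = b")
    case True
    then show ?thesis using that[OF c'(2)] by auto
  next
    case False
    have "meet a b \<sqsubseteq> c" if "a \<in> Domain (insert (c, c') P)" for a
      using that cmax c meet_absorb1[of c b] b by auto
    from extend_above[OF c'(2) _ b c(3) False this]
    obtain b' where "partial_iso (insert (b, b') (insert (c, c') P))" by blast
    from that[OF this] show ?thesis by auto
  qed
qed

text \<open>Two values are prescribed, and not only one, because a piece of the shift has to fit its
  neighbours at both ends of its block. In the back-and-forth, stage \<open>k\<close> puts
  \<open>e k\<close> into the domain and, by extending the converse relation, into the
  range.\<close>

theorem automorphism_extending_chain:
  assumes count: "countable B" and uv: "u \<in> B" "v \<in> B" "u \<sqsubseteq> v" "u \<noteq> v"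
    and uv': "u' \<in> B" "v' \<in> B" "u' \<sqsubseteq> v'" "u' \<noteq> v'"
  obtains \<phi> where "bij_betw \<phi> B B" "\<And>x y. \<lbrakk>x \<in> B; y \<in> B\<rbrakk> \<Longrightarrow> x \<sqsubseteq> y \<longleftrightarrow> \<phi> x \<sqsubseteq> \<phi> y"
    "\<phi> u = u'" "\<phi> v = v'"
proof -
  define e where "e = from_nat_into B"
  have e: "range e = B" unfolding e_def using count uv by (intro range_from_nat_into) auto
  have step: "\<exists>P'. partial_iso P' \<and> P \<subseteq> P' \<and> b \<in> Domain P' \<and> b \<in> Range P'"
    if P: "partial_iso P" "P \<noteq> {}" and b: "b \<in> B" for P b
  proof -
    obtain P1 where P1: "partial_iso P1" "P \<subseteq> P1" "b \<in> Domain P1"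
      using extend_domain[OF P b] .
    have "partial_iso (P1\<inverse>)" "P1\<inverse> \<noteq> {}" using P1 P partial_iso_converse by auto
    then obtain P2 where "partial_iso P2" "P1\<inverse> \<subseteq> P2" "b \<in> Domain P2"
      using extend_domain b by metis
    then show ?thesis using P1 partial_iso_converse by (intro exI[of _ "P2\<inverse>"]) auto
  qed
  have muv: "meet u v = u" "meet v u = u" "meet u' v' = u'" "meet v' u' = u'"
    "meet u u = u" "meet v v = v" "meet u' u' = u'" "meet v' v' = v'"
    using uv uv' by (auto intro: meet_absorb1 meet_absorb2)
  have "\<not> v \<sqsubseteq> u" "\<not> v' \<sqsubseteq> u'" using antisym uv uv' by blast+
  then have start: "partial_iso {(u, u'), (v, v')}"
    using uv uv' muv unfolding partial_iso_def by auto
  obtain P where P0: "\<And>k. partial_iso (P k) \<and> {(u, u'), (v, v')} \<subseteq> P k"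
    and PS: "\<And>k. P k \<subseteq> P (Suc k) \<and> e k \<in> Domain (P (Suc k)) \<and> e k \<in> Range (P (Suc k))"
  proof (atomize_elim, rule exE[OF dependent_nat_choice[of "\<lambda>_ P. partial_iso P \<and> {(u, u'), (v, v')} \<subseteq> P"
          "\<lambda>k P Q. P \<subseteq> Q \<and> e k \<in> Domain Q \<and> e k \<in> Range Q"]])
    show "\<exists>Q. (partial_iso Q \<and> {(u, u'), (v, v')} \<subseteq> Q) \<and> P \<subseteq> Q \<and> e k \<in> Domain Q \<and> e k \<in> Range Q"
      if "partial_iso P \<and> {(u, u'), (v, v')} \<subseteq> P" for P k
      using step[of P "e k"] that e by blast
  qed (use start in blast)+
  have mono: "P i \<subseteq> P j" if "i \<le> j" for i j
    using lift_Suc_mono_le[of P] PS that by blast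
  define G where "G = (\<Union>k. P k)"
  have G: "\<exists>k. (x, x') \<in> P k \<and> (y, y') \<in> P k" if xy: "(x, x') \<in> G" "(y, y') \<in> G" for x x' y y'
  proof -
    obtain i j where "(x, x') \<in> P i" "(y, y') \<in> P j" using xy by (auto simp: G_def)
    then show ?thesis using mono[of i "max i j"] mono[of j "max i j"] by auto
  qed
  have G_le: "x \<sqsubseteq> y \<longleftrightarrow> x' \<sqsubseteq> y'" and G_eq: "x = y \<longleftrightarrow> x' = y'"
    if "(x, x') \<in> G" "(y, y') \<in> G" for x x' y y'
    using G[OF that] P0 partial_isoD(4) partial_iso_eq_iff by metis+
  have G_sub: "G \<subseteq> B \<times> B" using P0 partial_isoD(2,3) by (force simp: G_def)
  have tot: "\<exists>y. (x, y) \<in> G" "\<exists>y. (y, x) \<in> G" if "x \<in> B" for x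
    using that e PS unfolding G_def by blast+
  define \<phi> where "\<phi> = (\<lambda>x. THE y. (x, y) \<in> G)"
  have \<phi>: "\<phi> x = y" if "(x, y) \<in> G" for x y
    unfolding \<phi>_def using that G_eq by blast
  have \<phi>G: "(x, \<phi> x) \<in> G" if "x \<in> B" for x using tot(1)[OF that] \<phi> by auto
  show ?thesis
  proof
    show "bij_betw \<phi> B B"
      unfolding bij_betw_def
    proof
      show "inj_on \<phi> B" using \<phi>G G_eq by (intro inj_onI) metis
      show "\<phi> ` B = B"
      proof
        show "\<phi> ` B \<subseteq> B" using \<phi>G G_sub by blast
        show "B \<subseteq> \<phi> ` B"
        proof
          fix y assume "y \<in> B"
          then obtain x where "(x, y) \<in> G" using tot(2) by blast
          then show "y \<in> \<phi> ` B" using \<phi> G_sub by blast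
        qed
      qed
    qed
    show "x \<sqsubseteq> y \<longleftrightarrow> \<phi> x \<sqsubseteq> \<phi> y" if "x \<in> B" "y \<in> B" for x y using G_le \<phi>G that by blast
    show "\<phi> u = u'" "\<phi> v = v'" using P0[of 0] by (auto intro!: \<phi> simp: G_def)
  qed
qed

text \<open>Glues automorphisms \<open>\<phi>\<^sub>i\<close> on the blocks between \<open>p\<^sub>i\<close> and \<open>p\<^bsub>i+1\<^esub>\<close>. For \<open>x\<close> in block \<open>i\<close> and \<open>y\<close> in a later
  block, \<open>x \<sqsubseteq> y\<close> holds iff \<open>x \<sqsubseteq> p\<^bsub>i+1\<^esub>\<close>, a condition that \<open>\<phi>\<^sub>i\<close> preserves.\<close>
lemma shift_automorphism:
  fixes p :: "int \<Rightarrow> 'b"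
  assumes count: "countable B" and p: "\<And>i. p i \<in> B" "\<And>i. p i \<sqsubseteq> p (i + 1)" "\<And>i. p i \<noteq> p (i + 1)"
    and low: "\<And>x. x \<in> B \<Longrightarrow> \<exists>i. p i \<sqsubseteq> x" and high: "\<And>x. x \<in> B \<Longrightarrow> \<exists>i. \<not> p i \<sqsubseteq> x"
  shows "\<exists>f. bij_betw f B B \<and> (\<forall>x\<in>B. \<forall>y\<in>B. x \<sqsubseteq> y \<longleftrightarrow> f x \<sqsubseteq> f y) \<and> (\<forall>i. f (p i) = p (i + 1))"
proof -
  have mono: "p i \<sqsubseteq> p j" if "i \<le> j" for i j
    using that by (induction rule: int_ge_induct) (use p in \<open>auto intro: trans\<close>)
  have "\<forall>i. \<exists>\<phi>. bij_betw \<phi> B B \<and> (\<forall>x\<in>B. \<forall>y\<in>B. x \<sqsubseteq> y \<longleftrightarrow> \<phi> x \<sqsubseteq> \<phi> y) \<and>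
    \<phi> (p i) = p (i + 1) \<and> \<phi> (p (i + 1)) = p (i + 1 + 1)"
  proof
    fix i
    obtain \<phi> where "bij_betw \<phi> B B" "\<And>x y. \<lbrakk>x \<in> B; y \<in> B\<rbrakk> \<Longrightarrow> x \<sqsubseteq> y \<longleftrightarrow> \<phi> x \<sqsubseteq> \<phi> y"
      "\<phi> (p i) = p (i + 1)" "\<phi> (p (i + 1)) = p (i + 1 + 1)"
      using automorphism_extending_chain[OF count, of "p i" "p (i + 1)" "p (i + 1)" "p (i + 1 + 1)"] p by blast
    then show "\<exists>\<phi>. bij_betw \<phi> B B \<and> (\<forall>x\<in>B. \<forall>y\<in>B. x \<sqsubseteq> y \<longleftrightarrow> \<phi> x \<sqsubseteq> \<phi> y) \<and>
      \<phi> (p i) = p (i + 1) \<and> \<phi> (p (i + 1)) = p (i + 1 + 1)" by blast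
  qed
  then obtain \<phi> where \<phi>: "\<And>i. bij_betw (\<phi> i) B B"
    "\<And>i x y. \<lbrakk>x \<in> B; y \<in> B\<rbrakk> \<Longrightarrow> x \<sqsubseteq> y \<longleftrightarrow> \<phi> i x \<sqsubseteq> \<phi> i y"
    "\<And>i. \<phi> i (p i) = p (i + 1)" "\<And>i. \<phi> i (p (i + 1)) = p (i + 1 + 1)"
    unfolding choice_iff by blast
  have \<phi>B: "\<phi> i x \<in> B" if "x \<in> B" for i x using \<phi>(1) that by (auto simp: bij_betw_def)
  define block where "block i x \<longleftrightarrow> x \<in> B \<and> p i \<sqsubseteq> x \<and> \<not> p (i + 1) \<sqsubseteq> x" for i x
  have block_ex: "\<exists>i. block i x" if x: "x \<in> B" for x
  proof (rule ccontr)
    assume no: "\<nexists>i. block i x"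
    obtain i where i: "p i \<sqsubseteq> x" using low x by blast
    \<comment> \<open>Without a block for \<open>x\<close>, the property
      \<open>p j \<sqsubseteq> x\<close> would propagate upwards from the index given by
      \<open>low\<close>, against \<open>high\<close>.\<close>
    have all: "p j \<sqsubseteq> x" if "i \<le> j" for j
      using that by (induction rule: int_ge_induct) (use i no x in \<open>auto simp: block_def\<close>)
    obtain j where "\<not> p j \<sqsubseteq> x" using high x by blast
    then have "\<not> p (max i j) \<sqsubseteq> x" using mono[of j "max i j"] trans[of "p j" "p (max i j)" x] p x by auto
    then show False using all[of "max i j"] by auto
  qed
  have block_le: "j \<le> i" if "p j \<sqsubseteq> x" "block i x" for i j x
  proof (rule ccontr)
    assume "\<not> j \<le> i"
    then have "p (i + 1) \<sqsubseteq> p j" by (intro mono) auto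
    then show False using trans[of "p (i + 1)" "p j" x] that p by (auto simp: block_def)
  qed
  have block_unique: "i = j" if "block i x" "block j x" for i j x
    using block_le[of i x j] block_le[of j x i] that by (auto simp: block_def)
  define idx where "idx x = (THE i. block i x)" for x
  have idx_eq: "idx x = i" if "block i x" for i x
    unfolding idx_def using that block_unique by blast
  have idx: "block (idx x) x" if "x \<in> B" for x using block_ex[OF that] idx_eq by auto
  have block_shift: "block (i + 1) (\<phi> i x) \<longleftrightarrow> block i x" if "x \<in> B" for i x
    using that p \<phi>(2)[of "p i" x i] \<phi>(2)[of "p (i + 1)" x i] \<phi>B[of x i] \<phi>(3,4) by (auto simp: block_def)
  have across: "x \<sqsubseteq> y \<longleftrightarrow> i < j \<and> x \<sqsubseteq> p (i + 1)" if b: "block i x" "block j y" "i \<noteq> j" for i j x y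
  proof
    assume "x \<sqsubseteq> y"
    then have "p i \<sqsubseteq> y" using trans[of "p i" x y] b p by (auto simp: block_def)
    then have "i < j" using block_le[of i y j] b by auto
    then have "p (i + 1) \<sqsubseteq> y" using trans[of "p (i + 1)" "p j" y] mono[of "i + 1" j] b p by (auto simp: block_def)
    then show "i < j \<and> x \<sqsubseteq> p (i + 1)"
      using chain[of x "p (i + 1)" y] \<open>x \<sqsubseteq> y\<close> \<open>i < j\<close> b p by (auto simp: block_def)
  next
    assume "i < j \<and> x \<sqsubseteq> p (i + 1)"
    then have "x \<sqsubseteq> p j" using trans[of x "p (i + 1)" "p j"] mono[of "i + 1" j] b p by (auto simp: block_def)
    then show "x \<sqsubseteq> y" using trans[of x "p j" y] b p by (auto simp: block_def)
  qed
  define f where "f x = \<phi> (idx x) x" for x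
  have f: "f x = \<phi> i x" "block (i + 1) (f x)" if "block i x" for i x
    using idx_eq[OF that] block_shift that by (auto simp: f_def block_def)
  have f_le: "x \<sqsubseteq> y \<longleftrightarrow> f x \<sqsubseteq> f y" if xy: "x \<in> B" "y \<in> B" for x y
  proof -
    obtain i j where ij: "block i x" "block j y" using block_ex xy by metis
    show ?thesis
    proof (cases "i = j")
      case True
      then show ?thesis using f ij \<phi>(2)[OF xy] by auto
    next
      case False
      have "f x \<sqsubseteq> p (i + 1 + 1) \<longleftrightarrow> x \<sqsubseteq> p (i + 1)"
        using f(1)[OF ij(1)] \<phi>(2)[of x "p (i + 1)" i] \<phi>(4)[of i] xy p by auto
      then show ?thesis
        using across[OF ij False] across[OF f(2)[OF ij(1)] f(2)[OF ij(2)]] False by auto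
    qed
  qed
  show ?thesis
  proof (intro exI[of _ f] conjI ballI allI)
    show "bij_betw f B B"
      unfolding bij_betw_def
    proof
      show "inj_on f B"
      proof (rule inj_onI)
        fix x y assume xy: "x \<in> B" "y \<in> B" "f x = f y"
        have "f x \<in> B" using f(2)[OF idx[OF xy(1)]] by (auto simp: block_def)
        then show "x = y" using f_le[of x y] f_le[of y x] xy antisym[of x y] by auto
      qed
      show "f ` B = B"
      proof
        show "f ` B \<subseteq> B" using f(2) idx by (auto simp: block_def)
        show "B \<subseteq> f ` B"
        proof
          fix y assume y: "y \<in> B"
          then obtain i where i: "block i y" using block_ex by blast
          have "y \<in> \<phi> (i - 1) ` B" using \<phi>(1)[of "i - 1"] y by (simp add: bij_betw_def)
          then obtain x where x: "x \<in> B" "\<phi> (i - 1) x = y" by blast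
          then have "block (i - 1) x" using block_shift[of x "i - 1"] i by simp
          from f(1)[OF this] x show "y \<in> f ` B" by (intro image_eqI[of _ _ x]) simp_all
        qed
      qed
    qed
    show "x \<sqsubseteq> y \<longleftrightarrow> f x \<sqsubseteq> f y" if "x \<in> B" "y \<in> B" for x y using f_le that .
    fix i
    have "block i (p i)" using p antisym[of "p i" "p (i + 1)"] by (auto simp: block_def)
    then show "f (p i) = p (i + 1)" using f \<phi>(3) by simp
  qed
qed

text \<open>Each term is chosen strictly above its predecessor and above the next element of an
  enumeration of \<open>C\<close>. The order is a parameter \<open>R\<close> so that the result
  applies to \<open>\<sqsubseteq>\<close> and to its converse.\<close>

lemma cofinal_sequence:
  assumes count: "countable C" and C: "c0 \<in> C" and linear: "\<And>x y. \<lbrakk>x \<in> C; y \<in> C\<rbrakk> \<Longrightarrow> R x y \<or> R y x"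
    and trans: "\<And>x y z. \<lbrakk>x \<in> C; y \<in> C; z \<in> C; R x y; R y z\<rbrakk> \<Longrightarrow> R x z"
    and antisym: "\<And>x y. \<lbrakk>x \<in> C; y \<in> C; R x y; R y x\<rbrakk> \<Longrightarrow> x = y"
    and unbounded: "\<And>x. x \<in> C \<Longrightarrow> \<exists>y\<in>C. R x y \<and> x \<noteq> y"
  obtains q :: "nat \<Rightarrow> 'c" where "q 0 = c0" "\<And>n. q n \<in> C" "\<And>n. R (q n) (q (Suc n))"
    "\<And>n. q n \<noteq> q (Suc n)" "\<And>c. c \<in> C \<Longrightarrow> \<exists>n. R c (q n)"
proof -
  define e where "e = from_nat_into C"
  have e: "range e = C" unfolding e_def using count C by (intro range_from_nat_into) auto
  have step: "\<exists>y\<in>C. R x y \<and> x \<noteq> y \<and> R c y" if xc: "x \<in> C" "c \<in> C" for x c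
  proof -
    obtain m where m: "m \<in> C" "R x m" "R c m" using linear[of x c] linear[of x x] linear[of c c] xc by blast
    obtain y where "y \<in> C" "R m y" "m \<noteq> y" using unbounded m by blast
    then show ?thesis using m xc trans[of x m y] trans[of c m y] antisym[of m y] by blast
  qed
  define q where "q = rec_nat c0 (\<lambda>n x. SOME y. y \<in> C \<and> R x y \<and> x \<noteq> y \<and> R (e n) y)"
  have qS: "q (Suc n) \<in> C \<and> R (q n) (q (Suc n)) \<and> q n \<noteq> q (Suc n) \<and> R (e n) (q (Suc n))" if "q n \<in> C" for n
  proof -
    have "\<exists>y. y \<in> C \<and> R (q n) y \<and> q n \<noteq> y \<and> R (e n) y" using step[OF that] e by blast
    from someI_ex[OF this] show ?thesis by (simp add: q_def)
  qed
  have qC: "q n \<in> C" for n by (induction n) (use C qS in \<open>auto simp: q_def\<close>)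
  show ?thesis
  proof
    show "\<exists>n. R c (q n)" if "c \<in> C" for c using that e qS qC by blast
  qed (use qC qS in \<open>auto simp: q_def\<close>)
qed

lemma bi_cofinal_sequence:
  assumes count: "countable C" and C: "C \<noteq> {}" "C \<subseteq> B"
    and linear: "\<And>x y. \<lbrakk>x \<in> C; y \<in> C\<rbrakk> \<Longrightarrow> x \<sqsubseteq> y \<or> y \<sqsubseteq> x"
    and up: "\<And>x. x \<in> C \<Longrightarrow> \<exists>y\<in>C. x \<sqsubseteq> y \<and> x \<noteq> y" and down: "\<And>x. x \<in> C \<Longrightarrow> \<exists>y\<in>C. y \<sqsubseteq> x \<and> x \<noteq> y"
  shows "\<exists>p :: int \<Rightarrow> 'b. (\<forall>i. p i \<in> C \<and> p i \<sqsubseteq> p (i + 1) \<and> p i \<noteq> p (i + 1)) \<and>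
    (\<forall>c\<in>C. (\<exists>i. p i \<sqsubseteq> c) \<and> (\<exists>i. c \<sqsubseteq> p i))"
proof -
  obtain c0 where c0: "c0 \<in> C" using C by blast
  have transC: "\<lbrakk>x \<in> C; y \<in> C; z \<in> C; x \<sqsubseteq> y; y \<sqsubseteq> z\<rbrakk> \<Longrightarrow> x \<sqsubseteq> z" for x y z
    using trans[of x y z] C(2) by auto
  have antisymC: "\<lbrakk>x \<in> C; y \<in> C; x \<sqsubseteq> y; y \<sqsubseteq> x\<rbrakk> \<Longrightarrow> x = y" for x y
    using antisym[of x y] C(2) by auto
  note seq = cofinal_sequence[OF count c0]
  have "\<exists>q. q 0 = c0 \<and> (\<forall>n. q n \<in> C \<and> q n \<sqsubseteq> q (Suc n) \<and> q n \<noteq> q (Suc n)) \<and> (\<forall>c\<in>C. \<exists>n. c \<sqsubseteq> q n)"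
  proof (rule seq[of "(\<sqsubseteq>)"])
    fix x y z assume "x \<in> C" "y \<in> C" "z \<in> C" "x \<sqsubseteq> y" "y \<sqsubseteq> z"
    then show "x \<sqsubseteq> z" by (rule transC)
  qed (use linear antisymC up in \<open>auto 0 2\<close>)
  then obtain q where q: "q 0 = c0" "\<And>n. q n \<in> C" "\<And>n. q n \<sqsubseteq> q (Suc n)"
    "\<And>n. q n \<noteq> q (Suc n)" "\<And>c. c \<in> C \<Longrightarrow> \<exists>n. c \<sqsubseteq> q n" by blast
  have "\<exists>r. r 0 = c0 \<and> (\<forall>n. r n \<in> C \<and> r (Suc n) \<sqsubseteq> r n \<and> r n \<noteq> r (Suc n)) \<and> (\<forall>c\<in>C. \<exists>n. r n \<sqsubseteq> c)"
  proof (rule seq[of "\<lambda>x y. y \<sqsubseteq> x"])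
    fix x y z assume "x \<in> C" "y \<in> C" "z \<in> C" "y \<sqsubseteq> x" "z \<sqsubseteq> y"
    then show "z \<sqsubseteq> x" using transC by blast
  qed (use linear antisymC down in \<open>auto 0 2\<close>)
  then obtain r where r: "r 0 = c0" "\<And>n. r n \<in> C" "\<And>n. r (Suc n) \<sqsubseteq> r n"
    "\<And>n. r n \<noteq> r (Suc n)" "\<And>c. c \<in> C \<Longrightarrow> \<exists>n. r n \<sqsubseteq> c" by blast
  define p where "p i = (if 0 \<le> i then q (nat i) else r (nat (- i)))" for i :: int
  have step: "p i \<sqsubseteq> p (i + 1) \<and> p i \<noteq> p (i + 1)" for i
  proof (cases "0 \<le> i")
    case True
    then have "nat (i + 1) = Suc (nat i)" by auto
    then show ?thesis using True q by (auto simp: p_def)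
  next
    case False
    \<comment> \<open>The index \<open>i + 1\<close> may be 0, which falls under the other case of
      the definition of \<open>p\<close>; \<open>q\<close> and \<open>r\<close> agree there, both
      starting at \<open>c0\<close>.\<close>
    then have "nat (- i) = Suc (nat (- (i + 1)))" by auto
    then have "p i = r (Suc (nat (- (i + 1))))" "p (i + 1) = r (nat (- (i + 1)))"
      using False q(1) r(1) by (auto simp: p_def)
    then show ?thesis using r(3,4) by metis
  qed
  show ?thesis
  proof (intro exI[of _ p] conjI ballI allI)
    show "\<exists>i. p i \<sqsubseteq> c" if c: "c \<in> C" for c
    proof -
      obtain n where "r n \<sqsubseteq> c" using r c by blast
      moreover have "p (- int n) = r n" using q(1) r(1) by (cases "n = 0") (auto simp: p_def)
      ultimately show ?thesis by metis
    qed
    show "\<exists>i. c \<sqsubseteq> p i" if c: "c \<in> C" for c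
    proof -
      obtain n where "c \<sqsubseteq> q n" using q c by blast
      moreover have "p (int n) = q n" by (auto simp: p_def)
      ultimately show ?thesis by metis
    qed
  qed (use step q r in \<open>auto simp: p_def\<close>)
qed

end

section \<open>Peano continua are arcwise connected\<close>

text \<open>Lebesgue number of the cover by open sets with small connected trace. The radius is
  halved because the ball containing such a trace is centred at some \<open>z\<close> other than
  \<open>x\<close>.\<close>

lemma uniformly_locally_connected:
  fixes X :: "'a::metric_space set"
  assumes X: "compact X" "locally connected X" and "\<epsilon> > 0"
  shows "\<exists>\<delta>>0. \<forall>x\<in>X. \<forall>y\<in>X. dist x y < \<delta> \<longrightarrow>
    (\<exists>C. connected C \<and> C \<subseteq> X \<and> x \<in> C \<and> y \<in> C \<and> C \<subseteq> ball x \<epsilon>)"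
proof -
  define \<G> where "\<G> = {V. open V \<and> connected (X \<inter> V) \<and> (\<exists>z. X \<inter> V \<subseteq> ball z (\<epsilon> / 2))}"
  have "X \<subseteq> \<Union>\<G>"
  proof
    fix x assume x: "x \<in> X"
    have "openin (top_of_set X) (X \<inter> ball x (\<epsilon> / 2))" by (simp add: openin_open_Int)
    then obtain u where u: "openin (top_of_set X) u" "connected u" "x \<in> u" "u \<subseteq> X \<inter> ball x (\<epsilon> / 2)"
      using X(2) x \<open>\<epsilon> > 0\<close> unfolding locally_connected
      by (metis IntI centre_in_ball half_gt_zero)
    then obtain V where "open V" "u = X \<inter> V" by (auto simp: openin_open)
    then have "V \<in> \<G>" using u by (auto simp: \<G>_def)
    then show "x \<in> \<Union>\<G>" using u \<open>u = X \<inter> V\<close> by blast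
  qed
  then obtain \<delta> where \<delta>: "\<delta> > 0" "\<And>x. x \<in> X \<Longrightarrow> \<exists>G\<in>\<G>. ball x \<delta> \<subseteq> G"
    by (rule Heine_Borel_lemma[OF X(1)]) (auto simp: \<G>_def)
  show ?thesis
  proof (intro exI[of _ \<delta>] conjI ballI impI)
    fix x y assume xy: "x \<in> X" "y \<in> X" "dist x y < \<delta>"
    then obtain V where V: "V \<in> \<G>" "ball x \<delta> \<subseteq> V" using \<delta> by blast
    then obtain z where z: "connected (X \<inter> V)" "X \<inter> V \<subseteq> ball z (\<epsilon> / 2)" by (auto simp: \<G>_def)
    have xyV: "x \<in> X \<inter> V" "y \<in> X \<inter> V" using V xy \<delta>(1) by auto
    have "X \<inter> V \<subseteq> ball x \<epsilon>"
    proof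
      fix w assume "w \<in> X \<inter> V"
      then have "dist z w < \<epsilon> / 2" "dist z x < \<epsilon> / 2" using z xyV by auto
      then show "w \<in> ball x \<epsilon>" using dist_triangle_half_r[of z x \<epsilon> w] by auto
    qed
    then show "\<exists>C. connected C \<and> C \<subseteq> X \<and> x \<in> C \<and> y \<in> C \<and> C \<subseteq> ball x \<epsilon>"
      using z xyV by (intro exI[of _ "X \<inter> V"]) auto
  qed (rule \<delta>)
qed

text \<open>Reachability by short jumps is an equivalence relation with open classes. The chain is
  an eventually constant sequence, so that chains can be lengthened freely.\<close>

lemma connected_chain:
  fixes C :: "'a::metric_space set"
  assumes C: "connected C" "x \<in> C" "y \<in> C" and "\<delta> > 0"
  obtains s :: "nat \<Rightarrow> 'a" and n where "s 0 = x" "\<And>i. n \<le> i \<Longrightarrow> s i = y" "\<And>i. s i \<in> C"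
    "\<And>i. dist (s i) (s (Suc i)) < \<delta>"
proof -
  define E where "E u v \<longleftrightarrow> u \<in> C \<and> v \<in> C \<and> dist u v < \<delta>" for u v
  have "E\<^sup>*\<^sup>* x y"
  proof (rule connected_equivalence_relation[OF C])
    have "symp E" by (auto simp: E_def symp_def dist_commute)
    then show "E\<^sup>*\<^sup>* v u" if "E\<^sup>*\<^sup>* u v" for u v
      using that by (metis symp_rtranclp sympD)
    show "\<exists>T. openin (top_of_set C) T \<and> a \<in> T \<and> (\<forall>x\<in>T. E\<^sup>*\<^sup>* a x)" if "a \<in> C" for a
      using that \<open>\<delta> > 0\<close>
      by (intro exI[of _ "C \<inter> ball a \<delta>"]) (auto simp: openin_open_Int E_def)
  qed auto
  then have "\<exists>s n. s 0 = x \<and> (\<forall>i\<ge>n. s i = y) \<and> (\<forall>i. s i \<in> C \<and> dist (s i) (s (Suc i)) < \<delta>)"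
  proof (induction rule: converse_rtranclp_induct)
    case base
    show ?case using C \<open>\<delta> > 0\<close> by (intro exI[of _ "\<lambda>_. y"]) auto
  next
    case (step u v)
    then obtain s n where s: "s 0 = v" "\<And>i. i \<ge> n \<Longrightarrow> s i = y" "\<And>i. s i \<in> C \<and> dist (s i) (s (Suc i)) < \<delta>"
      by blast
    define t where "t = case_nat u s"
    have "t 0 = u" by (simp add: t_def)
    moreover have "t i = y" if "i \<ge> Suc n" for i
      using that s(2) by (cases i) (auto simp: t_def)
    moreover have "t i \<in> C \<and> dist (t i) (t (Suc i)) < \<delta>" for i
      using s step.hyps(1) by (cases i) (auto simp: t_def E_def)
    ultimately show ?case by blast
  qed
  then show ?thesis using that by blast
qed

text \<open>Each link is replaced by a finer chain inside a small connected set. All these chains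
  are padded to the same length \<open>M\<close>; thus entry \<open>j\<close> of the new chain sits
  over entry \<open>j div M\<close> of the old one.\<close>

lemma chain_refinement:
  fixes X :: "'a::metric_space set" and c :: "nat \<Rightarrow> 'a"
  assumes small: "\<forall>x\<in>X. \<forall>y\<in>X. dist x y < \<delta> \<longrightarrow>
      (\<exists>C. connected C \<and> C \<subseteq> X \<and> x \<in> C \<and> y \<in> C \<and> C \<subseteq> ball x \<eta>)"
    and "\<delta>' > 0" "\<eta> > 0" and c: "\<forall>i. c i \<in> X \<and> dist (c i) (c (Suc i)) < \<delta>" "\<forall>i\<ge>N. c i = y"
  shows "\<exists>M\<ge>1. \<exists>c'. (\<forall>i. c' i \<in> X \<and> dist (c' i) (c' (Suc i)) < \<delta>') \<and> (\<forall>i\<ge>N * M. c' i = y) \<and>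
    c' 0 = c 0 \<and> (\<forall>j. dist (c' j) (c (j div M)) < \<eta>)"
proof -
  have "\<exists>s n. s 0 = c i \<and> (\<forall>j\<ge>n. s j = c (Suc i)) \<and> (\<forall>j. s j \<in> X \<inter> ball (c i) \<eta>) \<and>
      (\<forall>j. dist (s j) (s (Suc j)) < \<delta>') \<and> (N \<le> i \<longrightarrow> n = 0)" for i
  proof (cases "N \<le> i")
    case True
    then have "c (Suc i) = c i" using c(2) by simp
    then show ?thesis using c \<open>\<delta>' > 0\<close> \<open>\<eta> > 0\<close> by (intro exI[of _ "\<lambda>_. c i"] exI[of _ 0]) auto
  next
    case False
    obtain C where C: "connected C" "C \<subseteq> X" "c i \<in> C" "c (Suc i) \<in> C" "C \<subseteq> ball (c i) \<eta>"
      using small c(1) by blast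
    obtain s n where "s 0 = c i" "\<And>j. n \<le> j \<Longrightarrow> s j = c (Suc i)" "\<And>j. s j \<in> C"
      "\<And>j. dist (s j) (s (Suc j)) < \<delta>'"
      using connected_chain[OF C(1,3,4) \<open>\<delta>' > 0\<close>] by blast
    moreover from this(3) have "s j \<in> X \<inter> ball (c i) \<eta>" for j using C by blast
    ultimately show ?thesis using False by (intro exI[of _ s] exI[of _ n]) auto
  qed
  then obtain s n where s: "\<And>i. s i 0 = c i" "\<And>i j. n i \<le> j \<Longrightarrow> s i j = c (Suc i)"
    "\<And>i j. s i j \<in> X \<inter> ball (c i) \<eta>" "\<And>i j. dist (s i j) (s i (Suc j)) < \<delta>'" "\<And>i. N \<le> i \<Longrightarrow> n i = 0"
    by metis
  \<comment> \<open>Beyond \<open>N\<close> the chain is constant and \<open>n i = 0\<close>, so a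
    maximum over finitely many links bounds all lengths.\<close>
  define M where "M = Suc (Max (insert 0 (n ` {..<N})))"
  have "n i \<le> Max (insert 0 (n ` {..<N}))" if "i < N" for i using that by (intro Max_ge) auto
  then have nM: "n i \<le> M" for i using s(5)[of i] by (cases "i < N") (auto simp: M_def le_SucI)
  have "M \<ge> 1" by (simp add: M_def)
  define c' where "c' j = s (j div M) (j mod M)" for j
  show ?thesis
  proof (intro exI[of _ M] exI[of _ c'] conjI allI impI)
    show "dist (c' j) (c' (Suc j)) < \<delta>'" for j
    proof (cases "Suc (j mod M) = M")
      case True
      then have "Suc j div M = Suc (j div M)" "Suc j mod M = 0" by (auto simp: div_Suc mod_Suc)
      then have "c' (Suc j) = s (j div M) (Suc (j mod M))"
        using s(1,2) nM[of "j div M"] True by (simp add: c'_def)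
      then show ?thesis using s(4) by (simp add: c'_def)
    next
      case False
      then have "Suc j div M = j div M" "Suc j mod M = Suc (j mod M)" by (auto simp: div_Suc mod_Suc)
      then show ?thesis using s(4) by (simp add: c'_def)
    qed
    show "c' j = y" if "N * M \<le> j" for j
    proof -
      have "N \<le> j div M" using that \<open>M \<ge> 1\<close> by (simp add: less_eq_div_iff_mult_less_eq)
      then show ?thesis using s(2)[of "j div M"] s(5) c(2) by (simp add: c'_def)
    qed
    show "c' 0 = c 0" using s(1) by (simp add: c'_def)
    show "dist (c' j) (c (j div M)) < \<eta>" for j
      using s(3)[of "j div M" "j mod M"] by (simp add: c'_def dist_commute)
  qed (use \<open>M \<ge> 1\<close> s(3) in \<open>auto simp: c'_def\<close>)
qed

lemma geometric_Cauchy_limit: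
  fixes u :: "nat \<Rightarrow> 'a::metric_space"
  assumes X: "complete X" and u: "\<And>k. u k \<in> X" "\<And>k. dist (u k) (u (Suc k)) \<le> D * (1/2) ^ k" and "D \<ge> 0"
  obtains l where "l \<in> X" "\<And>k. dist (u k) l \<le> 2 * D * (1/2) ^ k"
proof -
  \<comment> \<open>The exact partial sum of the geometric series is kept, since the weaker bound
    would not pass the induction.\<close>
  have bound: "dist (u k) (u (k + m)) \<le> 2 * D * (1/2) ^ k - 2 * D * (1/2) ^ (k + m)" for k m
  proof (induction m)
    case (Suc m)
    have "dist (u k) (u (k + Suc m)) \<le> dist (u k) (u (k + m)) + dist (u (k + m)) (u (Suc (k + m)))"
      using dist_triangle by simp
    also have "\<dots> \<le> 2 * D * (1/2) ^ k - 2 * D * (1/2) ^ (k + m) + D * (1/2) ^ (k + m)"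
      using Suc u(2)[of "k + m"] by linarith
    finally show ?case by (simp add: algebra_simps)
  qed auto
  have bound': "dist (u k) (u j) \<le> 2 * D * (1/2) ^ k" if "k \<le> j" for k j
    using bound[of k "j - k"] that \<open>D \<ge> 0\<close>
    by (smt (verit) le_add_diff_inverse mult_nonneg_nonneg zero_le_power divide_nonneg_nonneg)
  have lim0: "(\<lambda>k. 2 * D * (1/2) ^ k) \<longlonglongrightarrow> 0"
    by (intro tendsto_mult_right_zero LIMSEQ_power_zero) auto
  have "Cauchy u"
  proof (rule metric_CauchyI)
    fix e :: real assume "e > 0"
    then have "\<forall>\<^sub>F k in sequentially. 2 * D * (1/2) ^ k < e / 2"
      using order_tendstoD(2)[OF lim0, of "e / 2"] by simp
    then obtain M where M: "2 * D * (1/2) ^ M < e / 2" by (auto simp: eventually_sequentially)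
    show "\<exists>M. \<forall>m\<ge>M. \<forall>n\<ge>M. dist (u m) (u n) < e"
    proof (intro exI[of _ M] allI impI)
      fix m n assume "M \<le> m" "M \<le> n"
      then have "dist (u M) (u m) < e / 2" "dist (u M) (u n) < e / 2"
        using bound'[of M m] bound'[of M n] M by linarith+
      then show "dist (u m) (u n) < e" by (rule dist_triangle_half_r)
    qed
  qed
  then obtain l where l: "l \<in> X" "u \<longlonglongrightarrow> l" using X u by (meson completeE)
  have "dist (u k) l \<le> 2 * D * (1/2) ^ k" for k
  proof (rule tendsto_upperbound)
    show "(\<lambda>j. dist (u k) (u j)) \<longlonglongrightarrow> dist (u k) l" using l by (intro tendsto_intros)
    show "\<forall>\<^sub>F j in sequentially. dist (u k) (u j) \<le> 2 * D * (1/2) ^ k"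
      using bound' by (auto simp: eventually_sequentially)
  qed auto
  then show ?thesis using that l by blast
qed

lemma floor_mult_near:
  fixes s t :: real
  assumes "0 \<le> s" "s \<le> t" "(t - s) * real N < 1"
  shows "nat \<lfloor>t * real N\<rfloor> = nat \<lfloor>s * real N\<rfloor> \<or> nat \<lfloor>t * real N\<rfloor> = Suc (nat \<lfloor>s * real N\<rfloor>)"
proof -
  have "\<lfloor>s * real N\<rfloor> \<le> \<lfloor>t * real N\<rfloor>" using assms by (intro floor_mono mult_right_mono) auto
  moreover have "t * real N < s * real N + 1" using assms(3) by (simp add: algebra_simps)
  then have "\<lfloor>t * real N\<rfloor> \<le> \<lfloor>s * real N\<rfloor> + 1" by linarith
  moreover have "0 \<le> \<lfloor>s * real N\<rfloor>" using assms by simp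
  ultimately show ?thesis by linarith
qed

text \<open>Successive refinements \<open>c\<^sub>k\<close> of a chain of length \<open>N\<^sub>k\<close> give step functions
  \<open>t \<mapsto> c\<^sub>k \<lfloor>t N\<^sub>k\<rfloor>\<close> that converge uniformly and whose jumps tend to 0, so the limit is a path.\<close>
lemma short_path:
  fixes X :: "'a::metric_space set"
  assumes X: "compact X" "locally connected X" and "\<epsilon> > 0"
  shows "\<exists>\<delta>>0. \<forall>x\<in>X. \<forall>y\<in>X. dist x y < \<delta> \<longrightarrow>
    (\<exists>g. path g \<and> pathstart g = x \<and> pathfinish g = y \<and> path_image g \<subseteq> X \<inter> ball x \<epsilon>)"
proof -
  \<comment> \<open>The limit path will stay within \<open>2 * D\<close> of the step function of
    level 0, which equals \<open>x\<close> before parameter 1.\<close>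
  define D where "D = \<epsilon> / 8"
  have "D > 0" using \<open>\<epsilon> > 0\<close> by (simp add: D_def)
  have "\<forall>k::nat. \<exists>\<delta>>0. \<delta> \<le> D * (1/2) ^ k \<and> (\<forall>x y. x \<in> X \<longrightarrow> y \<in> X \<longrightarrow> dist x y < \<delta> \<longrightarrow>
    (\<exists>C. connected C \<and> C \<subseteq> X \<and> x \<in> C \<and> y \<in> C \<and> C \<subseteq> ball x (D * (1/2) ^ k)))"
  proof
    fix k :: nat
    have pos: "D * (1/2) ^ k > 0" using \<open>D > 0\<close> by simp
    obtain \<delta> where "\<delta> > 0" "\<forall>x\<in>X. \<forall>y\<in>X. dist x y < \<delta> \<longrightarrow>
      (\<exists>C. connected C \<and> C \<subseteq> X \<and> x \<in> C \<and> y \<in> C \<and> C \<subseteq> ball x (D * (1/2) ^ k))"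
      using uniformly_locally_connected[OF X pos] by blast
    then show "\<exists>\<delta>>0. \<delta> \<le> D * (1/2) ^ k \<and> (\<forall>x y. x \<in> X \<longrightarrow> y \<in> X \<longrightarrow> dist x y < \<delta> \<longrightarrow>
      (\<exists>C. connected C \<and> C \<subseteq> X \<and> x \<in> C \<and> y \<in> C \<and> C \<subseteq> ball x (D * (1/2) ^ k)))"
      using pos by (intro exI[of _ "min \<delta> (D * (1/2) ^ k)"]) auto
  qed
  from choice[OF this] obtain \<delta> where *: "\<forall>k::nat. \<delta> k > 0 \<and> \<delta> k \<le> D * (1/2) ^ k \<and>
    (\<forall>x y. x \<in> X \<longrightarrow> y \<in> X \<longrightarrow> dist x y < \<delta> k \<longrightarrow>
    (\<exists>C. connected C \<and> C \<subseteq> X \<and> x \<in> C \<and> y \<in> C \<and> C \<subseteq> ball x (D * (1/2) ^ k)))" by (rule exE)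
  have \<delta>: "\<delta> k > 0" "\<delta> k \<le> D * (1/2) ^ k"
    "\<lbrakk>x \<in> X; y \<in> X; dist x y < \<delta> k\<rbrakk> \<Longrightarrow>
      \<exists>C. connected C \<and> C \<subseteq> X \<and> x \<in> C \<and> y \<in> C \<and> C \<subseteq> ball x (D * (1/2) ^ k)" for k x y
    using *[rule_format, of k] by blast+
  show ?thesis
  proof (intro exI[of _ "\<delta> 0"] conjI ballI impI \<delta>(1))
    fix x y assume xy: "x \<in> X" "y \<in> X" "dist x y < \<delta> 0"
    \<comment> \<open>A pair \<open>p\<close> is a chain from \<open>x\<close> to \<open>y\<close>:
      its number of links and its entries. \<open>Q k p\<close> bounds its jumps by
      \<open>\<delta> k\<close>, and \<open>R k p q\<close> says that \<open>q\<close> refines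
      \<open>p\<close> by subdividing every link into \<open>M\<close> pieces.\<close>
    define Q where "Q k p \<longleftrightarrow> fst p \<ge> (1::nat) \<and> (\<forall>i. snd p i \<in> X \<and> dist (snd p i) (snd p (Suc i)) < \<delta> k) \<and>
      (\<forall>i\<ge>fst p. snd p i = y) \<and> snd p 0 = x" for k and p :: "nat \<times> (nat \<Rightarrow> 'a)"
    define R where "R k p q \<longleftrightarrow> (\<exists>M\<ge>1. fst q = fst p * M \<and>
      (\<forall>j. dist (snd q j) (snd p (j div M)) < D * (1/2) ^ k))"
      for k :: nat and p q :: "nat \<times> (nat \<Rightarrow> 'a)"
    have start: "Q 0 (1, \<lambda>i. if i = 0 then x else y)"
      using xy \<delta>(1) by (auto simp: Q_def)
    have nxt: "\<exists>q. Q (Suc k) q \<and> R k p q" if p: "Q k p" for k p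
    proof -
      obtain N c where Nc: "p = (N, c)" by force
      then have c: "N \<ge> 1" "\<forall>i. c i \<in> X \<and> dist (c i) (c (Suc i)) < \<delta> k" "\<forall>i\<ge>N. c i = y" "c 0 = x"
        using p by (auto simp: Q_def)
      have "D * (1/2) ^ k > 0" using \<open>D > 0\<close> by simp
      moreover have "\<forall>x\<in>X. \<forall>y\<in>X. dist x y < \<delta> k \<longrightarrow>
          (\<exists>C. connected C \<and> C \<subseteq> X \<and> x \<in> C \<and> y \<in> C \<and> C \<subseteq> ball x (D * (1/2) ^ k))"
        using \<delta>(3) by simp
      ultimately obtain M c' where c': "M \<ge> 1" "\<forall>i. c' i \<in> X \<and> dist (c' i) (c' (Suc i)) < \<delta> (Suc k)"
        "\<forall>i\<ge>N * M. c' i = y" "c' 0 = c 0" "\<forall>j. dist (c' j) (c (j div M)) < D * (1/2) ^ k"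
        using chain_refinement[OF _ \<delta>(1)[of "Suc k"] _ c(2,3)] by blast
      then have "Q (Suc k) (N * M, c')" using c c' by (auto simp: Q_def)
      moreover have "R k p (N * M, c')" using c' by (auto simp: R_def Nc)
      ultimately show ?thesis by blast
    qed
    define P where "P = rec_nat (1, \<lambda>i. if i = 0 then x else y) (\<lambda>k p. SOME q. Q (Suc k) q \<and> R k p q)"
    have P0: "P 0 = (1, \<lambda>i. if i = 0 then x else y)" by (simp add: P_def)
    have PS: "Q (Suc k) (P (Suc k)) \<and> R k (P k) (P (Suc k))" if "Q k (P k)" for k
      using someI_ex[OF nxt[OF that]] by (simp add: P_def)
    have QP: "Q k (P k)" for k by (induction k) (use start P0 PS in auto)
    define N c where "N k = fst (P k)" and "c k = snd (P k)" for k
    have N1: "N k \<ge> 1" and cX: "c k i \<in> X" and cd: "dist (c k i) (c k (Suc i)) < \<delta> k"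
      and cy: "N k \<le> i \<Longrightarrow> c k i = y" and cx: "c k 0 = x" for k i
      using QP[of k] by (auto simp: Q_def N_def c_def)
    define u where "u t k = c k (nat \<lfloor>t * real (N k)\<rfloor>)" for t :: real and k
    have u_step: "dist (u t k) (u t (Suc k)) \<le> D * (1/2) ^ k" if "0 \<le> t" for t k
    proof -
      obtain M where M: "M \<ge> 1" "N (Suc k) = N k * M" "\<And>j. dist (c (Suc k) j) (c k (j div M)) < D * (1/2) ^ k"
        using PS[OF QP[of k]] by (auto simp: R_def N_def c_def)
      \<comment> \<open>The cell of \<open>t\<close> at level \<open>k\<close> is the one containing
        its cell at level \<open>k + 1\<close>, because the number of cells is multiplied by
        \<open>M\<close>.\<close>
      have "\<lfloor>t * real (N k)\<rfloor> = \<lfloor>t * real (N (Suc k)) / real_of_int (int M)\<rfloor>"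
        using M by simp
      also have "\<dots> = \<lfloor>t * real (N (Suc k))\<rfloor> div int M" by (rule floor_divide_real_eq_div) simp
      finally have "nat \<lfloor>t * real (N k)\<rfloor> = nat \<lfloor>t * real (N (Suc k))\<rfloor> div M"
        using that by (simp add: nat_div_distrib)
      then show ?thesis using M(3)[of "nat \<lfloor>t * real (N (Suc k))\<rfloor>"] by (simp add: u_def dist_commute)
    qed
    have "\<exists>l. l \<in> X \<and> (\<forall>k. dist (u t k) l \<le> 2 * D * (1/2) ^ k)" if "0 \<le> t" for t
      by (rule geometric_Cauchy_limit[of X "u t" D])
        (use X u_step[OF that] cX \<open>D > 0\<close> in \<open>auto simp: u_def compact_imp_complete\<close>)
    then obtain g where g: "\<And>t. 0 \<le> t \<Longrightarrow> g t \<in> X" "\<And>t k. 0 \<le> t \<Longrightarrow> dist (u t k) (g t) \<le> 2 * D * (1/2) ^ k"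
      by metis
    have lim0: "(\<lambda>k. K * (1/2) ^ k) \<longlonglongrightarrow> (0::real)" for K :: real
      by (intro tendsto_mult_right_zero LIMSEQ_power_zero) auto
    have g_end: "g t = z" if "0 \<le> t" "\<And>k. u t k = z" for t z
    proof -
      have "dist z (g t) \<le> 0"
      proof (rule tendsto_lowerbound[OF lim0[of "2 * D"]])
        show "\<forall>\<^sub>F k in sequentially. dist z (g t) \<le> 2 * D * (1/2) ^ k" using g(2)[of t] that by simp
      qed auto
      then show ?thesis by simp
    qed
    have g0: "g 0 = x" by (rule g_end) (auto simp: u_def cx)
    have g1: "g 1 = y" by (rule g_end) (auto simp: u_def cy)
    \<comment> \<open>The factor 5 is 2 + 1 + 2: the distances of \<open>g s\<close> and
      \<open>g t\<close> from the step function, and one jump of it between the same or adjacent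
      cells.\<close>
    have g_close: "dist (g s) (g t) < 5 * D * (1/2) ^ k" if "0 \<le> s" "s \<le> t" "(t - s) * real (N k) < 1" for s t k
    proof -
      have "dist (u s k) (u t k) < \<delta> k"
        using floor_mult_near[OF that] cd \<delta>(1) by (auto simp: u_def)
      then have "dist (u s k) (u t k) < D * (1/2) ^ k" using \<delta>(2)[of k] by linarith
      moreover have "dist (u s k) (g s) \<le> 2 * D * (1/2) ^ k" "dist (u t k) (g t) \<le> 2 * D * (1/2) ^ k"
        using g(2) that by auto
      moreover have "dist (g s) (g t) \<le> dist (u s k) (g s) + dist (u s k) (u t k) + dist (u t k) (g t)"
        by (metis dist_triangle3 dist_commute add.commute add_left_mono dist_triangle order_trans add.assoc)
      ultimately show ?thesis by linarith
    qed
    have "path g"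
      unfolding path_def continuous_on_iff
    proof (intro ballI allI impI)
      fix s e :: real assume s: "s \<in> {0..1}" and "e > 0"
      have "\<forall>\<^sub>F k in sequentially. 5 * D * (1/2) ^ k < e" using order_tendstoD(2)[OF lim0 \<open>e > 0\<close>] .
      then obtain k where k: "5 * D * (1/2) ^ k < e" by (auto simp: eventually_sequentially)
      show "\<exists>d>0. \<forall>t\<in>{0..1}. dist t s < d \<longrightarrow> dist (g t) (g s) < e"
      proof (intro exI[of _ "1 / real (N k)"] conjI ballI impI)
        show "0 < 1 / real (N k)" using N1[of k] by simp
        fix t assume t: "t \<in> {0..1}" "dist t s < 1 / real (N k)"
        then have "\<bar>t - s\<bar> * real (N k) < 1" using N1[of k] by (simp add: dist_real_def field_simps)
        then show "dist (g t) (g s) < e"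
          using g_close[of s t k] g_close[of t s k] s t k by (cases "s \<le> t") (auto simp: dist_commute)
      qed
    qed
    moreover have "g t \<in> X \<inter> ball x \<epsilon>" if t: "t \<in> {0..1}" for t
    proof (cases "t = 1")
      case True
      have "dist x y < D" using xy(3) \<delta>(2)[of 0] by simp
      then show ?thesis using True g1 xy \<open>D > 0\<close> by (simp add: D_def)
    next
      case False
      then have "\<lfloor>t\<rfloor> = 0" using t by (simp add: floor_eq_iff)
      then have "u t 0 = x" using P0 by (simp add: u_def N_def c_def)
      then have "dist x (g t) \<le> 2 * D" using g(2)[of t 0] t by simp
      then show ?thesis using g(1)[of t] t \<open>D > 0\<close> by (simp add: D_def)
    qed
    then have "path_image g \<subseteq> X \<inter> ball x \<epsilon>" by (auto simp: path_image_def)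
    ultimately show "\<exists>g. path g \<and> pathstart g = x \<and> pathfinish g = y \<and> path_image g \<subseteq> X \<inter> ball x \<epsilon>"
      using g0 g1 by (intro exI[of _ g]) (auto simp: pathstart_def pathfinish_def)
  qed
qed

text \<open>Path components of \<open>U\<close> are open by \<open>short_path\<close>. Applied to a
  component of the complement of a point, this gives paths that avoid the point.\<close>

lemma open_connected_imp_path_connected:
  fixes X :: "'a::metric_space set"
  assumes X: "compact X" "locally connected X" and U: "openin (top_of_set X) U" "connected U"
    and xy: "x \<in> U" "y \<in> U"
  obtains g where "path g" "path_image g \<subseteq> U" "pathstart g = x" "pathfinish g = y"
proof -
  have "path_component U x y"
  proof (rule connected_equivalence_relation[OF U(2) xy])
    fix a assume a: "a \<in> U"
    obtain V where V: "open V" "U = X \<inter> V" using U(1) by (auto simp: openin_open)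
    then obtain e where e: "e > 0" "ball a e \<subseteq> V" using a openE by blast
    obtain d where d: "d > 0" "\<forall>x\<in>X. \<forall>y\<in>X. dist x y < d \<longrightarrow>
        (\<exists>g. path g \<and> pathstart g = x \<and> pathfinish g = y \<and> path_image g \<subseteq> X \<inter> ball x e)"
      using short_path[OF X e(1)] by blast
    have "path_component U a z" if z: "z \<in> U \<inter> ball a d" for z
    proof -
      obtain g where "path g" "pathstart g = a" "pathfinish g = z" "path_image g \<subseteq> X \<inter> ball a e"
        using d(2)[rule_format, of a z] a z V by auto
      then show ?thesis using V e unfolding path_component_def by blast
    qed
    then show "\<exists>T. openin (top_of_set U) T \<and> a \<in> T \<and> (\<forall>x\<in>T. path_component U a x)"
      using a d(1) by (intro exI[of _ "U \<inter> ball a d"]) (auto simp: openin_open_Int)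
  qed (blast intro: path_component_sym path_component_trans)+
  then show ?thesis using that unfolding path_component_def by blast
qed

text \<open>Isometric embedding into a Banach space: the library states its theorems on arcs for normed spaces only.\<close>
definition kuratowski :: "'a::metric_space \<Rightarrow> 'a \<Rightarrow> ('a \<Rightarrow>\<^sub>C real)" where
  "kuratowski x0 x = Bcontfun (\<lambda>z. dist x z - dist x0 z)"

text \<open>The subtracted term keeps the function bounded, by \<open>dist x x0\<close>, so that it
  is an element of the space of bounded continuous functions.\<close>

lemma apply_kuratowski: "apply_bcontfun (kuratowski x0 x) z = dist x z - dist x0 z"
proof -
  have "(\<lambda>z. dist x z - dist x0 z) \<in> bcontfun"
  proof (rule bcontfun_normI)
    show "continuous_on UNIV (\<lambda>z. dist x z - dist x0 z)" by (intro continuous_intros)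
    show "norm (dist x z - dist x0 z) \<le> dist x x0" for z
      using dist_triangle[of x z x0] dist_triangle[of x0 z x] by (simp add: dist_commute abs_le_iff)
  qed
  then show ?thesis by (simp add: kuratowski_def Bcontfun_inverse)
qed

lemma dist_kuratowski: "dist (kuratowski x0 x) (kuratowski x0 y) = dist x y"
proof (rule antisym)
  show "dist (kuratowski x0 x) (kuratowski x0 y) \<le> dist x y"
  proof (rule dist_bound)
    fix z show "dist (apply_bcontfun (kuratowski x0 x) z) (apply_bcontfun (kuratowski x0 y) z) \<le> dist x y"
      using dist_triangle[of x z y] dist_triangle[of y z x]
      by (simp add: apply_kuratowski dist_real_def dist_commute abs_le_iff)
  qed
  \<comment> \<open>Evaluation at the point \<open>x\<close> already attains the distance.\<close>
  have "dist x y = dist (apply_bcontfun (kuratowski x0 x) x) (apply_bcontfun (kuratowski x0 y) x)"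
    by (simp add: apply_kuratowski dist_real_def dist_commute)
  also have "\<dots> \<le> dist (kuratowski x0 x) (kuratowski x0 y)" by (rule dist_bounded)
  finally show "dist x y \<le> dist (kuratowski x0 x) (kuratowski x0 y)" .
qed

lemma path_contains_arc_metric:
  fixes p :: "real \<Rightarrow> 'a::metric_space"
  assumes p: "path p" and ne: "pathstart p \<noteq> pathfinish p"
  obtains q where "arc q" "path_image q \<subseteq> path_image p" "pathstart q = pathstart p" "pathfinish q = pathfinish p"
proof -
  define f where "f = kuratowski (pathstart p)"
  have f: "dist (f x) (f y) = dist x y" for x y by (simp add: f_def dist_kuratowski)
  then have inj: "inj_on f S" for S by (intro inj_onI) (metis dist_eq_0_iff)
  have cont: "continuous_on S f" for S
    unfolding continuous_on_iff using f by auto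
  have cont_inv: "continuous_on (f ` S) (inv_into UNIV f)" for S
    unfolding continuous_on_iff using f inj[of UNIV] by (auto simp: inv_f_f)
  have "path (f \<circ> p)" using p cont by (rule path_continuous_image)
  moreover have "f (pathstart p) \<noteq> f (pathfinish p)" using inj[of UNIV] ne by (auto dest: injD)
  ultimately obtain q where q: "arc q" "path_image q \<subseteq> path_image (f \<circ> p)"
    "pathstart q = f (pathstart p)" "pathfinish q = f (pathfinish p)"
    using path_contains_arc[of "f \<circ> p" "f (pathstart p)" "f (pathfinish p)"]
    by (auto simp: pathstart_compose pathfinish_compose)
  have sub: "path_image q \<subseteq> f ` path_image p" using q(2) by (simp add: path_image_compose)
  show ?thesis
  proof (rule that[of "inv_into UNIV f \<circ> q"])
    have "continuous_on (path_image q) (inv_into UNIV f)"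
      using cont_inv sub by (rule continuous_on_subset)
    moreover have "inj_on (inv_into UNIV f) (path_image q)"
      using sub by (intro inj_on_inv_into) auto
    ultimately show "arc (inv_into UNIV f \<circ> q)"
      using q(1) path_continuous_image[of q "inv_into UNIV f"]
      unfolding arc_def by (auto simp: path_image_def intro: comp_inj_on)
    show "path_image (inv_into UNIV f \<circ> q) \<subseteq> path_image p"
      using sub inj[of UNIV] by (auto simp: path_image_compose inv_f_f)
  qed (use q inj[of UNIV] in \<open>auto simp: pathstart_compose pathfinish_compose inv_f_f\<close>)
qed

section \<open>Separation in dendrites\<close>

lemma homeomorphic_kuratowski: "S homeomorphic kuratowski x0 ` S"
proof -
  define f where "f = kuratowski x0"
  have f: "dist (f x) (f y) = dist x y" for x y by (simp add: f_def dist_kuratowski)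
  then have inj: "inj f" by (intro injI) (metis dist_eq_0_iff)
  have "homeomorphism S (f ` S) f (inv f)"
  proof (rule homeomorphismI)
    show "continuous_on S f" "continuous_on (f ` S) (inv f)"
      unfolding continuous_on_iff using f inj by auto
  qed (use inj in auto)
  then show ?thesis unfolding homeomorphic_def f_def by blast
qed

text \<open>Around the parameter 1/2 take the largest interval, from \<open>s\<close> to
  \<open>u\<close>, whose interior is mapped off the second arc. This piece of
  \<open>\<gamma>\<close> meets the second arc only at its two ends and closes up with the piece of
  \<open>\<delta>\<close> between them.\<close>

lemma two_arcs_contain_circle_normed:
  fixes \<gamma> \<delta> :: "real \<Rightarrow> 'a::real_normed_vector"
  assumes \<gamma>: "arc \<gamma>" and \<delta>: "arc \<delta>"
    and ends: "pathstart \<delta> = pathstart \<gamma>" "pathfinish \<delta> = pathfinish \<gamma>"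
    and mid: "\<gamma> (1/2) \<notin> path_image \<delta>"
  obtains C where "C \<subseteq> path_image \<gamma> \<union> path_image \<delta>" "C homeomorphic sphere (0::complex) 1"
proof -
  have inj: "inj_on \<gamma> {0..1}" and path\<gamma>: "path \<gamma>" using \<gamma>(1) by (auto simp: arc_def)
  define D where "D = path_image \<delta>"
  have "closed D" using \<delta>(1) by (simp add: D_def arc_imp_path closed_path_image)
  have endsD: "\<gamma> 0 \<in> D" "\<gamma> 1 \<in> D"
    using ends pathstart_in_path_image[of \<delta>] pathfinish_in_path_image[of \<delta>]
    by (auto simp: D_def pathstart_def pathfinish_def)
  have cont: "continuous_on S \<gamma>" if "S \<subseteq> {0..1}" for S
    using path\<gamma> that continuous_on_subset by (auto simp: path_def)
  have compact: "compact ({l..r} \<inter> \<gamma> -` D)" if "0 \<le> l" "r \<le> 1" for l r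
  proof -
    have "closed ({l..r} \<inter> \<gamma> -` D)"
      using that by (intro continuous_closed_preimage cont \<open>closed D\<close>) auto
    then have "compact ({l..r} \<inter> ({l..r} \<inter> \<gamma> -` D))" by (intro compact_Int_closed compact_Icc)
    then show ?thesis by simp
  qed
  have ne: "0 \<in> {0..1/2} \<inter> \<gamma> -` D" "1 \<in> {1/2..1} \<inter> \<gamma> -` D" using endsD by auto
  have c1: "compact ({0..1/2} \<inter> \<gamma> -` D)" and c2: "compact ({1/2..1} \<inter> \<gamma> -` D)"
    by (rule compact; simp)+
  have "\<exists>s\<in>{0..1/2} \<inter> \<gamma> -` D. \<forall>t\<in>{0..1/2} \<inter> \<gamma> -` D. t \<le> s"
    using ne(1) by (intro compact_attains_sup c1) blast
  then obtain s where s: "s \<in> {0..1/2} \<inter> \<gamma> -` D" "\<And>t. t \<in> {0..1/2} \<inter> \<gamma> -` D \<Longrightarrow> t \<le> s"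
    by blast
  have "\<exists>u\<in>{1/2..1} \<inter> \<gamma> -` D. \<forall>t\<in>{1/2..1} \<inter> \<gamma> -` D. u \<le> t"
    using ne(2) by (intro compact_attains_inf c2) blast
  then obtain u where u: "u \<in> {1/2..1} \<inter> \<gamma> -` D" "\<And>t. t \<in> {1/2..1} \<inter> \<gamma> -` D \<Longrightarrow> u \<le> t"
    by blast
  have suD: "\<gamma> s \<in> D" "\<gamma> u \<in> D" using s(1) u(1) by auto
  then have "s \<noteq> 1/2" "u \<noteq> 1/2" using mid unfolding D_def by metis+
  then have su: "s < u" "s \<in> {0..1}" "u \<in> {0..1}" using s(1) u(1) by auto
  have meet: "path_image (subpath s u \<gamma>) \<inter> D \<subseteq> {\<gamma> s, \<gamma> u}"
  proof
    fix z assume z: "z \<in> path_image (subpath s u \<gamma>) \<inter> D"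
    then obtain t where t: "t \<in> {s..u}" "z = \<gamma> t" using su by (auto simp: path_image_subpath)
    then have "t \<in> {0..1/2} \<inter> \<gamma> -` D \<or> t \<in> {1/2..1} \<inter> \<gamma> -` D" using su z by auto
    then have "t = s \<or> t = u" using s(2)[of t] u(2)[of t] t(1) by auto
    then show "z \<in> {\<gamma> s, \<gamma> u}" using t by auto
  qed
  obtain s' u' where s'u': "s' \<in> {0..1}" "u' \<in> {0..1}" "\<gamma> s = \<delta> s'" "\<gamma> u = \<delta> u'"
    using suD unfolding D_def path_image_def by blast
  have "\<gamma> s \<noteq> \<gamma> u" using inj su by (metis inj_onD less_irrefl)
  then have "s' \<noteq> u'" using s'u' by auto
  define loop where "loop = subpath s u \<gamma> +++ subpath u' s' \<delta>"
  have sub: "path_image (subpath u' s' \<delta>) \<subseteq> D" unfolding D_def by (intro path_image_subpath_subset s'u')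
  have "simple_path loop"
    unfolding loop_def
  proof (rule simple_path_join_loop)
    show "arc (subpath s u \<gamma>)" "arc (subpath u' s' \<delta>)"
      using arc_subpath_arc[OF \<gamma> su(2,3)] arc_subpath_arc[OF \<delta> s'u'(2,1)] su(1) \<open>s' \<noteq> u'\<close> by auto
  qed (use meet sub s'u' in auto)
  moreover have "pathfinish loop = pathstart loop" using s'u' by (simp add: loop_def)
  ultimately have "path_image loop homeomorphic sphere (0::complex) 1"
    by (intro homeomorphic_simple_path_image_circle) auto
  moreover have "path_image loop \<subseteq> path_image \<gamma> \<union> path_image \<delta>"
    using path_image_join_subset[of "subpath s u \<gamma>" "subpath u' s' \<delta>"] sub
      path_image_subpath_subset[OF su(2,3), of \<gamma>] unfolding loop_def D_def by blast
  ultimately show ?thesis using that by blast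
qed

lemma arc_kuratowski:
  assumes "arc \<gamma>"
  shows "arc (kuratowski x0 \<circ> \<gamma>)"
proof -
  have cont: "continuous_on S (kuratowski x0)" for S
    unfolding continuous_on_iff by (auto simp: dist_kuratowski)
  have "inj (kuratowski x0)" by (intro injI) (metis dist_eq_0_iff dist_kuratowski)
  then have "inj_on (kuratowski x0 \<circ> \<gamma>) {0..1}"
    using assms by (intro comp_inj_on) (auto simp: arc_def intro: inj_on_subset)
  then show ?thesis using assms path_continuous_image[OF _ cont] by (simp add: arc_def)
qed

lemma two_arcs_contain_circle:
  fixes \<gamma> \<delta> :: "real \<Rightarrow> 'a::metric_space"
  assumes \<gamma>: "arc \<gamma>" and \<delta>: "arc \<delta>"
    and ends: "pathstart \<delta> = pathstart \<gamma>" "pathfinish \<delta> = pathfinish \<gamma>"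
    and mid: "\<gamma> (1/2) \<notin> path_image \<delta>"
  obtains C where "C \<subseteq> path_image \<gamma> \<union> path_image \<delta>" "C homeomorphic sphere (0::complex) 1"
proof -
  define f where "f = kuratowski (pathstart \<gamma>)"
  have inj: "inj f" unfolding f_def by (intro injI) (metis dist_eq_0_iff dist_kuratowski)
  obtain C where C: "C \<subseteq> path_image (f \<circ> \<gamma>) \<union> path_image (f \<circ> \<delta>)" "C homeomorphic sphere (0::complex) 1"
  proof (rule two_arcs_contain_circle_normed[of "f \<circ> \<gamma>" "f \<circ> \<delta>"])
    show "(f \<circ> \<gamma>) (1/2) \<notin> path_image (f \<circ> \<delta>)"
      using mid inj by (auto simp: path_image_compose dest: injD)
  qed (use \<gamma> \<delta> ends arc_kuratowski in \<open>auto simp: f_def pathstart_compose pathfinish_compose\<close>)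
  then have "C \<subseteq> f ` (path_image \<gamma> \<union> path_image \<delta>)" by (simp add: path_image_compose image_Un)
  then obtain C' where C': "C' \<subseteq> path_image \<gamma> \<union> path_image \<delta>" "C = f ` C'"
    by (meson subset_imageE)
  then have "C' homeomorphic sphere (0::complex) 1"
    using C(2) homeomorphic_kuratowski homeomorphic_trans unfolding f_def by blast
  then show ?thesis using that C' by blast
qed

text \<open>The midpoint \<open>p\<close> of an arc from \<open>x\<close> to \<open>y\<close>
  separates them. Otherwise they lie in one component of the complement of \<open>p\<close>, which
  is open and connected and so contains a second arc; that arc misses \<open>p\<close>, and the two
  arcs contain a circle.\<close>

lemma dendrite_separation:
  fixes X :: "'a::metric_space set"
  assumes X: "dendrite X" and xy: "x \<in> X" "y \<in> X" "x \<noteq> y"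
  obtains p where "p \<in> X" "p \<noteq> x" "p \<noteq> y" "\<not> connected_component (X - {p}) x y"
proof -
  have X': "compact X" "connected X" "locally connected X" using X by (auto simp: dendrite_def)
  have arcs: "\<exists>g. arc g \<and> path_image g \<subseteq> U \<and> pathstart g = x \<and> pathfinish g = y"
    if U: "openin (top_of_set X) U" "connected U" "x \<in> U" "y \<in> U" for U
  proof -
    obtain g where g: "path g" "path_image g \<subseteq> U" "pathstart g = x" "pathfinish g = y"
      using open_connected_imp_path_connected[OF X'(1,3) U] .
    then have "pathstart g \<noteq> pathfinish g" using xy by simp
    from path_contains_arc_metric[OF g(1) this] show ?thesis using g by (metis order_trans)
  qed
  obtain \<gamma> where \<gamma>: "arc \<gamma>" "path_image \<gamma> \<subseteq> X" "pathstart \<gamma> = x" "pathfinish \<gamma> = y"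
    using arcs[of X] X' xy by auto
  have inj: "inj_on \<gamma> {0..1}" using \<gamma>(1) by (auto simp: arc_def)
  define p where "p = \<gamma> (1/2)"
  have ends: "\<gamma> 0 = x" "\<gamma> 1 = y" using \<gamma> by (auto simp: pathstart_def pathfinish_def)
  have p: "p \<in> X" "p \<noteq> x" "p \<noteq> y"
    using \<gamma>(2) inj_onD[OF inj, of "1/2" 0] inj_onD[OF inj, of "1/2" 1] ends
    by (auto simp: p_def path_image_def)
  have "\<not> connected_component (X - {p}) x y"
  proof
    assume conn: "connected_component (X - {p}) x y"
    define W where "W = connected_component_set (X - {p}) x"
    have "openin (top_of_set X) (X - {p})"
      by (metis openin_delete openin_subtopology_self)
    then have "openin (top_of_set X) W"
      unfolding W_def using X'(3) locally_open_subset openin_connected_component_locally_connected openin_trans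
      by blast
    moreover have "connected W" "x \<in> W" "y \<in> W"
      using conn p xy unfolding W_def by (auto simp: connected_connected_component connected_component_refl)
    ultimately obtain \<delta> where \<delta>: "arc \<delta>" "path_image \<delta> \<subseteq> W" "pathstart \<delta> = x" "pathfinish \<delta> = y"
      using arcs by blast
    have W: "W \<subseteq> X - {p}" unfolding W_def by (rule connected_component_subset)
    then have "\<gamma> (1/2) \<notin> path_image \<delta>" using \<delta>(2) unfolding p_def by blast
    then obtain C where "C \<subseteq> path_image \<gamma> \<union> path_image \<delta>" "C homeomorphic sphere (0::complex) 1"
      using two_arcs_contain_circle[OF \<gamma>(1) \<delta>(1)] \<gamma> \<delta> by metis
    moreover have "path_image \<gamma> \<union> path_image \<delta> \<subseteq> X" using \<gamma>(2) \<delta>(2) W by blast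
    ultimately show False using X unfolding dendrite_def by blast
  qed
  then show ?thesis using that p by blast
qed

section \<open>Calculus of cut points in a tree-like continuum\<close>

locale tree_space =
  fixes X :: "'a::metric_space set"
  assumes compact_X: "compact X" and connected_X: "connected X" and loc_connected_X: "locally connected X"
    and separation: "\<lbrakk>x \<in> X; y \<in> X; x \<noteq> y\<rbrakk> \<Longrightarrow>
      \<exists>p\<in>X. p \<noteq> x \<and> p \<noteq> y \<and> \<not> connected_component (X - {p}) x y"
begin

abbreviation branch :: "'a \<Rightarrow> 'a \<Rightarrow> 'a set" where
  "branch p x \<equiv> connected_component_set (X - {p}) x"

abbreviation joined :: "'a \<Rightarrow> 'a \<Rightarrow> 'a \<Rightarrow> bool" where
  "joined p x y \<equiv> connected_component (X - {p}) x y"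

lemma joined_in: "joined p x y \<Longrightarrow> x \<in> X \<and> y \<in> X \<and> x \<noteq> p \<and> y \<noteq> p"
  using connected_component_in by fastforce

lemma joined_sym: "joined p x y \<Longrightarrow> joined p y x"
  by (rule connected_component_sym)

lemma joined_trans: "joined p x y \<Longrightarrow> joined p y z \<Longrightarrow> joined p x z"
  by (rule connected_component_trans)

lemma branch_subset: "branch p x \<subseteq> X - {p}"
  by (rule connected_component_subset)

lemma joined_refl: "\<lbrakk>x \<in> X; x \<noteq> p\<rbrakk> \<Longrightarrow> joined p x x"
  by (simp add: connected_component_refl)

lemma joinedI: "\<lbrakk>connected S; S \<subseteq> X; p \<notin> S; x \<in> S; y \<in> S\<rbrakk> \<Longrightarrow> joined p x y"
  unfolding connected_component_def by blast

lemma openin_branch: "openin (top_of_set X) (branch p x)"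
proof -
  have "openin (top_of_set X) (X - {p})"
    by (metis openin_delete openin_subtopology_self)
  then show ?thesis
    using loc_connected_X locally_open_subset openin_connected_component_locally_connected openin_trans
    by blast
qed

text \<open>What remains of \<open>X\<close> is the union of the other branches at \<open>p\<close>,
  which are open.\<close>

lemma closed_insert_branch:
  assumes p: "p \<in> X"
  shows "closed (insert p (branch p x))"
proof -
  have "X - insert p (branch p x) = \<Union>(branch p ` (X - insert p (branch p x)))"
  proof (intro equalityI subsetI)
    fix z assume "z \<in> X - insert p (branch p x)"
    then show "z \<in> \<Union>(branch p ` (X - insert p (branch p x)))" using joined_refl[of z p] by (auto intro!: bexI[of _ z])
  next
    fix z assume "z \<in> \<Union>(branch p ` (X - insert p (branch p x)))"
    then obtain w where w: "\<not> joined p x w" "joined p w z" by auto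
    then have "\<not> joined p x z" using joined_trans joined_sym by metis
    then show "z \<in> X - insert p (branch p x)" using joined_in[OF w(2)] by auto
  qed
  then have "openin (top_of_set X) (X - insert p (branch p x))"
    by (metis (no_types, lifting) imageE openin_Union openin_branch)
  moreover have sub: "insert p (branch p x) \<subseteq> X" using p branch_subset by auto
  ultimately have "closedin (top_of_set X) (insert p (branch p x))"
    by (simp add: closedin_def)
  then show ?thesis using compact_X compact_imp_closed closedin_closed_trans by blast
qed

text \<open>The point \<open>p\<close> adheres to each of its branches: a branch not adhering to
  \<open>p\<close> would be open and closed in the connected space \<open>X\<close>.\<close>

lemma connected_insert_branch:
  assumes p: "p \<in> X" and x: "x \<in> X" "x \<noteq> p"
  shows "connected (insert p (branch p x))"
proof -
  have "p \<in> closure (branch p x)"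
  proof (rule ccontr)
    assume n: "p \<notin> closure (branch p x)"
    have "closure (branch p x) \<subseteq> insert p (branch p x)"
      by (rule closure_minimal[OF _ closed_insert_branch[OF p]]) auto
    then have "closure (branch p x) = branch p x" using n closure_subset by blast
    then have "closed (branch p x)" using closure_eq by blast
    then have "closedin (top_of_set X) (branch p x)"
      using branch_subset by (intro closed_subset) blast+
    moreover have "x \<in> branch p x" using joined_refl[of x p] x by simp
    moreover have "p \<notin> branch p x" using branch_subset by blast
    ultimately show False using connected_X openin_branch p connected_clopen by blast
  qed
  then show ?thesis
    by (intro connected_intermediate_closure[OF connected_connected_component])
      (use closure_subset[of "branch p x"] in auto)
qed

text \<open>The branch of \<open>x\<close> at \<open>p\<close> together with \<open>p\<close> is
  connected and misses \<open>q\<close>. This is the basic inference: it yields transitivity,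
  linearity and density of the order below.\<close>

lemma not_joined_switch:
  assumes "p \<in> X" "q \<in> X" "x \<in> X" "p \<noteq> q" "x \<noteq> p" "\<not> joined p q x"
  shows "joined q p x"
proof (rule joinedI[OF connected_insert_branch[of p x]])
  show "q \<notin> insert p (branch p x)" using assms joined_sym by fastforce
  show "insert p (branch p x) \<subseteq> X" using branch_subset assms by auto
qed (use assms joined_refl[of x p] in auto)

end

section \<open>The order defined by separation from a root\<close>

locale rooted_tree_space = tree_space +
  fixes a assumes root: "a \<in> X"
begin

text \<open>Also covers \<open>x = a\<close> and \<open>x = y\<close>: then \<open>a\<close> or \<open>y\<close> is not in \<open>X - {x}\<close>, so \<open>joined x a y\<close> fails.\<close>
definition below :: "'a \<Rightarrow> 'a \<Rightarrow> bool" (infix \<open>\<sqsubseteq>\<close> 50) where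
  "x \<sqsubseteq> y \<longleftrightarrow> \<not> joined x a y"

lemma below_refl [simp]: "x \<sqsubseteq> x"
  using joined_in[of x a x] by (auto simp: below_def)

lemma root_below [simp]: "a \<sqsubseteq> x"
  using joined_in[of a a x] by (auto simp: below_def)

lemma below_root: "\<lbrakk>x \<in> X; x \<sqsubseteq> a\<rbrakk> \<Longrightarrow> x = a"
  using joined_refl root by (auto simp: below_def)

lemma joined_root_above: "\<lbrakk>x \<in> X; y \<in> X; x \<noteq> y; x \<sqsubseteq> y\<rbrakk> \<Longrightarrow> joined y a x \<and> y \<noteq> a"
proof (cases "x = a")
  case False
  assume A: "x \<in> X" "y \<in> X" "x \<noteq> y" "x \<sqsubseteq> y"
  then have "\<not> joined x y a" unfolding below_def using joined_sym by metis
  then have "joined y x a" using not_joined_switch[of x y a] A False root by auto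
  then show ?thesis using joined_in joined_sym by metis
qed (use root joined_refl in auto)

lemma below_antisym: "\<lbrakk>x \<in> X; y \<in> X; x \<sqsubseteq> y; y \<sqsubseteq> x\<rbrakk> \<Longrightarrow> x = y"
  using joined_root_above[of x y] by (auto simp: below_def)

lemma below_trans:
  assumes "x \<in> X" "y \<in> X" "z \<in> X" and xy: "x \<sqsubseteq> y" and yz: "y \<sqsubseteq> z"
  shows "x \<sqsubseteq> z"
proof (cases "x = y \<or> y = z \<or> x = a")
  case False
  have "joined y a x" using joined_root_above assms False by blast
  then have "\<not> joined y x z" using yz unfolding below_def by (metis joined_trans)
  then have "joined x y z" using not_joined_switch[of y x z] assms False by auto
  then show ?thesis using xy unfolding below_def by (metis joined_trans joined_sym)
qed (use assms in auto)

lemma below_linear: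
  assumes "x \<in> X" "y \<in> X" "z \<in> X" "x \<sqsubseteq> z" "y \<sqsubseteq> z"
  shows "x \<sqsubseteq> y \<or> y \<sqsubseteq> x"
proof (rule ccontr)
  assume n: "\<not> ?thesis"
  then have j: "joined x a y" "joined y a x" by (auto simp: below_def)
  then have ne: "x \<noteq> y" "z \<noteq> x" using joined_in[OF j(1)] assms n by auto
  have "\<not> joined x y z" using j assms(4) unfolding below_def by (metis joined_trans)
  then have "joined y x z" using not_joined_switch[of x y z] assms ne by auto
  then show False using j assms(5) unfolding below_def by (metis joined_trans)
qed

definition up :: "'a \<Rightarrow> 'a set" where "up x = {y \<in> X. x \<sqsubseteq> y}"

lemma compact_up: "compact (up x)"
proof -
  have "up x = X - branch x a" by (auto simp: up_def below_def)
  moreover have "closedin (top_of_set X) (X - branch x a)"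
    using openin_branch by (simp add: closedin_diff)
  ultimately show ?thesis using compact_X closedin_compact by metis
qed

text \<open>Being strictly off the arc is an open condition: if \<open>z\<close> does not separate
  \<open>a\<close> from \<open>x\<close>, a path from \<open>a\<close> to \<open>x\<close> misses
  \<open>z\<close>, and its compact image misses a neighbourhood of \<open>z\<close>.\<close>

lemma compact_down:
  assumes x: "x \<in> X"
  shows "compact {z \<in> X. z \<sqsubseteq> x}"
proof -
  have "openin (top_of_set X) {z \<in> X. joined z a x}"
  proof (subst openin_subopen, intro ballI)
    fix z assume z: "z \<in> {z \<in> X. joined z a x}"
    then have ax: "a \<in> branch z a" "x \<in> branch z a"
      using joined_in[of z a x] joined_refl[of a z] by auto
    obtain g where g: "path g" "path_image g \<subseteq> branch z a" "pathstart g = a" "pathfinish g = x"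
      using open_connected_imp_path_connected[OF compact_X loc_connected_X openin_branch
          connected_connected_component ax] .
    have "openin (top_of_set X) (X - path_image g)"
      using g(1) by (simp add: closed_path_image open_Compl openin_open_Int Diff_eq)
    moreover have "z \<in> X - path_image g" using g(2) z branch_subset[of z a] by auto
    moreover have "joined w a x" if "w \<in> X - path_image g" for w
    proof (rule joinedI[of "path_image g"])
      show "connected (path_image g)" using g(1) by (rule connected_path_image)
      show "path_image g \<subseteq> X" using g(2) branch_subset by blast
      show "a \<in> path_image g" "x \<in> path_image g"
        using pathstart_in_path_image[of g] pathfinish_in_path_image[of g] g by auto
    qed (use that in auto)
    ultimately show "\<exists>T. openin (top_of_set X) T \<and> z \<in> T \<and> T \<subseteq> {z \<in> X. joined z a x}"
      by (intro exI[of _ "X - path_image g"]) auto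
  qed
  then have "closedin (top_of_set X) (X - {z \<in> X. joined z a x})" by (simp add: closedin_diff)
  moreover have "X - {z \<in> X. joined z a x} = {z \<in> X. z \<sqsubseteq> x}" by (auto simp: below_def)
  ultimately show ?thesis using compact_X closedin_compact by metis
qed

text \<open>Finite intersection property of the closed sets \<open>up c\<close>. The compact set
  \<open>S\<close> keeps the bound in a prescribed place: the common lower bounds for
  \<open>meet_exists\<close>, and \<open>up x0\<close> for Zorn's lemma.\<close>

lemma chain_upper_bound:
  assumes S: "compact S" "S \<subseteq> X" "S \<noteq> {}" and C: "C \<subseteq> S"
    and linear: "\<And>x y. \<lbrakk>x \<in> C; y \<in> C\<rbrakk> \<Longrightarrow> x \<sqsubseteq> y \<or> y \<sqsubseteq> x"
  obtains u where "u \<in> S" "\<And>c. c \<in> C \<Longrightarrow> c \<sqsubseteq> u"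
proof -
  have finite_bound: "\<exists>m\<in>Z. \<forall>z\<in>Z. z \<sqsubseteq> m" if "finite Z" "Z \<noteq> {}" "Z \<subseteq> C" for Z
    using that
  proof (induction Z rule: finite_ne_induct)
    case (insert z Z)
    then obtain m where m: "m \<in> Z" "\<forall>z\<in>Z. z \<sqsubseteq> m" by auto
    show ?case
    proof (cases "z \<sqsubseteq> m")
      case False
      then have "m \<sqsubseteq> z" using linear[of z m] m insert.prems by auto
      moreover have "insert z Z \<subseteq> X" using insert.prems C S(2) by blast
      ultimately have "\<forall>w\<in>insert z Z. w \<sqsubseteq> z"
        using m below_trans[of _ m z] by auto
      then show ?thesis by blast
    qed (use m in auto)
  qed auto
  have "S \<inter> (\<Inter>c\<in>C. up c) \<noteq> {}"
  proof (rule compact_imp_fip_image[OF S(1)])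
    show "closed (up c)" for c using compact_up compact_imp_closed by blast
    fix Z assume Z: "finite Z" "Z \<subseteq> C"
    show "S \<inter> (\<Inter>c\<in>Z. up c) \<noteq> {}"
    proof (cases "Z = {}")
      case False
      then obtain m where m: "m \<in> Z" "\<forall>z\<in>Z. z \<sqsubseteq> m" using finite_bound Z by blast
      then have "m \<in> S \<inter> (\<Inter>c\<in>Z. up c)" using Z C S(2) by (auto simp: up_def)
      then show ?thesis by blast
    qed (use S in auto)
  qed
  then show ?thesis using that by (auto simp: up_def)
qed

text \<open>The common lower bounds form a compact chain, which therefore contains an upper bound of
  itself.\<close>

lemma meet_exists:
  assumes xy: "x \<in> X" "y \<in> X"
  obtains m where "m \<in> X" "m \<sqsubseteq> x" "m \<sqsubseteq> y" "\<And>z. \<lbrakk>z \<in> X; z \<sqsubseteq> x; z \<sqsubseteq> y\<rbrakk> \<Longrightarrow> z \<sqsubseteq> m"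
proof -
  define L where "L = {z \<in> X. z \<sqsubseteq> x} \<inter> {z \<in> X. z \<sqsubseteq> y}"
  have L: "compact L" using compact_down xy by (auto simp: L_def intro: compact_Int)
  have "L \<noteq> {}" "L \<subseteq> X" using root by (auto simp: L_def)
  moreover have "u \<sqsubseteq> v \<or> v \<sqsubseteq> u" if "u \<in> L" "v \<in> L" for u v
    using below_linear[of u v x] that xy by (auto simp: L_def)
  ultimately obtain m where "m \<in> L" "\<And>c. c \<in> L \<Longrightarrow> c \<sqsubseteq> m"
    using chain_upper_bound[OF L, of L] by (metis order_refl)
  then show ?thesis using that by (auto simp: L_def)
qed

text \<open>A cut point \<open>p\<close> between \<open>x\<close> and \<open>y\<close> works. If it
  were not below \<open>y\<close>, then \<open>a\<close> and \<open>y\<close> would be on one side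
  of \<open>p\<close>, so \<open>p\<close> would be below \<open>x\<close> and hence below
  \<open>y\<close>. If it were below \<open>x\<close>, then \<open>x\<close> would separate it from
  \<open>y\<close>, and \<open>not_joined_switch\<close> would join \<open>x\<close> and
  \<open>y\<close> off \<open>p\<close>.\<close>

lemma below_dense:
  assumes xy: "x \<in> X" "y \<in> X" "x \<sqsubseteq> y" "x \<noteq> y"
  obtains z where "z \<in> X" "x \<sqsubseteq> z" "x \<noteq> z" "z \<sqsubseteq> y" "z \<noteq> y"
proof -
  obtain p where p: "p \<in> X" "p \<noteq> x" "p \<noteq> y" "\<not> joined p x y" using separation xy by blast
  have py: "p \<sqsubseteq> y"
  proof (rule ccontr)
    assume n: "\<not> p \<sqsubseteq> y"
    then have "joined p a y" by (simp add: below_def)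
    then have "\<not> joined p a x" using p(4) joined_trans joined_sym by metis
    then have "p \<sqsubseteq> x" by (simp add: below_def)
    then show False using below_trans p(1) xy n by blast
  qed
  have "\<not> p \<sqsubseteq> x"
  proof
    assume "p \<sqsubseteq> x"
    then have "joined x a p" using joined_root_above p xy by blast
    then have "\<not> joined x p y" using xy(3) unfolding below_def by (metis joined_trans)
    then show False using not_joined_switch[of x p y] p xy by auto
  qed
  then have "x \<sqsubseteq> p" using below_linear[of x p y] p(1) xy py by blast
  then show ?thesis using that p py by metis
qed

text \<open>A union of closed branches at \<open>z\<close>, all containing \<open>z\<close>.\<close>

lemma connected_up:
  assumes z: "z \<in> X"
  shows "connected (up z)"
proof -
  define \<S> where "\<S> = insert {z} ((\<lambda>w. insert z (branch z w)) ` (up z - {z}))"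
  have "connected (\<Union>\<S>)"
  proof (rule connected_Union)
    show "connected s" if "s \<in> \<S>" for s
      using that connected_insert_branch[OF z] by (auto simp: \<S>_def up_def)
    show "\<Inter>\<S> \<noteq> {}" by (auto simp: \<S>_def)
  qed
  moreover have "\<Union>\<S> = up z"
  proof
    show "\<Union>\<S> \<subseteq> up z"
    proof
      fix v assume "v \<in> \<Union>\<S>"
      then consider "v = z" | w where "w \<in> up z" "joined z w v" unfolding \<S>_def by blast
      then show "v \<in> up z"
      proof cases
        case 2
        then have "\<not> joined z a w" by (simp add: up_def below_def)
        then have "\<not> joined z a v" using joined_trans joined_sym 2(2) by metis
        then show ?thesis using joined_in[OF 2(2)] by (auto simp: up_def below_def)
      qed (use z in \<open>auto simp: up_def\<close>)
    qed
    show "up z \<subseteq> \<Union>\<S>"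
    proof
      fix v assume v: "v \<in> up z"
      show "v \<in> \<Union>\<S>"
      proof (cases "v = z")
        case False
        then have "v \<in> branch z v" using v joined_refl[of v z] by (simp add: up_def)
        then show ?thesis using v False unfolding \<S>_def by blast
      qed (auto simp: \<S>_def)
    qed
  qed
  ultimately show ?thesis by simp
qed

text \<open>The bridge between components and order. Given a common lower bound \<open>z\<close>
  strictly above \<open>m\<close>, the connected set \<open>up z\<close> misses \<open>m\<close>.
  Conversely, having such a bound is an equivalence relation on the branch, transitive by
  \<open>below_linear\<close>; its classes are open because \<open>z\<close> stays below all points
  of the branch at \<open>z\<close> that contains \<open>u\<close>.\<close>

lemma joined_above_iff:
  assumes X: "m \<in> X" "x \<in> X" "y \<in> X" and m: "m \<sqsubseteq> x" "m \<noteq> x" "m \<sqsubseteq> y" "m \<noteq> y"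
  shows "joined m x y \<longleftrightarrow> (\<exists>z\<in>X. m \<sqsubseteq> z \<and> m \<noteq> z \<and> z \<sqsubseteq> x \<and> z \<sqsubseteq> y)"
proof
  assume "\<exists>z\<in>X. m \<sqsubseteq> z \<and> m \<noteq> z \<and> z \<sqsubseteq> x \<and> z \<sqsubseteq> y"
  then obtain z where z: "z \<in> X" "m \<sqsubseteq> z" "m \<noteq> z" "z \<sqsubseteq> x" "z \<sqsubseteq> y" by blast
  have "m \<notin> up z" using below_antisym[of m z] X z by (auto simp: up_def)
  moreover have "up z \<subseteq> X" "x \<in> up z" "y \<in> up z" using z X by (auto simp: up_def)
  ultimately show "joined m x y" using joinedI[OF connected_up[OF z(1)]] by blast
next
  assume j: "joined m x y"
  define R where "R u v \<longleftrightarrow> (\<exists>z\<in>X. m \<sqsubseteq> z \<and> m \<noteq> z \<and> z \<sqsubseteq> u \<and> z \<sqsubseteq> v)" for u v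
  have br: "u \<in> X \<and> m \<sqsubseteq> u \<and> m \<noteq> u" if "u \<in> branch m x" for u
  proof -
    have u: "joined m x u" using that by simp
    then have "\<not> joined m a u" using m(1) unfolding below_def
      using joined_trans joined_sym by metis
    then show ?thesis using joined_in[OF u] by (auto simp: below_def)
  qed
  have "R x y"
  proof (rule connected_equivalence_relation[of "branch m x"])
    show "R u w" if uvw: "R u v" "R v w" "u \<in> branch m x" "v \<in> branch m x" "w \<in> branch m x" for u v w
    proof -
      obtain z1 where z1: "z1 \<in> X" "m \<sqsubseteq> z1" "m \<noteq> z1" "z1 \<sqsubseteq> u" "z1 \<sqsubseteq> v" using uvw unfolding R_def by blast
      obtain z2 where z2: "z2 \<in> X" "m \<sqsubseteq> z2" "m \<noteq> z2" "z2 \<sqsubseteq> v" "z2 \<sqsubseteq> w" using uvw unfolding R_def by blast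
      have uw: "u \<in> X" "v \<in> X" "w \<in> X" using uvw br by auto
      from below_linear[of z1 z2 v] z1 z2 uw consider "z1 \<sqsubseteq> z2" | "z2 \<sqsubseteq> z1" by blast
      then show ?thesis
      proof cases
        case 1
        then have "z1 \<sqsubseteq> w" using below_trans[of z1 z2 w] z1 z2 uw by blast
        then show ?thesis using z1 unfolding R_def by blast
      next
        case 2
        then have "z2 \<sqsubseteq> u" using below_trans[of z2 z1 u] z1 z2 uw by blast
        then show ?thesis using z2 unfolding R_def by blast
      qed
    qed
    show "\<exists>T. openin (top_of_set (branch m x)) T \<and> u \<in> T \<and> (\<forall>v\<in>T. R u v)" if u: "u \<in> branch m x" for u
    proof -
      obtain z where z: "z \<in> X" "m \<sqsubseteq> z" "m \<noteq> z" "z \<sqsubseteq> u" "z \<noteq> u"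
        using below_dense[of m u] br[OF u] X(1) by blast
      obtain V where V: "open V" "branch z u = X \<inter> V"
        using openin_branch[of z u] by (auto simp: openin_open)
      have uz: "u \<in> branch z u" using joined_refl[of u z] br[OF u] z by auto
      have "R u v" if "v \<in> branch m x \<inter> V" for v
      proof -
        have "joined z u v" using that V br[of v] by auto
        then have "z \<sqsubseteq> v" using z(4) unfolding below_def
          using joined_trans joined_sym by metis
        then show ?thesis using z unfolding R_def by blast
      qed
      then show ?thesis using u uz V by (intro exI[of _ "branch m x \<inter> V"]) (auto simp: openin_open_Int)
    qed
    show "connected (branch m x)" by (rule connected_connected_component)
    show "x \<in> branch m x" "y \<in> branch m x" using j joined_refl[of x m] m X by auto
    show "R v u" if "R u v" for u v using that unfolding R_def by blast
  qed
  then show "\<exists>z\<in>X. m \<sqsubseteq> z \<and> m \<noteq> z \<and> z \<sqsubseteq> x \<and> z \<sqsubseteq> y" by (simp add: R_def)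
qed

text \<open>Zorn's lemma, with chains bounded by compactness. It is used twice, to find an end point
  as the root and to find the attracting point.\<close>

lemma maximal_above:
  assumes x0: "x0 \<in> X"
  obtains e where "e \<in> X" "x0 \<sqsubseteq> e" "\<And>y. \<lbrakk>y \<in> X; e \<sqsubseteq> y\<rbrakk> \<Longrightarrow> y = e"
proof -
  have upX: "up x0 \<subseteq> X" "x0 \<in> up x0" using x0 by (auto simp: up_def)
  have "\<exists>m\<in>up x0. \<forall>y\<in>up x0. m \<sqsubseteq> y \<longrightarrow> y = m"
  proof (rule predicate_Zorn)
    show "partial_order_on (up x0) (relation_of (\<sqsubseteq>) (up x0))"
    proof (rule partial_order_on_relation_ofI)
      show "u \<sqsubseteq> u" for u by simp
      show "u \<sqsubseteq> w" if "u \<in> up x0" "v \<in> up x0" "w \<in> up x0" "u \<sqsubseteq> v" "v \<sqsubseteq> w" for u v w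
        using that below_trans[of u v w] upX by blast
      show "u = v" if "u \<in> up x0" "v \<in> up x0" "u \<sqsubseteq> v" "v \<sqsubseteq> u" for u v
        using that below_antisym[of u v] upX by blast
    qed
    fix C assume "C \<in> Chains (relation_of (\<sqsubseteq>) (up x0))"
    then have C: "C \<subseteq> up x0" "\<And>u v. \<lbrakk>u \<in> C; v \<in> C\<rbrakk> \<Longrightarrow> u \<sqsubseteq> v \<or> v \<sqsubseteq> u"
      unfolding Chains_def relation_of_def by blast+
    have "up x0 \<noteq> {}" using upX by blast
    then show "\<exists>u\<in>up x0. \<forall>c\<in>C. c \<sqsubseteq> u"
      using chain_upper_bound[OF compact_up upX(1) _ C] by metis
  qed
  then obtain e where e: "e \<in> up x0" and max: "\<forall>y\<in>up x0. e \<sqsubseteq> y \<longrightarrow> y = e" by blast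
  have eX: "e \<in> X" "x0 \<sqsubseteq> e" using e by (simp_all add: up_def)
  moreover have "y = e" if y: "y \<in> X" "e \<sqsubseteq> y" for y
  proof -
    have "y \<in> up x0" using below_trans[OF x0 eX(1) y(1) eX(2) y(2)] y(1) by (simp add: up_def)
    then show ?thesis using max y(2) by blast
  qed
  ultimately show ?thesis by (rule that)
qed

end

section \<open>Branch points\<close>

lemma dense_meets_openin:
  assumes "openin (top_of_set X) G" "G \<noteq> {}" "X \<subseteq> closure B" "B \<subseteq> X"
  shows "B \<inter> G \<noteq> {}"
proof -
  obtain V where V: "open V" "G = X \<inter> V" using assms(1) by (auto simp: openin_open)
  then have "V \<inter> closure B \<noteq> {}" using assms by auto
  then have "V \<inter> B \<noteq> {}" using open_Int_closure_eq_empty[OF V(1)] by blast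
  then show ?thesis using V assms(4) by blast
qed

lemma compact_countable_dense:
  fixes X :: "'a::metric_space set"
  assumes X: "compact X"
  obtains D where "countable D" "D \<subseteq> X" "X \<subseteq> closure D"
proof -
  have "\<exists>k. finite k \<and> k \<subseteq> X \<and> X \<subseteq> (\<Union>c\<in>k. ball c (inverse (Suc n)))" for n
  proof -
    have "X \<subseteq> (\<Union>c\<in>X. ball c (inverse (Suc n)))" by force
    from compactE_image[OF X _ this] show ?thesis by (metis open_ball)
  qed
  then obtain k where k: "\<And>n. finite (k n)" "\<And>n. k n \<subseteq> X" "\<And>n. X \<subseteq> (\<Union>c\<in>k n. ball c (inverse (Suc n)))"
    by metis
  show ?thesis
  proof (rule that[of "\<Union>n. k n"])
    show "countable (\<Union>n. k n)" using k(1) by (simp add: countable_finite)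
    show "X \<subseteq> closure (\<Union>n. k n)"
    proof
      fix x assume x: "x \<in> X"
      show "x \<in> closure (\<Union>n. k n)"
        unfolding closure_approachable
      proof (intro allI impI)
        fix e :: real assume "e > 0"
        then obtain n where n: "inverse (Suc n) < e" using reals_Archimedean by blast
        obtain c where "c \<in> k n" "dist c x < inverse (Suc n)" using k(3)[of n] x by auto
        then show "\<exists>y\<in>\<Union>n. k n. dist y x < e" using n by force
      qed
    qed
  qed (use k(2) in blast)
qed

lemma card_image_same_kernel:
  assumes "\<And>x y. \<lbrakk>x \<in> S; y \<in> S\<rbrakk> \<Longrightarrow> f x = f y \<longleftrightarrow> g x = g y"
  shows "card (f ` S) = card (g ` S)"
proof (rule bij_betw_same_card)
  have inv: "inv_into S f (f x) \<in> S" "f (inv_into S f (f x)) = f x" if "x \<in> S" for x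
    using that by (auto simp: inv_into_into f_inv_into_f)
  then have eq: "g (inv_into S f (f x)) = g x" if "x \<in> S" for x
    using assms[of "inv_into S f (f x)" x] that by blast
  show "bij_betw (g \<circ> inv_into S f) (f ` S) (g ` S)"
    unfolding bij_betw_def
  proof
    show "inj_on (g \<circ> inv_into S f) (f ` S)"
      using assms eq by (auto simp: inj_on_def)
    show "(g \<circ> inv_into S f) ` f ` S = g ` S"
      using eq by (auto simp: image_image)
  qed
qed

lemma point_order_ge_3_iff:
  "3 \<le> point_order X p \<longleftrightarrow> (\<exists>T\<subseteq>components (X - {p}). finite T \<and> card T = 3)"
proof
  assume "3 \<le> point_order X p"
  then have "infinite (components (X - {p})) \<or> 3 \<le> card (components (X - {p}))"
    by (auto simp: point_order_def split: if_splits)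
  then show "\<exists>T\<subseteq>components (X - {p}). finite T \<and> card T = 3"
    by (metis infinite_arbitrarily_large obtain_subset_with_card_n)
next
  assume "\<exists>T\<subseteq>components (X - {p}). finite T \<and> card T = 3"
  then show "3 \<le> point_order X p"
    unfolding point_order_def by (auto dest: card_mono)
qed

lemma point_order_eq_imp_card_eq:
  "point_order X p = point_order X q \<Longrightarrow> card (components (X - {p})) = card (components (X - {q}))"
  by (auto simp: point_order_def split: if_splits)

context tree_space
begin

lemma branch_eq_iff: "\<lbrakk>y \<in> X; y \<noteq> p\<rbrakk> \<Longrightarrow> branch p x = branch p y \<longleftrightarrow> joined p x y"
  using joined_refl[of y p] connected_component_eq[of y "X - {p}" x] by auto

lemma components_eq_branches: "components (X - {p}) = branch p ` (X - {p})"
  by (simp add: components_def)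

lemma branch_pointI:
  assumes p: "p \<in> X" and xyz: "x \<in> X - {p}" "y \<in> X - {p}" "z \<in> X - {p}"
    and "\<not> joined p x y" "\<not> joined p x z" "\<not> joined p y z"
  shows "p \<in> branch_points X"
proof -
  define T where "T = {branch p x, branch p y, branch p z}"
  have "branch p x \<noteq> branch p y" "branch p x \<noteq> branch p z" "branch p y \<noteq> branch p z"
    using assms branch_eq_iff by auto
  then have "card T = 3" by (simp add: T_def)
  moreover have "T \<subseteq> components (X - {p})" using xyz by (auto simp: T_def components_eq_branches)
  moreover have "finite T" by (simp add: T_def)
  ultimately show ?thesis using p unfolding branch_points_def point_order_ge_3_iff by blast
qed

lemma branch_pointE:
  assumes p: "p \<in> branch_points X"
  obtains x y z where "x \<in> X - {p}" "y \<in> X - {p}" "z \<in> X - {p}"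
    "\<not> joined p x y" "\<not> joined p x z" "\<not> joined p y z"
proof -
  obtain T where T: "T \<subseteq> components (X - {p})" "card T = 3"
    using p by (auto simp: branch_points_def point_order_ge_3_iff)
  obtain K L M where KLM: "T = {K, L, M}" "K \<noteq> L" "L \<noteq> M" "K \<noteq> M" using T(2) by (auto simp: card_3_iff)
  then obtain x y z where xyz: "x \<in> X - {p}" "y \<in> X - {p}" "z \<in> X - {p}"
    "K = branch p x" "L = branch p y" "M = branch p z"
    using T(1) by (auto simp: components_eq_branches)
  then show ?thesis using that[of x y z] KLM branch_eq_iff by auto
qed

text \<open>Suppose \<open>p\<close> and \<open>q\<close> differ. As \<open>q\<close> separates the
  three points pairwise, any two of them include one in the branch of \<open>q\<close> at
  \<open>p\<close>; so this branch contains at least two of them. As \<open>p\<close> separates them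
  too, it contains at most one.\<close>

lemma median_unique:
  assumes pq: "p \<in> X" "q \<in> X"
    and p: "x \<in> X - {p}" "y \<in> X - {p}" "z \<in> X - {p}" "\<not> joined p x y" "\<not> joined p x z" "\<not> joined p y z"
    and q: "x \<in> X - {q}" "y \<in> X - {q}" "z \<in> X - {q}" "\<not> joined q x y" "\<not> joined q x z" "\<not> joined q y z"
  shows "p = q"
proof (rule ccontr)
  assume ne: "p \<noteq> q"
  have two: "joined p q u \<or> joined p q v" if uv: "u \<in> X - {p}" "v \<in> X - {p}" "\<not> joined q u v" for u v
  proof (rule ccontr)
    assume "\<not> ?thesis"
    then have "joined q p u" "joined q p v" using not_joined_switch[OF pq] uv ne by auto
    then show False using uv(3) joined_sym joined_trans by blast
  qed
  have excl: "\<not> (joined p q u \<and> joined p q v)" if "\<not> joined p u v" for u v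
    using that joined_sym joined_trans by blast
  show False using two[of x y] two[of x z] two[of y z] excl[of x y] excl[of x z] excl[of y z] p q by blast
qed

text \<open>Choose three points of a countable dense set in different branches at \<open>p\<close>;
  by \<open>median_unique\<close> they determine \<open>p\<close>.\<close>

lemma countable_branch_points: "countable (branch_points X)"
proof -
  obtain D where D: "countable D" "D \<subseteq> X" "X \<subseteq> closure D" using compact_countable_dense[OF compact_X] .
  define sep where "sep p t \<longleftrightarrow> (\<exists>x y z. t = (x, y, z) \<and> x \<in> X - {p} \<and> y \<in> X - {p} \<and> z \<in> X - {p} \<and>
    \<not> joined p x y \<and> \<not> joined p x z \<and> \<not> joined p y z)" for p and t :: "'a \<times> 'a \<times> 'a"
  have "\<exists>t\<in>D \<times> D \<times> D. sep p t" if p: "p \<in> branch_points X" for p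
  proof -
    obtain x y z where xyz: "x \<in> X - {p}" "y \<in> X - {p}" "z \<in> X - {p}"
      "\<not> joined p x y" "\<not> joined p x z" "\<not> joined p y z" using branch_pointE[OF p] .
    have pick: "\<exists>d\<in>D. joined p u d" if u: "u \<in> X - {p}" for u
    proof -
      have "branch p u \<noteq> {}" using joined_refl[of u p] u by blast
      then have "D \<inter> branch p u \<noteq> {}" using dense_meets_openin[OF openin_branch] D by blast
      then show ?thesis by blast
    qed
    obtain d1 d2 d3 where d: "d1 \<in> D" "joined p x d1" "d2 \<in> D" "joined p y d2" "d3 \<in> D" "joined p z d3"
      using pick xyz(1-3) by metis
    have "\<not> joined p d1 d2" "\<not> joined p d1 d3" "\<not> joined p d2 d3"
      using xyz(4-6) d joined_sym joined_trans by metis+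
    then show ?thesis using d joined_in[OF d(2)] joined_in[OF d(4)] joined_in[OF d(6)]
      by (intro bexI[of _ "(d1, d2, d3)"]) (auto simp: sep_def)
  qed
  then obtain t where t: "\<And>p. p \<in> branch_points X \<Longrightarrow> t p \<in> D \<times> D \<times> D" "\<And>p. p \<in> branch_points X \<Longrightarrow> sep p (t p)"
    by metis
  have "inj_on t (branch_points X)"
  proof (rule inj_onI)
    fix p q assume pq: "p \<in> branch_points X" "q \<in> branch_points X" "t p = t q"
    obtain x y z where xyz: "t p = (x, y, z)" by (metis surj_pair)
    have "sep p (x, y, z)" "sep q (x, y, z)" using t(2)[OF pq(1)] t(2)[OF pq(2)] pq(3) xyz by simp_all
    then show "p = q" using median_unique[of p q x y z] pq by (auto simp: sep_def branch_points_def)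
  qed
  moreover have "countable (t ` branch_points X)"
  proof (rule countable_subset)
    show "t ` branch_points X \<subseteq> D \<times> D \<times> D" using t(1) by blast
  qed (use D(1) in auto)
  ultimately show ?thesis by (rule countable_image_inj_on[rotated])
qed

end

section \<open>Universal dendrites rooted at an end point\<close>

locale universal_tree_space = rooted_tree_space +
  fixes n :: enat
  assumes endpoint: "\<lbrakk>x \<in> X; y \<in> X; x \<noteq> a; y \<noteq> a\<rbrakk> \<Longrightarrow> joined a x y"
    and dense_branch_points: "X \<subseteq> closure (branch_points X)"
    and order_branch_points: "p \<in> branch_points X \<Longrightarrow> point_order X p = n"
begin

abbreviation "B \<equiv> branch_points X"

lemma B_subset: "B \<subseteq> X"
  by (auto simp: branch_points_def)

lemma B_in_X: "x \<in> B \<Longrightarrow> x \<in> X"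
  by (simp add: branch_points_def)

lemma root_notin_B: "a \<notin> B"
  by (metis DiffD1 DiffD2 branch_pointE endpoint singletonI)

lemma B_meets: "\<lbrakk>openin (top_of_set X) G; G \<noteq> {}\<rbrakk> \<Longrightarrow> B \<inter> G \<noteq> {}"
  using dense_meets_openin[OF _ _ dense_branch_points B_subset] .

lemma B_meets_branch:
  assumes "x \<in> X" "x \<noteq> p"
  obtains b where "b \<in> B" "joined p x b"
proof -
  have "branch p x \<noteq> {}" using joined_refl[OF assms] by blast
  then have "B \<inter> branch p x \<noteq> {}" by (rule B_meets[OF openin_branch])
  then show ?thesis using that by blast
qed

text \<open>The root, \<open>x\<close> and \<open>y\<close> lie in three different branches at
  \<open>m\<close>; that \<open>m\<close> is not the root follows from
  \<open>endpoint\<close>.\<close>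

lemma meet_in_B:
  assumes X: "m \<in> X" "x \<in> X" "y \<in> X" and m: "m \<sqsubseteq> x" "m \<sqsubseteq> y"
    and greatest: "\<And>z. \<lbrakk>z \<in> X; z \<sqsubseteq> x; z \<sqsubseteq> y\<rbrakk> \<Longrightarrow> z \<sqsubseteq> m"
    and inc: "\<not> x \<sqsubseteq> y" "\<not> y \<sqsubseteq> x"
  shows "m \<in> B"
proof -
  have ne: "m \<noteq> x" "m \<noteq> y" using m inc by auto
  have nj: "\<not> joined m x y"
  proof
    assume "joined m x y"
    then obtain z where z: "z \<in> X" "m \<sqsubseteq> z" "m \<noteq> z" "z \<sqsubseteq> x" "z \<sqsubseteq> y"
      using joined_above_iff X m ne by blast
    then show False using greatest[of z] below_antisym[of m z] X by blast
  qed
  have "m \<noteq> a" using nj endpoint[of x y] X ne by blast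
  show ?thesis
    by (rule branch_pointI[of m a x y]) (use X root ne \<open>m \<noteq> a\<close> m nj in \<open>auto simp: below_def\<close>)
qed

text \<open>Converts topological density into order density. The points on the \<open>y\<close>-side
  of \<open>x\<close> and on the \<open>x\<close>-side of \<open>y\<close> form a nonempty open set,
  so it contains a branch point \<open>b0\<close>. This may lie off the arc from \<open>x\<close> to
  \<open>y\<close>; then its meet with \<open>y\<close> lies on the arc and is itself a branch
  point.\<close>

lemma B_dense:
  assumes xy: "x \<in> X" "y \<in> X" "x \<sqsubseteq> y" "x \<noteq> y"
  obtains b where "b \<in> B" "x \<sqsubseteq> b" "x \<noteq> b" "b \<sqsubseteq> y" "b \<noteq> y"
proof -
  obtain u where u: "u \<in> X" "x \<sqsubseteq> u" "x \<noteq> u" "u \<sqsubseteq> y" "u \<noteq> y" using below_dense[OF xy] .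
  have "joined x y u" using joined_above_iff[of x y u] u xy by auto
  moreover have "joined y a u" using joined_root_above[of u y] u xy by blast
  moreover have "joined y a x" using joined_root_above[of x y] xy by blast
  ultimately have "u \<in> branch x y \<inter> branch y x" using joined_sym joined_trans by blast
  moreover have "openin (top_of_set X) (branch x y \<inter> branch y x)" by (intro openin_Int openin_branch)
  ultimately obtain b0 where b0: "b0 \<in> B" "joined x y b0" "joined y x b0" using B_meets by blast
  have b0X: "b0 \<in> X" using b0 B_subset by blast
  have "\<not> joined x a b0" using b0(2) xy(3) unfolding below_def using joined_sym joined_trans by blast
  then have xb0: "x \<sqsubseteq> b0" by (simp add: below_def)
  have nyb0: "\<not> y \<sqsubseteq> b0" using \<open>joined y a x\<close> b0(3) joined_trans unfolding below_def by blast
  obtain m where m: "m \<in> X" "m \<sqsubseteq> b0" "m \<sqsubseteq> y" "\<And>z. \<lbrakk>z \<in> X; z \<sqsubseteq> b0; z \<sqsubseteq> y\<rbrakk> \<Longrightarrow> z \<sqsubseteq> m"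
    using meet_exists[OF b0X xy(2)] by metis
  have "x \<noteq> b0" using joined_in[OF b0(2)] by blast
  then obtain z where z: "z \<in> X" "x \<sqsubseteq> z" "x \<noteq> z" "z \<sqsubseteq> y" "z \<sqsubseteq> b0"
    using joined_above_iff[of x y b0] xy b0(2) b0X xb0 by auto
  have zm: "z \<sqsubseteq> m" using m(4) z by blast
  have xm: "x \<sqsubseteq> m" using below_trans[of x z m] z m xy zm by blast
  have "x \<noteq> m" using below_antisym[of x z] z zm xy by blast
  moreover have "m \<noteq> y" using nyb0 m by blast
  moreover have "m \<in> B"
  proof (cases "b0 \<sqsubseteq> y")
    case True
    then have "m = b0" using m(4)[of b0] m(1,2) below_antisym[of m b0] b0X by auto
    then show ?thesis using b0 by simp
  next
    case False
    show ?thesis by (rule meet_in_B[of m b0 y]) (use m b0X xy False nyb0 in auto)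
  qed
  ultimately show ?thesis using that[of m] xm m by blast
qed

lemma cone_eq_branch:
  assumes x: "x \<in> B" and b: "b \<in> B" "x \<sqsubseteq> b" "x \<noteq> b"
  shows "upper_cone B (\<sqsubseteq>) x b = B \<inter> branch x b"
proof (intro equalityI subsetI)
  fix c assume "c \<in> upper_cone B (\<sqsubseteq>) x b"
  then obtain z where z: "c \<in> B" "z \<in> B" "x \<sqsubseteq> z" "x \<noteq> z" "z \<sqsubseteq> b" "z \<sqsubseteq> c" by (auto simp: upper_cone_def)
  have "x \<sqsubseteq> c" "x \<noteq> c"
    using below_trans[of x z c] below_antisym[of x z] z x B_in_X by blast+
  then have "joined x b c" using joined_above_iff[of x b c] z x b B_in_X by blast
  then show "c \<in> B \<inter> branch x b" using z by blast
next
  fix c assume "c \<in> B \<inter> branch x b"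
  then have c: "c \<in> B" "joined x b c" by auto
  then have "\<not> joined x a c" using b(2) unfolding below_def using joined_sym joined_trans by blast
  then have xc: "x \<sqsubseteq> c" "x \<noteq> c" using joined_in[OF c(2)] by (auto simp: below_def)
  then obtain z where z: "z \<in> X" "x \<sqsubseteq> z" "x \<noteq> z" "z \<sqsubseteq> b" "z \<sqsubseteq> c"
    using joined_above_iff[of x b c] c x b B_in_X by blast
  obtain z' where z': "z' \<in> B" "x \<sqsubseteq> z'" "x \<noteq> z'" "z' \<sqsubseteq> z" using B_dense[of x z] z x B_in_X by metis
  have "z' \<sqsubseteq> b" "z' \<sqsubseteq> c" using below_trans[of z' z] z z' b c B_in_X by blast+
  then show "c \<in> upper_cone B (\<sqsubseteq>) x b" using z' c by (auto simp: upper_cone_def)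
qed

text \<open>The branch of the root is the one component without a cone. If there are infinitely many
  components, both sides of the equation are 0.\<close>

lemma card_cones:
  assumes x: "x \<in> B"
  shows "card (upper_cones B (\<sqsubseteq>) x) = card (components (X - {x})) - 1" "upper_cones B (\<sqsubseteq>) x \<noteq> {}"
proof -
  have xX: "x \<in> X" "x \<noteq> a" using x B_in_X root_notin_B by auto
  define S where "S = {b \<in> B. x \<sqsubseteq> b \<and> x \<noteq> b}"
  have "upper_cone B (\<sqsubseteq>) x b = upper_cone B (\<sqsubseteq>) x c \<longleftrightarrow> branch x b = branch x c" if "b \<in> S" "c \<in> S" for b c
  proof -
    have "B \<inter> branch x b = B \<inter> branch x c \<Longrightarrow> branch x b = branch x c"
      using that joined_refl[of c x] branch_eq_iff[of c x b] B_in_X unfolding S_def by blast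
    then show ?thesis using that cone_eq_branch[OF x] by (auto simp: S_def)
  qed
  then have "card (upper_cones B (\<sqsubseteq>) x) = card (branch x ` S)"
    unfolding upper_cones_def S_def[symmetric] by (rule card_image_same_kernel)
  also have eq: "branch x ` S = components (X - {x}) - {branch x a}"
  proof (intro equalityI subsetI)
    fix K assume "K \<in> branch x ` S"
    then obtain b where b: "b \<in> B" "x \<sqsubseteq> b" "x \<noteq> b" "K = branch x b" by (auto simp: S_def)
    then have "branch x a \<noteq> K" using branch_eq_iff[of b x a] B_in_X by (auto simp: below_def)
    then show "K \<in> components (X - {x}) - {branch x a}"
      using b B_in_X by (auto simp: components_eq_branches)
  next
    fix K assume "K \<in> components (X - {x}) - {branch x a}"
    then obtain y where y: "y \<in> X" "y \<noteq> x" "K = branch x y" "K \<noteq> branch x a"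
      by (auto simp: components_eq_branches)
    obtain b where b: "b \<in> B" "joined x y b" using B_meets_branch y by metis
    have "branch x y = branch x b" using branch_eq_iff[of b x y] b joined_in[OF b(2)] by auto
    moreover from this have "\<not> joined x a b"
      using y branch_eq_iff[of b x a] joined_in[OF b(2)] by auto
    ultimately show "K \<in> branch x ` S" using b y joined_in[OF b(2)] by (auto simp: S_def below_def)
  qed
  also have "card \<dots> = card (components (X - {x})) - 1"
    using xX root by (intro card_Diff_singleton) (auto simp: components_eq_branches)
  finally show "card (upper_cones B (\<sqsubseteq>) x) = card (components (X - {x})) - 1" .
  obtain u v w where uvw: "u \<in> X - {x}" "v \<in> X - {x}" "\<not> joined x u v" using branch_pointE[OF x] by metis
  then have "branch x u \<noteq> branch x v" using branch_eq_iff[of v x u] by auto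
  moreover have "branch x u \<in> components (X - {x})" "branch x v \<in> components (X - {x})"
    using uvw by (auto simp: components_eq_branches)
  ultimately have "branch x ` S \<noteq> {}" unfolding eq by (metis Diff_iff empty_iff singletonD)
  then have "S \<noteq> {}" by blast
  then show "upper_cones B (\<sqsubseteq>) x \<noteq> {}" unfolding upper_cones_def S_def by blast
qed

sublocale meet_tree B "(\<sqsubseteq>)"
proof
  show "x \<sqsubseteq> x" for x by simp
  show "x = y" if "x \<in> B" "y \<in> B" "x \<sqsubseteq> y" "y \<sqsubseteq> x" for x y using below_antisym that B_in_X by blast
  show "x \<sqsubseteq> z" if "x \<in> B" "y \<in> B" "z \<in> B" "x \<sqsubseteq> y" "y \<sqsubseteq> z" for x y z
    using below_trans that B_in_X by blast
  show "x \<sqsubseteq> y \<or> y \<sqsubseteq> x" if "x \<in> B" "y \<in> B" "z \<in> B" "x \<sqsubseteq> z" "y \<sqsubseteq> z" for x y z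
    using below_linear that B_in_X by blast
  show "\<exists>m\<in>B. m \<sqsubseteq> x \<and> m \<sqsubseteq> y \<and> (\<forall>z\<in>B. z \<sqsubseteq> x \<longrightarrow> z \<sqsubseteq> y \<longrightarrow> z \<sqsubseteq> m)"
    if xy: "x \<in> B" "y \<in> B" for x y
  proof -
    have X: "x \<in> X" "y \<in> X" using xy B_in_X by auto
    consider "x \<sqsubseteq> y" | "y \<sqsubseteq> x" | "\<not> x \<sqsubseteq> y" "\<not> y \<sqsubseteq> x" by blast
    then show ?thesis
    proof cases
      case 1
      then show ?thesis using xy by (intro bexI[of _ x]) auto
    next
      case 2
      then show ?thesis using xy by (intro bexI[of _ y]) auto
    next
      case 3
      obtain m where m: "m \<in> X" "m \<sqsubseteq> x" "m \<sqsubseteq> y" "\<And>z. \<lbrakk>z \<in> X; z \<sqsubseteq> x; z \<sqsubseteq> y\<rbrakk> \<Longrightarrow> z \<sqsubseteq> m"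
        using meet_exists[OF X] by metis
      then have "m \<in> B" using meet_in_B X 3 by blast
      then show ?thesis using m B_in_X by blast
    qed
  qed
  show "\<exists>z\<in>B. x \<sqsubseteq> z \<and> x \<noteq> z \<and> z \<sqsubseteq> y \<and> z \<noteq> y" if "x \<in> B" "y \<in> B" "x \<sqsubseteq> y" "x \<noteq> y" for x y
    using B_dense[of x y] that B_in_X by metis
  show "\<exists>y\<in>B. y \<sqsubseteq> x \<and> y \<noteq> x" if "x \<in> B" for x
    using B_dense[of a x] that B_in_X root root_notin_B root_below by metis
  show "\<exists>y\<in>B. x \<sqsubseteq> y \<and> y \<noteq> x" if "x \<in> B" for x
    using card_cones(2)[OF that] by (auto simp: upper_cones_def)
  show "card (upper_cones B (\<sqsubseteq>) x) = card (upper_cones B (\<sqsubseteq>) y)" if "x \<in> B" "y \<in> B" for x y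
    using card_cones(1) that order_branch_points point_order_eq_imp_card_eq by metis
qed

end

section \<open>Shadowing for north-south dynamics\<close>

lemma nested_compact_shrink:
  fixes K :: "int \<Rightarrow> 'a::metric_space set"
  assumes K: "\<And>i. compact (K i)" and mono: "\<And>i j. i \<le> j \<Longrightarrow> K j \<subseteq> K i"
    and inter: "(\<Inter>i. K i) = {b}" and r: "r > 0"
  obtains N where "\<And>i. N \<le> i \<Longrightarrow> K i \<subseteq> ball b r"
proof -
  have "compact (K 0 - ball b r)" using K by (simp add: compact_diff)
  moreover have "K 0 - ball b r \<subseteq> (\<Union>i\<in>UNIV. - K i)"
  proof
    fix x assume "x \<in> K 0 - ball b r"
    then have "x \<noteq> b" using r by auto
    then show "x \<in> (\<Union>i\<in>UNIV. - K i)" using inter by blast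
  qed
  ultimately obtain I where I: "finite I" "K 0 - ball b r \<subseteq> (\<Union>i\<in>I. - K i)"
    using K by (metis compactE_image compact_imp_closed open_Compl)
  define N where "N = Max (insert 0 I)"
  have N: "i \<le> N" if "i \<in> insert 0 I" for i using that I by (simp add: N_def)
  have "K i \<subseteq> ball b r" if i: "N \<le> i" for i
  proof
    fix x assume x: "x \<in> K i"
    then have "x \<in> K j" if "j \<in> insert 0 I" for j using mono[of j i] N[OF that] i by auto
    then show "x \<in> ball b r" using I(2) by blast
  qed
  then show ?thesis using that by blast
qed

lemma compact_closed_gap:
  fixes S T :: "'a::metric_space set"
  assumes "compact S" "closed T" "S \<inter> T = {}"
  shows "\<exists>d>0. \<forall>x\<in>S. \<forall>y\<in>T. d \<le> dist x y"
proof (cases "S = {} \<or> T = {}")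
  case False
  have "continuous_on S (\<lambda>x. infdist x T)" by (intro continuous_intros)
  then obtain x0 where x0: "x0 \<in> S" "\<And>x. x \<in> S \<Longrightarrow> infdist x0 T \<le> infdist x T"
    using continuous_attains_inf[of S "\<lambda>x. infdist x T"] assms False by blast
  have "infdist x0 T > 0" using assms False x0 by (intro infdist_pos_not_in_closed) auto
  moreover have "infdist x0 T \<le> dist x y" if "x \<in> S" "y \<in> T" for x y
    using x0(2)[OF that(1)] infdist_le[OF that(2), of x] by linarith
  ultimately show ?thesis by blast
qed (auto intro: exI[of _ 1])

section \<open>Integer iterates, pseudo-orbits and shadowing\<close>

lemma int_iterate_0 [simp]: "int_iterate X g 0 x = x"
  by (simp add: int_iterate_def)

lemma int_iterate_in:
  assumes "bij_betw g X X" "x \<in> X"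
  shows "int_iterate X g k x \<in> X"
proof -
  have "(g ^^ m) x \<in> X" "(inv_into X g ^^ m) x \<in> X" for m
    using assms by (induction m) (auto simp: bij_betw_def inv_into_into)
  then show ?thesis by (simp add: int_iterate_def)
qed

lemma int_iterate_add1:
  assumes g: "bij_betw g X X" and x: "x \<in> X"
  shows "int_iterate X g (k + 1) x = g (int_iterate X g k x)"
proof (cases "0 \<le> k")
  case True
  then have "nat (k + 1) = Suc (nat k)" by auto
  then show ?thesis using True by (simp add: int_iterate_def)
next
  case False
  define m where "m = nat (- (k + 1))"
  have m: "nat (- k) = Suc m" using False by (auto simp: m_def)
  have "int_iterate X g (k + 1) x = (inv_into X g ^^ m) x"
    using False by (auto simp: int_iterate_def m_def)
  moreover have "(inv_into X g ^^ m) x \<in> X"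
    using g x by (induction m) (auto simp: bij_betw_def inv_into_into)
  ultimately show ?thesis
    using g False m by (simp add: int_iterate_def bij_betw_def f_inv_into_f)
qed

lemma int_iterate_surj:
  assumes g: "bij_betw g X X"
  shows "z \<in> X \<Longrightarrow> \<exists>y\<in>X. int_iterate X g k y = z"
proof (induction k arbitrary: z rule: int_induct[where k = 0])
  case (step1 i)
  have "z \<in> g ` X" using g step1.prems by (simp add: bij_betw_def)
  then obtain w where w: "w \<in> X" "g w = z" by blast
  then obtain y where "y \<in> X" "int_iterate X g i y = w" using step1.IH by blast
  then show ?case using int_iterate_add1[OF g] w by auto
next
  case (step2 i)
  have "g z \<in> X" using g step2.prems by (auto simp: bij_betw_def)
  then obtain y where y: "y \<in> X" "int_iterate X g i y = g z" using step2.IH by blast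
  then have "g (int_iterate X g (i - 1) y) = g z" using int_iterate_add1[OF g, of y "i - 1"] by simp
  then show ?case using g y step2.prems int_iterate_in[OF g] by (metis bij_betw_def inj_onD)
qed auto

text \<open>Induction on \<open>M\<close> with uniform continuity. The number of steps has to be
  fixed before \<open>\<delta>\<close>, hence the importance of a bounded passage time.\<close>

lemma pseudo_orbit_finite_time:
  fixes X :: "'a::metric_space set"
  assumes cont: "uniformly_continuous_on X g" and gX: "g ` X \<subseteq> X" and "\<eta> > 0"
  obtains \<delta> where "\<delta> > 0" "\<And>x :: int \<Rightarrow> 'a. \<lbrakk>\<And>k. x k \<in> X; \<And>k. dist (g (x k)) (x (k + 1)) < \<delta>\<rbrakk>
    \<Longrightarrow> \<forall>k. \<forall>j\<le>M. dist ((g ^^ j) (x k)) (x (k + int j)) < \<eta>"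
proof -
  have iter: "(g ^^ j) x \<in> X" if "x \<in> X" for j x
    using that gX by (induction j) auto
  have "\<exists>\<delta>>0. \<forall>x :: int \<Rightarrow> 'a. (\<forall>k. x k \<in> X) \<longrightarrow> (\<forall>k. dist (g (x k)) (x (k + 1)) < \<delta>)
    \<longrightarrow> (\<forall>k. \<forall>j\<le>M. dist ((g ^^ j) (x k)) (x (k + int j)) < \<eta>)"
    using \<open>\<eta> > 0\<close>
  proof (induction M arbitrary: \<eta>)
    case 0
    then show ?case by (intro exI[of _ 1]) auto
  next
    case (Suc M)
    obtain \<eta>' where \<eta>': "\<eta>' > 0" "\<And>u v. \<lbrakk>u \<in> X; v \<in> X; dist u v < \<eta>'\<rbrakk> \<Longrightarrow> dist (g u) (g v) < \<eta> / 2"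
      using cont Suc.prems unfolding uniformly_continuous_on_def
      by (metis dist_commute half_gt_zero)
    obtain \<delta> where \<delta>: "\<delta> > 0" "\<forall>x :: int \<Rightarrow> 'a. (\<forall>k. x k \<in> X) \<longrightarrow> (\<forall>k. dist (g (x k)) (x (k + 1)) < \<delta>)
        \<longrightarrow> (\<forall>k. \<forall>j\<le>M. dist ((g ^^ j) (x k)) (x (k + int j)) < min \<eta> \<eta>')"
      using Suc.IH[of "min \<eta> \<eta>'"] \<eta>' Suc.prems by auto
    show ?case
    proof (intro exI[of _ "min \<delta> (\<eta> / 2)"] conjI allI impI)
      fix x :: "int \<Rightarrow> 'a" and k j
      assume x: "\<forall>k. x k \<in> X" "\<forall>k. dist (g (x k)) (x (k + 1)) < min \<delta> (\<eta> / 2)" and j: "j \<le> Suc M"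
      have IH: "dist ((g ^^ i) (x k)) (x (k + int i)) < min \<eta> \<eta>'" if "i \<le> M" for i
        using \<delta>(2)[rule_format, of x i k] x that by auto
      show "dist ((g ^^ j) (x k)) (x (k + int j)) < \<eta>"
      proof (cases "j \<le> M")
        case False
        then have j: "j = Suc M" using j by simp
        have "dist (g ((g ^^ M) (x k))) (g (x (k + int M))) < \<eta> / 2"
          using IH[of M] x iter by (intro \<eta>') auto
        moreover have "dist (g (x (k + int M))) (x (k + int M + 1)) < \<eta> / 2" using x(2) by auto
        ultimately have "dist (g ((g ^^ M) (x k))) (x (k + int M + 1)) < \<eta>"
          using dist_triangle_half_l[of _ "g (x (k + int M))"] by (metis dist_commute)
        then show ?thesis by (simp add: j ac_simps)
      qed (use IH in auto)
    qed (use \<delta> Suc.prems in auto)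
  qed
  then show ?thesis using that by blast
qed

text \<open>\<open>K i\<close> shrinks to \<open>b\<close> as \<open>i\<close> grows,
  \<open>L i\<close> to \<open>a\<close> as \<open>i\<close> decreases. A pseudo-orbit outside
  \<open>L (- N)\<close> never returns there and is in \<open>K N\<close> after \<open>M\<close>
  steps. It is shadowed by \<open>a\<close> if it stays in \<open>L (- N)\<close>, by
  \<open>b\<close> if it is never there, and otherwise by the true orbit through its last point
  \<open>x k0\<close> in \<open>L (- N)\<close>: until \<open>k0\<close> both lie in the small set
  \<open>L (- N)\<close>, for \<open>Suc M\<close> further steps continuity keeps them close, and
  then both lie in the small set \<open>K N\<close>.\<close>

theorem north_south_shadowing:
  fixes X :: "'a::metric_space set" and K L :: "int \<Rightarrow> 'a set"
  assumes X: "compact X" and hom: "homeomorphism X X g h"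
    and fixed: "g a = a" "g b = b"
    and compact: "\<And>i. compact (K i)" "\<And>i. compact (L i)"
    and cover: "\<And>i. K i \<union> L i = X" and disjoint: "\<And>i. K (i + 1) \<inter> L i = {}"
    and move: "\<And>i x. x \<in> K i \<Longrightarrow> g x \<in> K (i + 1)"
    and inter: "(\<Inter>i. K i) = {b}" "(\<Inter>i. L i) = {a}"
  shows "shadowing_property X g"
proof -
  have g: "bij_betw g X X"
    using hom by (intro bij_betwI[of g X X h]) (auto simp: homeomorphism_def)
  have gX: "g ` X \<subseteq> X" using g by (auto simp: bij_betw_def)
  have ucont: "uniformly_continuous_on X g"
    using hom X by (intro compact_uniformly_continuous) (auto simp: homeomorphism_def)
  have sub: "K i \<subseteq> X" "L i \<subseteq> X" for i using cover by auto
  have Kmono: "K j \<subseteq> K i" if "i \<le> j" for i j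
    using that
  proof (induction rule: int_ge_induct)
    case (step j)
    then show ?case using cover[of j] sub(1)[of "j + 1"] disjoint[of j] by blast
  qed auto
  have Lmono: "L i \<subseteq> L j" if "i \<le> j" for i j
    using that
  proof (induction rule: int_ge_induct)
    case (step j)
    then show ?case using cover[of "j + 1"] sub(2)[of j] disjoint[of j] by blast
  qed auto
  have pull_back: "x \<in> L i" if "x \<in> X" "g x \<in> L i" for x i
    using move[of x i] disjoint[of i] cover[of i] that by blast
  have abKL: "b \<in> K i" "a \<in> L i" for i
  proof -
    have "b \<in> (\<Inter>i. K i)" "a \<in> (\<Inter>i. L i)" using inter by simp_all
    then show "b \<in> K i" "a \<in> L i" by blast+
  qed
  then have ab: "a \<in> X" "b \<in> X" using sub by blast+
  show ?thesis
    unfolding shadowing_property_def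
  proof (intro allI impI)
    fix \<epsilon> :: real assume \<epsilon>: "\<epsilon> > 0"
    obtain N1 where N1: "\<And>i. N1 \<le> i \<Longrightarrow> K i \<subseteq> ball b (\<epsilon> / 2)"
      using nested_compact_shrink[OF compact(1) Kmono inter(1), of "\<epsilon> / 2"] \<epsilon> by auto
    have "(\<Inter>i. L (- i)) = (\<Inter>i. L i)"
    proof (intro equalityI subsetI INT_I)
      fix x i assume "x \<in> (\<Inter>i. L (- i))"
      then have "x \<in> L (- (- i))" by blast
      then show "x \<in> L i" by simp
    qed blast
    then have Linter: "(\<Inter>i. L (- i)) = {a}" using inter(2) by simp
    obtain N2 where N2: "\<And>i. N2 \<le> i \<Longrightarrow> L (- i) \<subseteq> ball a (\<epsilon> / 2)"
      using nested_compact_shrink[of "\<lambda>i. L (- i)", OF compact(2) Lmono Linter, of "\<epsilon> / 2"] \<epsilon> by auto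
    define n where "n = nat (max N1 N2)"
    define N where "N = int n"
    have N12: "N1 \<le> N" "N2 \<le> N" unfolding N_def n_def by auto
    have near_b: "dist x y < \<epsilon>" if "x \<in> K N" "y \<in> K N" for x y
    proof -
      have "x \<in> ball b (\<epsilon> / 2)" "y \<in> ball b (\<epsilon> / 2)" using N1[OF N12(1)] that by auto
      then show ?thesis using dist_triangle_half_r[of b x \<epsilon> y] by auto
    qed
    have near_a: "dist x y < \<epsilon>" if "x \<in> L (- N)" "y \<in> L (- N)" for x y
    proof -
      have "x \<in> ball a (\<epsilon> / 2)" "y \<in> ball a (\<epsilon> / 2)" using N2[OF N12(2)] that by auto
      then show ?thesis using dist_triangle_half_r[of a x \<epsilon> y] by auto
    qed
    have gap: "\<exists>d>0. \<forall>x\<in>K (i + 1). \<forall>y\<in>L i. d \<le> dist x y" for i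
      by (intro compact_closed_gap compact compact_imp_closed disjoint)
    obtain \<gamma>1 where \<gamma>1: "\<gamma>1 > 0" "\<And>x y. \<lbrakk>x \<in> K (N + 1); y \<in> L N\<rbrakk> \<Longrightarrow> \<gamma>1 \<le> dist x y" using gap by blast
    obtain \<gamma>2 where \<gamma>2: "\<gamma>2 > 0" "\<And>x y. \<lbrakk>x \<in> K (- N + 1); y \<in> L (- N)\<rbrakk> \<Longrightarrow> \<gamma>2 \<le> dist x y" using gap by blast
    \<comment> \<open>\<open>\<gamma>2\<close> prevents a return to \<open>L (- N)\<close>.
      \<open>\<gamma>1\<close> forces arrival in \<open>K N\<close>, and is halved because two
      errors add up when \<open>z\<close> is compared with the orbit of \<open>x (k0 + 1)\<close>.
      \<open>\<epsilon>\<close> is for the passage itself.\<close>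
    define \<eta> where "\<eta> = min \<epsilon> (min (\<gamma>1 / 2) \<gamma>2)"
    \<comment> \<open>The way from \<open>K (- N)\<close> to \<open>K (N + 1)\<close> takes
      \<open>2 * N + 1\<close> steps.\<close>
    define M where "M = 2 * n + 1"
    have "\<eta> > 0" using \<epsilon> \<gamma>1 \<gamma>2 by (auto simp: \<eta>_def)
    obtain \<delta> where \<delta>: "\<delta> > 0" "\<And>x :: int \<Rightarrow> 'a. \<lbrakk>\<And>k. x k \<in> X; \<And>k. dist (g (x k)) (x (k + 1)) < \<delta>\<rbrakk>
        \<Longrightarrow> \<forall>k. \<forall>j\<le>Suc M. dist ((g ^^ j) (x k)) (x (k + int j)) < \<eta>"
      using pseudo_orbit_finite_time[OF ucont gX \<open>\<eta> > 0\<close>] by metis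
    have iterK: "(g ^^ j) x \<in> K (i + int j)" if "x \<in> K i" for i j x
    proof (induction j)
      case (Suc j)
      then show ?case using move[OF Suc] by (simp add: ac_simps)
    qed (use that in auto)
    show "\<exists>\<delta>>0. \<forall>x. (\<forall>k. x k \<in> X) \<and> (\<forall>k. dist (g (x k)) (x (k + 1)) < \<delta>) \<longrightarrow>
            (\<exists>y\<in>X. \<forall>k. dist (int_iterate X g k y) (x k) < \<epsilon>)"
    proof (intro exI[of _ \<delta>] conjI allI impI \<delta>(1))
      fix x :: "int \<Rightarrow> 'a"
      assume "(\<forall>k. x k \<in> X) \<and> (\<forall>k. dist (g (x k)) (x (k + 1)) < \<delta>)"
      then have xX: "x k \<in> X" and follow: "j \<le> Suc M \<Longrightarrow> dist ((g ^^ j) (x k)) (x (k + int j)) < \<eta>" for k j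
        using \<delta>(2)[of x] by blast+
      have leave: "x (k + 1) \<notin> L (- N)" if "x k \<notin> L (- N)" for k
      proof
        assume "x (k + 1) \<in> L (- N)"
        moreover have "g (x k) \<in> K (- N + 1)" using move[of "x k" "- N"] that cover[of "- N"] xX[of k] by blast
        ultimately show False using \<gamma>2(2) follow[of 1 k] by (force simp: \<eta>_def)
      qed
      have arrive: "x (k + int M) \<in> K N \<and> (g ^^ M) (x k) \<in> K (N + 1)" if "x k \<notin> L (- N)" for k
      proof -
        have "x k \<in> K (- N)" using that cover[of "- N"] xX[of k] by blast
        then have *: "(g ^^ M) (x k) \<in> K (N + 1)" using iterK[of "x k" "- N" M] by (simp add: M_def N_def)
        then have "x (k + int M) \<notin> L N" using \<gamma>1(2) follow[of M k] \<gamma>1(1) by (force simp: \<eta>_def)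
        then show ?thesis using * cover[of N] xX[of "k + int M"] by blast
      qed
      have stay: "x k \<in> L (- N)" if "k \<le> l" "x l \<in> L (- N)" for k l
      proof (rule ccontr)
        assume k: "x k \<notin> L (- N)"
        have "x l \<notin> L (- N)"
          using \<open>k \<le> l\<close> by (induction rule: int_ge_induct) (use k leave in auto)
        then show False using that by simp
      qed
      consider "\<And>k. x k \<in> L (- N)" | "\<And>k. x k \<notin> L (- N)"
        | k0 where "x k0 \<in> L (- N)" "x (k0 + 1) \<notin> L (- N)"
      proof -
        have "(\<forall>k. x k \<in> L (- N)) \<or> (\<forall>k. x k \<notin> L (- N)) \<or> (\<exists>k0. x k0 \<in> L (- N) \<and> x (k0 + 1) \<notin> L (- N))"
        proof (rule ccontr)
          assume "\<not> ?thesis"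
          then obtain k l where kl: "x k \<notin> L (- N)" "x l \<in> L (- N)"
            and no: "\<And>k0. x k0 \<in> L (- N) \<Longrightarrow> x (k0 + 1) \<in> L (- N)" by blast
          have "x (max k l) \<in> L (- N)"
            using max.cobounded2[of l k] by (induction rule: int_ge_induct) (use kl no in auto)
          then show False using stay[of k "max k l"] kl by simp
        qed
        then show ?thesis using that by blast
      qed
      then show "\<exists>y\<in>X. \<forall>k. dist (int_iterate X g k y) (x k) < \<epsilon>"
      proof cases
        case 1
        have "int_iterate X g k a = a" for k
        proof (induction k rule: int_induct[where k = 0])
          case (step2 i)
          then have "g (int_iterate X g (i - 1) a) = g a"
            using int_iterate_add1[OF g ab(1), of "i - 1"] fixed by simp
          then show ?case using g ab int_iterate_in[OF g] by (metis bij_betw_def inj_onD)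
        qed (use int_iterate_add1[OF g ab(1)] fixed in auto)
        moreover have "a \<in> L (- N)" by (rule abKL)
        ultimately show ?thesis using near_a 1 ab by metis
      next
        case 2
        have "int_iterate X g k b = b" for k
        proof (induction k rule: int_induct[where k = 0])
          case (step2 i)
          then have "g (int_iterate X g (i - 1) b) = g b"
            using int_iterate_add1[OF g ab(2), of "i - 1"] fixed by simp
          then show ?case using g ab int_iterate_in[OF g] by (metis bij_betw_def inj_onD)
        qed (use int_iterate_add1[OF g ab(2)] fixed in auto)
        moreover have "b \<in> K N" by (rule abKL)
        \<comment> \<open>\<open>M\<close> steps before time \<open>k\<close> the pseudo-orbit was
          already outside \<open>L (- N)\<close>.\<close>
        moreover have "x k \<in> K N" for k using arrive[of "k - int M"] 2 by simp
        ultimately show ?thesis using near_b ab by metis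
      next
        case (3 k0)
        obtain y where y: "y \<in> X" "int_iterate X g k0 y = x k0" using int_iterate_surj[OF g xX] by blast
        define z where "z k = int_iterate X g k y" for k
        have zX: "z k \<in> X" and zS: "z (k + 1) = g (z k)" for k
          using int_iterate_in[OF g y(1)] int_iterate_add1[OF g y(1)] by (auto simp: z_def)
        have zk0: "z (k0 + int j) = (g ^^ j) (x k0)" for j
        proof (induction j)
          case (Suc j)
          then show ?case using zS[of "k0 + int j"] by (simp add: ac_simps)
        qed (use y z_def in auto)
        have out: "x (k0 + 1 + int j) \<notin> L (- N)" for j
        proof (induction j)
          case (Suc j)
          then show ?case using leave[of "k0 + 1 + int j"] by (simp add: ac_simps)
        qed (use 3 in simp)
        have zL: "z k \<in> L (- N)" if "k \<le> k0" for k
          using that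
        proof (induction rule: int_le_induct)
          case base
          then show ?case using zk0[of 0] 3 by simp
        next
          case (step k)
          then show ?case using pull_back[of "z (k - 1)"] zX zS[of "k - 1"] by simp
        qed
        have zK: "z (k0 + int (Suc M) + int j) \<in> K N" for j
        proof (induction j)
          case 0
          \<comment> \<open>Only \<open>x (k0 + 1)\<close> is known to be outside
            \<open>L (- N)\<close>, so arrival is known for its orbit. That orbit and
            \<open>z\<close> are both near \<open>x (k0 + int (Suc M))\<close>, and the gap between
            \<open>K (N + 1)\<close> and \<open>L N\<close> transfers the arrival to
            \<open>z\<close>.\<close>
          have *: "(g ^^ M) (x (k0 + 1)) \<in> K (N + 1)" using arrive[of "k0 + 1"] 3 by blast
          have "dist ((g ^^ M) (x (k0 + 1))) (x (k0 + int (Suc M))) < \<gamma>1 / 2"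
            using follow[of M "k0 + 1"] by (simp add: \<eta>_def ac_simps)
          moreover have "dist (z (k0 + int (Suc M))) (x (k0 + int (Suc M))) < \<gamma>1 / 2"
            using follow[of "Suc M" k0] unfolding zk0 by (simp add: \<eta>_def)
          ultimately have "dist ((g ^^ M) (x (k0 + 1))) (z (k0 + int (Suc M))) < \<gamma>1"
            by (rule dist_triangle_half_l)
          then have "z (k0 + int (Suc M)) \<notin> L N" using \<gamma>1(2)[OF *] by force
          then show ?case using cover[of N] zX[of "k0 + int (Suc M)"] by auto
        next
          case (Suc j)
          then have "z (k0 + int (Suc M) + int j + 1) \<in> K (N + 1)" using zS move by metis
          then show ?case using Kmono[of N "N + 1"] by (auto simp: algebra_simps)
        qed
        have "dist (z k) (x k) < \<epsilon>" for k
        proof -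
          consider "k \<le> k0" | j where "j \<le> Suc M" "k = k0 + int j"
            | j where "k = k0 + int (Suc M) + int j"
          proof -
            have "k \<le> k0 \<or> (nat (k - k0) \<le> Suc M \<and> k = k0 + int (nat (k - k0)))
                \<or> k = k0 + int (Suc M) + int (nat (k - k0 - int (Suc M)))" by auto
            then show ?thesis using that by blast
          qed
          then show ?thesis
          proof cases
            case 1
            then show ?thesis using near_a zL stay[of k k0] 3 by blast
          next
            case (2 j)
            then show ?thesis using follow[of j k0] zk0[of j] by (simp add: \<eta>_def)
          next
            case (3 j)
            have "x k \<in> K N" using arrive[OF out[of j]] unfolding 3 by (simp add: algebra_simps)
            then show ?thesis using near_b zK[of j] 3 by blast
          qed
        qed
        then show ?thesis using y by (auto simp: z_def)
      qed
    qed
  qed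
qed

section \<open>The arc\<close>

lemma arc_shadowing_homeomorphism:
  fixes X :: "'a::metric_space set"
  assumes "X homeomorphic {0..1::real}"
  shows "\<exists>g h. homeomorphism X X g h \<and> shadowing_property X g"
proof -
  obtain \<phi> \<psi> where hom: "homeomorphism X {0..1::real} \<phi> \<psi>" using assms by (auto simp: homeomorphic_def)
  have \<phi>: "continuous_on X \<phi>" "\<And>x. x \<in> X \<Longrightarrow> 0 \<le> \<phi> x \<and> \<phi> x \<le> 1" "\<And>x. x \<in> X \<Longrightarrow> \<psi> (\<phi> x) = x"
    and \<psi>: "continuous_on {0..1} \<psi>" "\<And>y. 0 \<le> y \<Longrightarrow> y \<le> 1 \<Longrightarrow> \<psi> y \<in> X \<and> \<phi> (\<psi> y) = y"
    using hom by (force simp: homeomorphism_def)+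
  have "compact X" using assms homeomorphic_compactness by (metis compact_Icc)
  define g where "g = (\<lambda>x. \<psi> ((\<phi> x)\<^sup>2))"
  define h where "h = (\<lambda>x. \<psi> (sqrt (\<phi> x)))"
  have sq: "0 \<le> y\<^sup>2 \<and> y\<^sup>2 \<le> 1" if "0 \<le> y \<and> y \<le> 1" for y :: real
    using that by (simp add: power_le_one)
  have homgh: "homeomorphism X X g h"
  proof (rule homeomorphismI)
    show "continuous_on X g" unfolding g_def
      by (rule continuous_on_compose2[OF \<psi>(1)]) (use \<phi> sq in \<open>auto intro!: continuous_intros\<close>)
    show "continuous_on X h" unfolding h_def
      by (rule continuous_on_compose2[OF \<psi>(1)]) (use \<phi> in \<open>auto intro!: continuous_intros\<close>)
  qed (use \<phi> \<psi> sq in \<open>auto simp: g_def h_def\<close>)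
  \<comment> \<open>The two-sided orbit of 1/2 under squaring, decreasing from 1 to 0. Its points
    are the levels; the attracting point is \<open>\<psi> 0\<close> and the repelling one
    \<open>\<psi> 1\<close>.\<close>
  define t :: "int \<Rightarrow> real" where "t i = (1/2) powr (2 powr i)" for i
  have t_sq: "t (i + 1) = (t i)\<^sup>2" for i
    by (simp add: t_def powr_add powr_powr[symmetric] powr_numeral)
  have t01: "0 < t i \<and> t i < 1" for i
    using powr_less_mono2[of "2 powr i" "1/2" 1] by (simp add: t_def)
  have t_dec: "t (i + 1) < t i" for i
    using t01[of i] by (simp add: t_sq power2_eq_square)
  have lim0: "(\<lambda>k. t (int k)) \<longlonglongrightarrow> 0" and lim1: "(\<lambda>k. t (- int k)) \<longlonglongrightarrow> 1"
    unfolding t_def by (simp_all, real_asymp+)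
  have \<phi>g: "\<phi> (g x) = (\<phi> x)\<^sup>2" if "x \<in> X" for x using \<phi> \<psi> sq that by (simp add: g_def)
  have preimage: "compact {x \<in> X. \<phi> x \<in> S}" if "closed S" for S
  proof -
    have "closed (X \<inter> \<phi> -` S)"
      using \<phi>(1) compact_imp_closed[OF \<open>compact X\<close>] that by (rule continuous_closed_preimage)
    then have "compact (X \<inter> (X \<inter> \<phi> -` S))" using \<open>compact X\<close> by (rule compact_Int_closed[rotated])
    moreover have "X \<inter> (X \<inter> \<phi> -` S) = {x \<in> X. \<phi> x \<in> S}" by auto
    ultimately show ?thesis by simp
  qed
  have "shadowing_property X g"
  proof (rule north_south_shadowing[OF \<open>compact X\<close> homgh])
    show "g (\<psi> 1) = \<psi> 1" "g (\<psi> 0) = \<psi> 0" using \<psi> by (auto simp: g_def)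
    show "compact {x \<in> X. \<phi> x \<in> {..t i}}" "compact {x \<in> X. \<phi> x \<in> {t i..}}" for i
      by (intro preimage closed_atMost closed_atLeast)+
    show "{x \<in> X. \<phi> x \<in> {..t i}} \<union> {x \<in> X. \<phi> x \<in> {t i..}} = X" for i by auto
    show "{x \<in> X. \<phi> x \<in> {..t (i + 1)}} \<inter> {x \<in> X. \<phi> x \<in> {t i..}} = {}" for i
      using t_dec[of i] by auto
    show "g x \<in> {x \<in> X. \<phi> x \<in> {..t (i + 1)}}" if "x \<in> {x \<in> X. \<phi> x \<in> {..t i}}" for i x
      using that \<phi> \<psi> sq \<phi>g t_sq by (auto simp: g_def power_mono)
    show "(\<Inter>i. {x \<in> X. \<phi> x \<in> {..t i}}) = {\<psi> 0}"
    proof (intro equalityI subsetI)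
      fix x assume "x \<in> (\<Inter>i. {x \<in> X. \<phi> x \<in> {..t i}})"
      then have x: "x \<in> X" "\<And>i. \<phi> x \<le> t i" by auto
      have "\<phi> x \<le> 0" by (rule LIMSEQ_le_const[OF lim0]) (use x in auto)
      then have "\<phi> x = 0" using \<phi>(2)[OF x(1)] by simp
      then show "x \<in> {\<psi> 0}" using \<phi>(3)[OF x(1)] by simp
    qed (use \<psi> t01 in \<open>auto simp: less_imp_le\<close>)
    show "(\<Inter>i. {x \<in> X. \<phi> x \<in> {t i..}}) = {\<psi> 1}"
    proof (intro equalityI subsetI)
      fix x assume "x \<in> (\<Inter>i. {x \<in> X. \<phi> x \<in> {t i..}})"
      then have x: "x \<in> X" "\<And>i. t i \<le> \<phi> x" by auto
      have "1 \<le> \<phi> x" by (rule LIMSEQ_le_const2[OF lim1]) (use x in auto)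
      then have "\<phi> x = 1" using \<phi>(2)[OF x(1)] by simp
      then show "x \<in> {\<psi> 1}" using \<phi>(3)[OF x(1)] by simp
    qed (use \<psi> t01 in \<open>auto simp: less_imp_le\<close>)
  qed
  then show ?thesis using homgh by blast
qed

section \<open>Extending automorphisms of the branch points\<close>

context universal_tree_space
begin

text \<open>The right-hand side mentions only the order on the branch points, so every automorphism
  preserves it: \<open>c\<close> and \<open>d\<close> both lie on the root's side of
  \<open>p\<close>, or in a common cone above \<open>p\<close>.\<close>

lemma joined_B_iff:
  assumes "p \<in> B" "c \<in> B" "d \<in> B" "p \<noteq> c" "p \<noteq> d"
  shows "joined p c d \<longleftrightarrow> (\<not> p \<sqsubseteq> c \<and> \<not> p \<sqsubseteq> d) \<or>
    (p \<sqsubseteq> c \<and> p \<sqsubseteq> d \<and> (\<exists>z\<in>B. p \<sqsubseteq> z \<and> p \<noteq> z \<and> z \<sqsubseteq> c \<and> z \<sqsubseteq> d))"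
proof (cases "p \<sqsubseteq> c")
  case True
  have "joined p c d \<longleftrightarrow> d \<in> upper_cone B (\<sqsubseteq>) p c"
    using cone_eq_branch[of p c] assms True by auto
  moreover have "z \<in> B \<Longrightarrow> p \<sqsubseteq> z \<Longrightarrow> z \<sqsubseteq> d \<Longrightarrow> p \<sqsubseteq> d" for z
    using trans[of p z d] assms by blast
  ultimately show ?thesis using True assms(3) unfolding upper_cone_def by blast
next
  case False
  then have "joined p a c" by (simp add: below_def)
  then have "joined p c d \<longleftrightarrow> joined p a d" using joined_sym joined_trans by blast
  then show ?thesis using False by (simp add: below_def)
qed

text \<open>Let \<open>m\<close> be the meet; it differs from one of the two points, say
  \<open>y\<close>. Every branch point strictly between \<open>m\<close> and \<open>y\<close>
  separates, and two of these are produced, so one of them avoids the extra point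
  \<open>x0\<close>.\<close>

lemma separating_branch_point:
  assumes y: "y \<in> X" "y' \<in> X" "y \<noteq> y'"
  obtains q where "q \<in> B" "q \<noteq> y" "q \<noteq> y'" "q \<noteq> x0" "\<not> joined q y y'"
proof -
  have sep: "\<exists>q\<in>B. q \<noteq> y \<and> q \<noteq> y' \<and> q \<noteq> x0 \<and> \<not> joined q y y'"
    if X: "m \<in> X" "y \<in> X" "y' \<in> X" and m: "m \<sqsubseteq> y" "m \<noteq> y"
      and greatest: "\<And>z. \<lbrakk>z \<in> X; z \<sqsubseteq> y; z \<sqsubseteq> y'\<rbrakk> \<Longrightarrow> z \<sqsubseteq> m" for m y y'
  proof -
    obtain q1 where q1: "q1 \<in> B" "m \<sqsubseteq> q1" "m \<noteq> q1" "q1 \<sqsubseteq> y" "q1 \<noteq> y" using B_dense[OF X(1,2) m] .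
    obtain q2 where q2: "q2 \<in> B" "m \<sqsubseteq> q2" "m \<noteq> q2" "q2 \<sqsubseteq> q1" "q2 \<noteq> q1"
      using B_dense[OF X(1) B_in_X[OF q1(1)] q1(2,3)] .
    have q2y: "q2 \<sqsubseteq> y" "q2 \<noteq> y"
      using below_trans[of q2 q1 y] below_antisym[of q1 y] q1 q2 X B_in_X by blast+
    have main: "q \<noteq> y' \<and> \<not> joined q y y'" if q: "q \<in> B" "m \<sqsubseteq> q" "m \<noteq> q" "q \<sqsubseteq> y" for q
    proof -
      have "\<not> q \<sqsubseteq> y'" using greatest[of q] below_antisym[of m q] q X B_in_X by blast
      then have j: "joined q a y'" by (simp add: below_def)
      then have "q \<noteq> y'" using joined_in[of q a y'] by blast
      then show ?thesis using j q(4) unfolding below_def using joined_sym joined_trans by blast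
    qed
    show ?thesis
    proof (cases "q1 = x0")
      case True
      then show ?thesis using main[of q2] q2 q2y by blast
    next
      case False
      then show ?thesis using main[of q1] q1 by blast
    qed
  qed
  obtain m where m: "m \<in> X" "m \<sqsubseteq> y" "m \<sqsubseteq> y'" "\<And>z. \<lbrakk>z \<in> X; z \<sqsubseteq> y; z \<sqsubseteq> y'\<rbrakk> \<Longrightarrow> z \<sqsubseteq> m"
    using meet_exists[OF y(1,2)] by metis
  have "\<exists>q\<in>B. q \<noteq> y \<and> q \<noteq> y' \<and> q \<noteq> x0 \<and> \<not> joined q y y'"
  proof (cases "m = y")
    case False
    then show ?thesis using sep[of m y y'] m y by blast
  next
    case True
    then have "\<exists>q\<in>B. q \<noteq> y' \<and> q \<noteq> y \<and> q \<noteq> x0 \<and> \<not> joined q y' y"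
      using m y by (intro sep[of m y' y]) auto
    then show ?thesis using joined_sym by blast
  qed
  then show ?thesis using that by blast
qed

definition automorphism :: "('a \<Rightarrow> 'a) \<Rightarrow> bool" where
  "automorphism f \<longleftrightarrow> bij_betw f B B \<and> (\<forall>x\<in>B. \<forall>y\<in>B. x \<sqsubseteq> y \<longleftrightarrow> f x \<sqsubseteq> f y)"

lemma automorphismD:
  assumes "automorphism f"
  shows "x \<in> B \<Longrightarrow> f x \<in> B" "\<lbrakk>x \<in> B; y \<in> B\<rbrakk> \<Longrightarrow> f x = f y \<longleftrightarrow> x = y"
    "\<lbrakk>x \<in> B; y \<in> B\<rbrakk> \<Longrightarrow> f x \<sqsubseteq> f y \<longleftrightarrow> x \<sqsubseteq> y"
    "y \<in> B \<Longrightarrow> inv_into B f y \<in> B" "y \<in> B \<Longrightarrow> f (inv_into B f y) = y"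
proof -
  have f: "inj_on f B" "f ` B = B" using assms by (auto simp: automorphism_def bij_betw_def)
  show "x \<in> B \<Longrightarrow> f x \<in> B" using f(2) by blast
  show "\<lbrakk>x \<in> B; y \<in> B\<rbrakk> \<Longrightarrow> f x = f y \<longleftrightarrow> x = y" using f(1) by (auto dest: inj_onD)
  show "\<lbrakk>x \<in> B; y \<in> B\<rbrakk> \<Longrightarrow> f x \<sqsubseteq> f y \<longleftrightarrow> x \<sqsubseteq> y" using assms by (auto simp: automorphism_def)
  show "y \<in> B \<Longrightarrow> inv_into B f y \<in> B" using f(2) by (metis inv_into_into)
  show "y \<in> B \<Longrightarrow> f (inv_into B f y) = y" using f(2) by (metis f_inv_into_f)
qed

lemma automorphism_inv:
  assumes f: "automorphism f"
  shows "automorphism (inv_into B f)"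
  unfolding automorphism_def
proof (intro conjI ballI)
  show "bij_betw (inv_into B f) B B" using f by (simp add: automorphism_def bij_betw_inv_into)
  fix x y assume "x \<in> B" "y \<in> B"
  then show "x \<sqsubseteq> y \<longleftrightarrow> inv_into B f x \<sqsubseteq> inv_into B f y"
    using automorphismD(3)[OF f, of "inv_into B f x" "inv_into B f y"] automorphismD(4,5)[OF f] by simp
qed

lemma automorphism_joined_iff:
  assumes f: "automorphism f" and B: "p \<in> B" "c \<in> B" "d \<in> B" and ne: "p \<noteq> c" "p \<noteq> d"
  shows "joined (f p) (f c) (f d) \<longleftrightarrow> joined p c d"
proof -
  note fD = automorphismD[OF f]
  have "(\<exists>z\<in>B. f p \<sqsubseteq> z \<and> f p \<noteq> z \<and> z \<sqsubseteq> f c \<and> z \<sqsubseteq> f d) \<longleftrightarrow>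
    (\<exists>z\<in>B. p \<sqsubseteq> z \<and> p \<noteq> z \<and> z \<sqsubseteq> c \<and> z \<sqsubseteq> d)"
  proof
    assume "\<exists>z\<in>B. f p \<sqsubseteq> z \<and> f p \<noteq> z \<and> z \<sqsubseteq> f c \<and> z \<sqsubseteq> f d"
    then obtain z where z: "z \<in> B" "f p \<sqsubseteq> z" "f p \<noteq> z" "z \<sqsubseteq> f c" "z \<sqsubseteq> f d" by blast
    define w where "w = inv_into B f z"
    have "w \<in> B" "z = f w" using fD(4,5)[OF z(1)] by (auto simp: w_def)
    then show "\<exists>z\<in>B. p \<sqsubseteq> z \<and> p \<noteq> z \<and> z \<sqsubseteq> c \<and> z \<sqsubseteq> d" using z fD(2,3) B by blast
  next
    assume "\<exists>z\<in>B. p \<sqsubseteq> z \<and> p \<noteq> z \<and> z \<sqsubseteq> c \<and> z \<sqsubseteq> d"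
    then obtain z where z: "z \<in> B" "p \<sqsubseteq> z" "p \<noteq> z" "z \<sqsubseteq> c" "z \<sqsubseteq> d" by blast
    then show "\<exists>z\<in>B. f p \<sqsubseteq> z \<and> f p \<noteq> z \<and> z \<sqsubseteq> f c \<and> z \<sqsubseteq> f d"
      using fD(1-3) B by (intro bexI[of _ "f z"]) auto
  qed
  then show ?thesis
    using joined_B_iff[OF B ne] joined_B_iff[of "f p" "f c" "f d"] fD(1-3) B ne by simp
qed

text \<open>The image branch is replaced by its closure \<open>insert (f p) (branch (f p) (f c))\<close>: compactness then
  gives existence, and the graph of the extension is closed.\<close>
definition extends :: "('a \<Rightarrow> 'a) \<Rightarrow> 'a \<Rightarrow> 'a \<Rightarrow> bool" where
  "extends f x y \<longleftrightarrow> y \<in> X \<and> (\<forall>p\<in>B. \<forall>c\<in>B. joined p c x \<longrightarrow> y \<in> insert (f p) (branch (f p) (f c)))"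

text \<open>Finitely many conditions cut out an open set around \<open>x\<close>. It contains a
  branch point \<open>d\<close>, and \<open>f d\<close> satisfies the image conditions; compactness
  gives a point satisfying all of them.\<close>

lemma extends_exists:
  assumes f: "automorphism f" and x: "x \<in> X"
  obtains y where "extends f x y"
proof -
  note fD = automorphismD[OF f]
  define I where "I = {(p, c). p \<in> B \<and> c \<in> B \<and> joined p c x}"
  define T where "T = (\<lambda>(p, c). insert (f p) (branch (f p) (f c)))"
  have "X \<inter> (\<Inter>i\<in>I. T i) \<noteq> {}"
  proof (rule compact_imp_fip_image[OF compact_X])
    show "closed (T i)" if "i \<in> I" for i
      using that closed_insert_branch fD(1) B_in_X by (auto simp: I_def T_def)
    fix J assume J: "finite J" "J \<subseteq> I"
    define G where "G = \<Inter>(insert X ((\<lambda>(p, c). branch p c) ` J))"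
    have "openin (top_of_set X) G"
      unfolding G_def using J(1) openin_branch by (intro openin_Inter) auto
    moreover have "x \<in> G" using J x by (auto simp: G_def I_def)
    ultimately obtain d where d: "d \<in> B" "d \<in> G" using B_meets[of G] by blast
    have "f d \<in> T i" if i: "i \<in> J" for i
    proof -
      obtain p c where pc: "i = (p, c)" "p \<in> B" "c \<in> B" using i J unfolding I_def by blast
      have "joined p c d" using d(2) i pc(1) by (auto simp: G_def)
      then have "joined (f p) (f c) (f d)"
        using automorphism_joined_iff[OF f pc(2,3) d(1)] joined_in[of p c d] by auto
      then show ?thesis by (simp add: T_def pc(1))
    qed
    then show "X \<inter> (\<Inter>i\<in>J. T i) \<noteq> {}" using fD(1)[OF d(1)] B_in_X by blast
  qed
  then obtain y where "y \<in> X" "\<And>i. i \<in> I \<Longrightarrow> y \<in> T i" by blast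
  then have "extends f x y" unfolding extends_def I_def T_def by blast
  then show ?thesis by (rule that)
qed

text \<open>Pull a branch point \<open>q\<close> separating the two candidates back to
  \<open>p\<close>. Some branch at \<open>p\<close> contains \<open>x\<close>, and it forces both
  candidates into one branch at \<open>q\<close>. The choice \<open>q \<noteq> f x\<close> ensures
  that \<open>x\<close> differs from \<open>p\<close>.\<close>

lemma extends_unique:
  assumes f: "automorphism f" and x: "x \<in> X" and y: "extends f x y" "extends f x y'"
  shows "y = y'"
proof (rule ccontr)
  assume "y \<noteq> y'"
  moreover have yX: "y \<in> X" "y' \<in> X" using y by (auto simp: extends_def)
  ultimately obtain q where q: "q \<in> B" "q \<noteq> y" "q \<noteq> y'" "q \<noteq> f x" "\<not> joined q y y'"
    using separating_branch_point by metis
  define p where "p = inv_into B f q"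
  have p: "p \<in> B" "f p = q" using automorphismD(4,5)[OF f q(1)] by (auto simp: p_def)
  then have "x \<noteq> p" using q(4) by auto
  then obtain c where c: "c \<in> B" "joined p x c" using B_meets_branch[OF x] by metis
  have "joined q (f c) y" "joined q (f c) y'"
    using y p c joined_sym[OF c(2)] q(2,3) unfolding extends_def by blast+
  then show False using q(5) joined_sym joined_trans by blast
qed

definition extension :: "('a \<Rightarrow> 'a) \<Rightarrow> 'a \<Rightarrow> 'a" where
  "extension f x = (THE y. extends f x y)"

lemma extension_eqI: "\<lbrakk>automorphism f; x \<in> X; extends f x y\<rbrakk> \<Longrightarrow> extension f x = y"
  unfolding extension_def using extends_unique by blast

lemma extends_extension: "\<lbrakk>automorphism f; x \<in> X\<rbrakk> \<Longrightarrow> extends f x (extension f x)"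
  using extends_exists[of f x] extension_eqI by metis

lemma extension_in_X: "\<lbrakk>automorphism f; x \<in> X\<rbrakk> \<Longrightarrow> extension f x \<in> X"
  using extends_extension by (auto simp: extends_def)

lemma extension_B:
  assumes f: "automorphism f" and x: "x \<in> B"
  shows "extension f x = f x"
proof (rule extension_eqI[OF f B_in_X[OF x]])
  have "joined (f p) (f c) (f x)" if "p \<in> B" "c \<in> B" "joined p c x" for p c
    using automorphism_joined_iff[OF f that(1,2) x] that joined_in[OF that(3)] by auto
  then show "extends f x (f x)" using automorphismD(1)[OF f x] B_in_X by (auto simp: extends_def)
qed

text \<open>The point \<open>f p\<close>, added to close the branch, is not attained: a branch point
  \<open>q\<close> separating \<open>x\<close> from \<open>p\<close> would have an image on one side
  of which both \<open>f p\<close> and the image of \<open>x\<close> lie, although \<open>f\<close>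
  preserves separation.\<close>

lemma extension_joined:
  assumes f: "automorphism f" and x: "x \<in> X" and pc: "p \<in> B" "c \<in> B" "joined p c x"
  shows "joined (f p) (f c) (extension f x)"
proof -
  have "extension f x \<in> insert (f p) (branch (f p) (f c))"
    using extends_extension[OF f x] pc unfolding extends_def by blast
  moreover have "extension f x \<noteq> f p"
  proof
    assume eq: "extension f x = f p"
    have "x \<noteq> p" using joined_in[OF pc(3)] by blast
    then obtain q where q: "q \<in> B" "q \<noteq> x" "q \<noteq> p" "\<not> joined q x p"
      using separating_branch_point[OF x B_in_X[OF pc(1)]] by metis
    obtain d where d: "d \<in> B" "joined q x d" using B_meets_branch[OF x q(2)[symmetric]] .
    have "f p \<in> insert (f q) (branch (f q) (f d))"
      using extends_extension[OF f x] q(1) d(1) joined_sym[OF d(2)] eq unfolding extends_def by metis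
    moreover have "f p \<noteq> f q" using automorphismD(2)[OF f pc(1) q(1)] q(3) by simp
    ultimately have "joined (f q) (f d) (f p)" by blast
    then have "joined q d p"
      using automorphism_joined_iff[OF f q(1) d(1) pc(1)] q(3) joined_in[OF d(2)] by auto
    then show False using q(4) d(2) joined_trans by blast
  qed
  ultimately show ?thesis by blast
qed

lemma extension_joined_iff:
  assumes f: "automorphism f" and x: "x \<in> X" and pc: "p \<in> B" "c \<in> B"
  shows "joined (f p) (f c) (extension f x) \<longleftrightarrow> joined p c x"
proof
  assume j: "joined (f p) (f c) (extension f x)"
  have "x \<noteq> p" using joined_in[OF j] extension_B[OF f pc(1)] by auto
  then obtain d where d: "d \<in> B" "joined p x d" using B_meets_branch[OF x] by metis
  then have "joined (f p) (f d) (extension f x)" using extension_joined[OF f x pc(1) d(1)] joined_sym by blast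
  then have "joined (f p) (f c) (f d)" using j joined_sym joined_trans by blast
  moreover have "p \<noteq> c" "p \<noteq> d" using joined_in[OF j] joined_in[OF d(2)] by auto
  ultimately have "joined p c d" using automorphism_joined_iff[OF f pc d(1)] by blast
  then show "joined p c x" using d(2) joined_sym joined_trans by blast
qed (use extension_joined assms in blast)

text \<open>The root is no branch point, so \<open>f\<close> says nothing about it. A branch point
  \<open>c\<close> strictly below \<open>p\<close> represents the root's side of \<open>p\<close>,
  and its image represents the root's side of \<open>f p\<close>.\<close>

lemma extension_below_iff:
  assumes f: "automorphism f" and x: "x \<in> X" and p: "p \<in> B"
  shows "f p \<sqsubseteq> extension f x \<longleftrightarrow> p \<sqsubseteq> x"
proof -
  obtain c where c: "c \<in> B" "c \<sqsubseteq> p" "c \<noteq> p" using no_min p by blast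
  have "\<not> p \<sqsubseteq> c" using antisym[of c p] c p by blast
  moreover from this have "\<not> f p \<sqsubseteq> f c" using automorphismD(3)[OF f p c(1)] by simp
  ultimately have j: "joined p a c" "joined (f p) a (f c)" by (simp_all add: below_def)
  have "joined (f p) a (extension f x) \<longleftrightarrow> joined (f p) (f c) (extension f x)"
    using j(2) joined_sym joined_trans by blast
  also have "\<dots> \<longleftrightarrow> joined p c x" by (rule extension_joined_iff[OF f x p c(1)])
  also have "\<dots> \<longleftrightarrow> joined p a x" using j(1) joined_sym joined_trans by blast
  finally show ?thesis by (simp add: below_def)
qed

lemma extension_inverse:
  assumes f: "automorphism f" and x: "x \<in> X"
  shows "extension (inv_into B f) (extension f x) = x"
proof (rule extension_eqI[OF automorphism_inv[OF f] extension_in_X[OF f x]])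
  have "joined (inv_into B f p) (inv_into B f c) x"
    if "p \<in> B" "c \<in> B" "joined p c (extension f x)" for p c
    using extension_joined_iff[OF f x, of "inv_into B f p" "inv_into B f c"] that automorphismD(4,5)[OF f]
    by simp
  then show "extends (inv_into B f) (extension f x) x" using x unfolding extends_def by blast
qed

text \<open>A map into a compact space with closed graph is continuous: preimages of closed sets are
  projections of compact sets.\<close>

lemma continuous_on_extension:
  assumes f: "automorphism f"
  shows "continuous_on X (extension f)"
proof -
  \<comment> \<open>The graph, with each implication in \<open>extends\<close> written as a union of
    two closed sets.\<close>
  define \<Gamma> where "\<Gamma> = (X \<times> X) \<inter> (\<Inter>p\<in>B. \<Inter>c\<in>B.
    (X - branch p c) \<times> UNIV \<union> UNIV \<times> insert (f p) (branch (f p) (f c)))"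
  have "closed (X - branch p c)" for p c
  proof -
    have "closedin (top_of_set X) (X - branch p c)" using openin_branch by (simp add: closedin_diff)
    then show ?thesis using compact_X compact_imp_closed closedin_closed_trans by blast
  qed
  moreover have "closed (insert (f p) (branch (f p) (f c)))" if "p \<in> B" for p c
    using closed_insert_branch automorphismD(1)[OF f that] B_in_X by blast
  ultimately have "compact \<Gamma>"
    unfolding \<Gamma>_def
    by (intro compact_Int_closed compact_Times compact_X closed_INT ballI closed_Un closed_Times closed_UNIV)
  have \<Gamma>: "(x, y) \<in> \<Gamma> \<longleftrightarrow> x \<in> X \<and> extends f x y" for x y
    unfolding \<Gamma>_def extends_def by blast
  have "closed (extension f -` C \<inter> X)" if "closed C" for C
  proof -
    have "extension f -` C \<inter> X = fst ` (\<Gamma> \<inter> UNIV \<times> C)"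
    proof (intro equalityI subsetI)
      fix x assume "x \<in> extension f -` C \<inter> X"
      then have "(x, extension f x) \<in> \<Gamma> \<inter> UNIV \<times> C" using \<Gamma> extends_extension[OF f] by auto
      then show "x \<in> fst ` (\<Gamma> \<inter> UNIV \<times> C)" by force
    next
      fix x assume "x \<in> fst ` (\<Gamma> \<inter> UNIV \<times> C)"
      then obtain y where "(x, y) \<in> \<Gamma>" "y \<in> C" by auto
      then show "x \<in> extension f -` C \<inter> X" using \<Gamma> extension_eqI[OF f] by auto
    qed
    moreover have "compact (fst ` (\<Gamma> \<inter> UNIV \<times> C))"
      using \<open>compact \<Gamma>\<close> that
      by (intro compact_continuous_image continuous_intros compact_Int_closed closed_Times) auto
    ultimately show ?thesis by (simp add: compact_imp_closed)
  qed
  then show ?thesis using continuous_on_closed_vimage[of X] compact_X compact_imp_closed by blast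
qed

lemma homeomorphism_extension:
  assumes f: "automorphism f"
  shows "homeomorphism X X (extension f) (extension (inv_into B f))"
proof -
  note g = automorphism_inv[OF f]
  \<comment> \<open>The double inverse is compared with \<open>f\<close> on the branch points only;
    this suffices, as \<open>extends\<close> evaluates its function nowhere else.\<close>
  have "inv_into B (inv_into B f) p = f p" if "p \<in> B" for p
    using automorphismD(1)[OF f that] f that
    by (intro inv_into_f_eq) (auto simp: automorphism_def bij_betw_def inj_on_inv_into inv_into_into)
  then have same: "extends (inv_into B (inv_into B f)) x y \<longleftrightarrow> extends f x y" for x y
    unfolding extends_def by simp
  then have "extension (inv_into B (inv_into B f)) x = extension f x" for x
    by (simp add: extension_def)
  then have "extension f (extension (inv_into B f) y) = y" if "y \<in> X" for y
    using extension_inverse[OF g that] by simp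
  then show ?thesis
    using continuous_on_extension[OF f] continuous_on_extension[OF g] extension_inverse[OF f]
      extension_in_X[OF f] extension_in_X[OF g]
    by (intro homeomorphismI) auto
qed

section \<open>The north-south homeomorphism of a universal dendrite\<close>

lemma root_meet:
  assumes "x \<in> X" "y \<in> X" "x \<noteq> a" "y \<noteq> a"
  obtains z where "z \<in> X" "z \<noteq> a" "z \<sqsubseteq> x" "z \<sqsubseteq> y"
  using joined_above_iff[of a x y] endpoint[of x y] root assms by auto

theorem shadowing_homeomorphism_exists:
  assumes "b \<in> X" "b \<noteq> a" and b_max: "\<And>y. \<lbrakk>y \<in> X; b \<sqsubseteq> y\<rbrakk> \<Longrightarrow> y = b"
  shows "\<exists>g h. homeomorphism X X g h \<and> shadowing_property X g"
proof -
  define C where "C = {c \<in> B. c \<sqsubseteq> b \<and> c \<noteq> b}"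
  have C_sub: "C \<subseteq> B" by (auto simp: C_def)
  have C_ex: "\<exists>c\<in>C. u \<sqsubseteq> c \<and> u \<noteq> c \<and> c \<sqsubseteq> v \<and> c \<noteq> v"
    if uv: "u \<in> X" "v \<in> X" "u \<sqsubseteq> v" "u \<noteq> v" "v \<sqsubseteq> b" for u v
  proof -
    obtain c where c: "c \<in> B" "u \<sqsubseteq> c" "u \<noteq> c" "c \<sqsubseteq> v" "c \<noteq> v" using B_dense[OF uv(1-4)] .
    have "c \<sqsubseteq> b" using below_trans[of c v b] c uv assms(1) B_in_X by blast
    moreover have "c \<noteq> b" using b_max[of v] c uv by blast
    ultimately show ?thesis using c by (auto simp: C_def)
  qed
  have C_X: "c \<in> X" "c \<noteq> a" "c \<sqsubseteq> b" "c \<noteq> b" if "c \<in> C" for c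
    using that B_in_X root_notin_B by (auto simp: C_def)
  have b_notin_B: "b \<notin> B" using no_max b_max B_in_X by blast
  have "C \<noteq> {}" using C_ex[of a b] root assms by auto
  then have "\<exists>p :: int \<Rightarrow> 'a. (\<forall>i. p i \<in> C \<and> p i \<sqsubseteq> p (i + 1) \<and> p i \<noteq> p (i + 1)) \<and>
    (\<forall>c\<in>C. (\<exists>i. p i \<sqsubseteq> c) \<and> (\<exists>i. c \<sqsubseteq> p i))"
  proof (rule bi_cofinal_sequence[OF countable_subset[OF C_sub countable_branch_points] _ C_sub])
    show "x \<sqsubseteq> y \<or> y \<sqsubseteq> x" if "x \<in> C" "y \<in> C" for x y
      using below_linear[of x y b] C_X[OF that(1)] C_X[OF that(2)] assms(1) by blast
    show "\<exists>y\<in>C. x \<sqsubseteq> y \<and> x \<noteq> y" if "x \<in> C" for x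
      using C_ex[of x b] C_X[OF that] assms(1) by auto
    show "\<exists>y\<in>C. y \<sqsubseteq> x \<and> x \<noteq> y" if "x \<in> C" for x
      using C_ex[of a x] C_X[OF that] root by auto
  qed
  then obtain p :: "int \<Rightarrow> 'a" where p: "\<And>i. p i \<in> C" "\<And>i. p i \<sqsubseteq> p (i + 1)" "\<And>i. p i \<noteq> p (i + 1)"
    "\<And>c. c \<in> C \<Longrightarrow> \<exists>i. p i \<sqsubseteq> c" "\<And>c. c \<in> C \<Longrightarrow> \<exists>i. c \<sqsubseteq> p i" by blast
  have pB: "p i \<in> B" and pX: "p i \<in> X" and pa: "p i \<noteq> a" and pb: "p i \<sqsubseteq> b" for i
    using p(1)[of i] C_sub C_X by auto
  \<comment> \<open>By \<open>root_meet\<close>, \<open>x\<close> and \<open>b\<close> have a common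
    lower bound \<open>z\<close> other than the root; it lies on the arc to \<open>b\<close>, where
    the \<open>p i\<close> descend to the root.\<close>
  have P1: "\<exists>i. p i \<sqsubseteq> x \<and> p i \<noteq> x" if x: "x \<in> X" "x \<noteq> a" for x
  proof -
    obtain z where z: "z \<in> X" "z \<noteq> a" "z \<sqsubseteq> x" "z \<sqsubseteq> b" using root_meet[OF x(1) assms(1) x(2) assms(2)] .
    obtain c where c: "c \<in> C" "c \<sqsubseteq> z" "c \<noteq> z" using C_ex[of a z] z root by auto
    obtain i where i: "p i \<sqsubseteq> c" using p(4) c by blast
    have "p i \<sqsubseteq> z" using below_trans[of "p i" c z] i c z pX C_X by blast
    then have "p i \<sqsubseteq> x" using below_trans[of "p i" z x] z pX x by blast
    moreover have "p i \<noteq> x"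
    proof
      assume "p i = x"
      then have "z \<sqsubseteq> c" using below_trans[of z x c] z i x C_X[OF c(1)] by auto
      then show False using below_antisym[of c z] c z C_X[OF c(1)] by auto
    qed
    ultimately show ?thesis by blast
  qed
  \<comment> \<open>By maximality of \<open>b\<close>, the meet of \<open>x\<close> and
    \<open>b\<close> is strictly below \<open>b\<close>, and the \<open>p i\<close> pass it.\<close>
  have P2: "\<exists>i. \<not> p i \<sqsubseteq> x" if x: "x \<in> X" "x \<noteq> b" for x
  proof -
    obtain m where m: "m \<in> X" "m \<sqsubseteq> x" "m \<sqsubseteq> b" "\<And>z. \<lbrakk>z \<in> X; z \<sqsubseteq> x; z \<sqsubseteq> b\<rbrakk> \<Longrightarrow> z \<sqsubseteq> m"
      using meet_exists[OF x(1) assms(1)] by metis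
    have "m \<noteq> b" using b_max[OF x(1)] m(2) x(2) by auto
    then obtain c where c: "c \<in> C" "m \<sqsubseteq> c" "m \<noteq> c" using C_ex[of m b] m assms(1) by auto
    obtain i where i: "c \<sqsubseteq> p i" using p(5) c by blast
    have "\<not> p i \<sqsubseteq> x"
    proof
      assume "p i \<sqsubseteq> x"
      then have "p i \<sqsubseteq> m" using m(4) pX pb by blast
      then have "c \<sqsubseteq> m" using below_trans[of c "p i" m] i pX C_X[OF c(1)] m(1) by blast
      then show False using below_antisym[of c m] c C_X[OF c(1)] m(1) by auto
    qed
    then show ?thesis by blast
  qed
  have "\<exists>f. bij_betw f B B \<and> (\<forall>x\<in>B. \<forall>y\<in>B. x \<sqsubseteq> y \<longleftrightarrow> f x \<sqsubseteq> f y) \<and> (\<forall>i. f (p i) = p (i + 1))"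
  proof (rule shift_automorphism[where p = p, OF countable_branch_points pB p(2,3)])
    show "\<exists>i. p i \<sqsubseteq> x" if "x \<in> B" for x using P1[of x] that B_in_X root_notin_B by blast
    show "\<exists>i. \<not> p i \<sqsubseteq> x" if "x \<in> B" for x using P2[of x] that B_in_X b_notin_B by blast
  qed
  then obtain f where auto: "automorphism f" and f_p: "\<And>i. f (p i) = p (i + 1)"
    unfolding automorphism_def by blast
  define F where "F = extension f"
  have F_in: "F x \<in> X" if "x \<in> X" for x using extension_in_X[OF auto that] by (simp add: F_def)
  have F_p: "p (i + 1) \<sqsubseteq> F x \<longleftrightarrow> p i \<sqsubseteq> x" if "x \<in> X" for i x
    using extension_below_iff[OF auto that pB[of i]] f_p by (simp add: F_def)
  have F_p': "p i \<sqsubseteq> F x \<longleftrightarrow> p (i - 1) \<sqsubseteq> x" if "x \<in> X" for i x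
    using F_p[OF that, of "i - 1"] by simp
  \<comment> \<open>By \<open>P1\<close> and \<open>P2\<close>, \<open>a\<close> is the only point
    above no \<open>p i\<close>, and \<open>b\<close> the only one above all of them.
    \<open>F\<close> shifts the conditions by one index and so preserves both properties.\<close>
  have Fa: "F a = a"
  proof (rule ccontr)
    assume "F a \<noteq> a"
    then obtain i where "p i \<sqsubseteq> F a" using P1[OF F_in[OF root]] by blast
    then show False using F_p'[OF root] below_root[OF pX] pa by blast
  qed
  have Fb: "F b = b"
  proof (rule ccontr)
    assume "F b \<noteq> b"
    then obtain i where "\<not> p i \<sqsubseteq> F b" using P2[OF F_in[OF assms(1)]] by blast
    then show False using F_p'[OF assms(1)] pb by blast
  qed
  \<comment> \<open>The root's side of \<open>p i\<close>, closed by adding \<open>p i\<close>. It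
    meets \<open>up (p i)\<close> in \<open>p i\<close> alone, hence is disjoint from
    \<open>up (p (i + 1))\<close>.\<close>
  define L where "L i = insert (p i) (branch (p i) a)" for i
  have up_iff: "x \<in> up (p i) \<longleftrightarrow> x \<in> X \<and> p i \<sqsubseteq> x" for x i by (simp add: up_def)
  have L_iff: "x \<in> L i \<longleftrightarrow> x \<in> X \<and> (x = p i \<or> \<not> p i \<sqsubseteq> x)" for x i
    using pX[of i] branch_subset[of "p i" a] by (auto simp: L_def below_def)
  have "shadowing_property X F"
  proof (rule north_south_shadowing)
    show "compact X" by (rule compact_X)
    show "homeomorphism X X F (extension (inv_into B f))"
      unfolding F_def by (rule homeomorphism_extension[OF auto])
    show "F a = a" "F b = b" by fact+
    show "compact (up (p i))" for i by (rule compact_up)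
    show "compact (L i)" for i
    proof -
      have "compact (X \<inter> L i)" unfolding L_def by (intro compact_Int_closed compact_X closed_insert_branch pX)
      moreover have "X \<inter> L i = L i" using L_iff by blast
      ultimately show ?thesis by simp
    qed
    show "up (p i) \<union> L i = X" for i using up_iff L_iff by blast
    show "up (p (i + 1)) \<inter> L i = {}" for i
    proof -
      have False if x: "x \<in> X" "p (i + 1) \<sqsubseteq> x" "x = p i \<or> \<not> p i \<sqsubseteq> x" for x
        using x below_trans[of "p i" "p (i + 1)" x] below_antisym[of "p i" "p (i + 1)"] p(2,3)[of i] pX by blast
      then show ?thesis using up_iff L_iff by blast
    qed
    show "F x \<in> up (p (i + 1))" if "x \<in> up (p i)" for i x
      using that F_p F_in by (simp add: up_iff)
    show "(\<Inter>i. up (p i)) = {b}"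
    proof (intro equalityI subsetI)
      fix x assume "x \<in> (\<Inter>i. up (p i))"
      then have "x \<in> X" "\<And>i. p i \<sqsubseteq> x" by (auto simp: up_iff)
      then show "x \<in> {b}" using P2 by blast
    qed (use pb assms(1) in \<open>auto simp: up_iff\<close>)
    show "(\<Inter>i. L i) = {a}"
    proof (intro equalityI subsetI)
      fix x assume "x \<in> (\<Inter>i. L i)"
      then have "x \<in> X" "\<And>i. x = p i \<or> \<not> p i \<sqsubseteq> x" by (auto simp: L_iff)
      then show "x \<in> {a}" using P1[of x] by (metis singletonI)
    next
      fix x assume "x \<in> {a}"
      moreover have "\<not> p i \<sqsubseteq> a" for i using below_root[OF pX] pa by blast
      ultimately show "x \<in> (\<Inter>i. L i)" using root by (auto simp: L_iff)
    qed
  qed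
  then show ?thesis using homeomorphism_extension[OF auto] unfolding F_def by blast
qed

end

lemma singleton_shadowing_homeomorphism:
  fixes a :: "'a::metric_space"
  shows "\<exists>g h. homeomorphism {a} {a} g h \<and> shadowing_property {a} g"
proof (intro exI conjI)
  show "homeomorphism {a} {a} id id" by (auto simp: homeomorphism_def)
  have "int_iterate {a} id k a = a" for k
    using int_iterate_in[of id "{a}" a k] by simp
  then show "shadowing_property {a} id"
    unfolding shadowing_property_def by (auto intro!: exI[of _ 1])
qed

lemma dendrite_tree_space:
  assumes X: "dendrite X"
  shows "tree_space X"
proof
  show "compact X" "connected X" "locally connected X" using X by (auto simp: dendrite_def)
  show "\<exists>p\<in>X. p \<noteq> x \<and> p \<noteq> y \<and> \<not> connected_component (X - {p}) x y"
    if "x \<in> X" "y \<in> X" "x \<noteq> y" for x y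
    using dendrite_separation[OF X that] by metis
qed

text \<open>An end point to serve as root is found by rooting twice. For the order with an arbitrary
  root \<open>r\<close>, a maximal \<open>e\<close> separates \<open>r\<close> from no other point,
  so its complement is a single component. With \<open>e\<close> as the new root, a maximal
  \<open>b\<close> above \<open>r\<close> is chosen; starting from \<open>x0 \<noteq> r\<close> and
  from \<open>r \<noteq> e\<close> keeps \<open>e\<close>, \<open>r\<close> and then
  \<open>b\<close>, \<open>e\<close> distinct.\<close>

lemma universal_dendrite_shadowing_homeomorphism:
  fixes X :: "'a::metric_space set"
  assumes X: "dendrite X" and dense: "X \<subseteq> closure (branch_points X)"
    and order: "\<And>p. p \<in> branch_points X \<Longrightarrow> point_order X p = n"
  shows "\<exists>g h. homeomorphism X X g h \<and> shadowing_property X g"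
proof -
  interpret tree_space X using dendrite_tree_space[OF X] .
  have "branch_points X \<noteq> {}" using X dense by (auto simp: dendrite_def)
  then obtain p where "p \<in> branch_points X" by blast
  then obtain r x0 where "r \<in> X - {p}" "x0 \<in> X - {p}" "\<not> joined p r x0"
    using branch_pointE by metis
  then have r: "r \<in> X" "x0 \<in> X" "x0 \<noteq> r" using joined_refl[of r p] by auto
  interpret R: rooted_tree_space X r by unfold_locales (rule r)
  obtain e where e: "e \<in> X" "R.below x0 e" "\<And>y. \<lbrakk>y \<in> X; R.below e y\<rbrakk> \<Longrightarrow> y = e"
    using R.maximal_above[OF r(2)] by metis
  have from_r: "joined e r x" if x: "x \<in> X" "x \<noteq> e" for x
    using e(3)[OF x(1)] x(2) unfolding R.below_def by blast
  have endpoint: "joined e x y" if "x \<in> X" "y \<in> X" "x \<noteq> e" "y \<noteq> e" for x y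
    using joined_trans[OF joined_sym[OF from_r[OF that(1,3)]] from_r[OF that(2,4)]] .
  interpret U: universal_tree_space X e n
    by unfold_locales (fact e(1) endpoint dense order)+
  have "e \<noteq> r" using R.below_root[OF r(2)] e(2) r(3) by metis
  obtain b where b: "b \<in> X" "U.below r b" "\<And>y. \<lbrakk>y \<in> X; U.below b y\<rbrakk> \<Longrightarrow> y = b"
    using U.maximal_above[OF r(1)] by metis
  have "b \<noteq> e" using U.below_root[OF r(1)] b(2) \<open>e \<noteq> r\<close> by metis
  show ?thesis by (rule U.shadowing_homeomorphism_exists[OF b(1) \<open>b \<noteq> e\<close> b(3)])
qed

theorem theorem3p26:
  fixes n :: enat and X :: "'a::metric_space set"
  assumes "1 \<le> n" and "universal_dendrite n X"
  shows "\<exists>g h. homeomorphism X X g h \<and> shadowing_property X g"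
proof -
  consider a where "X = {a}" | "X homeomorphic {0..1::real}"
    | "dendrite X" "X \<subseteq> closure (branch_points X)" "\<And>p. p \<in> branch_points X \<Longrightarrow> point_order X p = n"
    using assms(2) unfolding universal_dendrite_def by metis
  then show ?thesis
  proof cases
    case 1
    then show ?thesis using singleton_shadowing_homeomorphism by simp
  next
    case 2
    then show ?thesis by (rule arc_shadowing_homeomorphism)
  next
    case 3
    then show ?thesis by (rule universal_dendrite_shadowing_homeomorphism)
  qed
qed

end
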